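(* Let $G$ be the simply connected $4$-dimensional real Lie group whose Lie algebra $\mathfrak{g}$ has a basis $\{X,Y,Z,W\}$ with $$[Y,Z]=W,\qquad [Z,W]=Y,\qquad [W,Y]=Z,\qquad X \text{ central}.$$ Let $g$ be the left invariant Riemannian metric on $G$ for which $\{X,Y,Z,W\}$ is orthonormal. Let $q\in\mathbb{R}$ with $0<|q|<1$, let $Q=qX$ (a left invariant vector field on $G$), and let $F$ be the left invariant Randers metric $$F(x,y)=\sqrt{g(x)(y,y)}+g(x)(Q(x),y),\qquad x\in G,\ y\in T_xG.$$ Then $F$ is of Berwald type, $(G,F)$ is geodesically complete, and its flag curvature is given as follows: if $U=aX+bY+cZ+dW$ and $V=\tilde aX+\tilde bY+\tilde cZ+\tilde dW$ in $\mathfrak{g}$ are orthonormal with respect to $g$ and $P=\mathrm{span}\{U,V\}$, then $$K(P,U)=\frac{(b\tilde c-c\tilde b)^2+(b\tilde d-d\tilde b)^2+(c\tilde d-d\tilde c)^2}{4(1+aq)^2}\ \ge\ 0 .$$ In particular, $(G,F)$ has non-negative flag curvature.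
   Context: Elements of the Lie algebra $\mathfrak{g}$ are identified with left invariant vector fields on $G$. A Riemannian metric $g$ on $G$ is left invariant if $g(x)(y,z)=g(e)(T_xl_{x^{-1}}y,T_xl_{x^{-1}}z)$ for all $x\in G$ and $y,z\in T_xG$, where $l_a$ is left translation by $a$ and $e$ is the unit element. A Finsler metric $F$ is left invariant if $F(x,y)=F(e,T_xl_{x^{-1}}y)$. A Finsler metric on a manifold $M$ is a non-negative function $F:TM\to\mathbb{R}$, smooth on $TM\setminus\{0\}$, with $F(x,\lambda y)=\lambda F(x,y)$ for $\lambda>0$, and with positive definite Hessian $\left[\frac12\frac{\partial^2F^2}{\partial y^i\partial y^j}\right]$ at every $(x,y)$ with $y\neq0$. A Randers metric is a Finsler metric of the form $F(x,y)=\sqrt{g(x)(y,y)}+g(x)(Q(x),y)$ with $g$ a Riemannian metric and $Q$ a vector field satisfying $\sqrt{g(Q,Q)}<1$. A Finsler metric is of Berwald type if the coefficients of its Chern connection in natural coordinates depend only on the base point $x$, so that the Chern connection defines an affine connection on $M$. The Randers metric above is of Berwald type if and only if $Q$ is parallel with respect to the Levi-Civita connection of $g$; in that case the Chern connection of $F$ is the Levi-Civita connection of $g$, and the curvature tensors and geodesics of $F$ and $g$ coincide. Geodesically complete means that every geodesic extends to all of $\mathbb{R}$. Flag curvature: for a nonzero tangent vector $U$ and a tangent plane $P=\mathrm{span}\{U,V\}$ at the same point, $$K(P,U)=\frac{g_U(R(V,U)U,V)}{g_U(U,U)\,g_U(V,V)-g_U(U,V)^2},$$ where $g_U(V_1,V_2)=\frac12\frac{\partial^2}{\partial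 s\,\partial t}F^2(U+sV_1+tV_2)\big|_{s=t=0}$, $R(V,U)U=\nabla_V\nabla_UU-\nabla_U\nabla_VU-\nabla_{[V,U]}U$, and $\nabla$ is the Chern connection of $F$. Non-negative flag curvature means $K(P,U)\ge0$ for all such pairs $(P,U)$. *)

theory Defs
  imports "HOL-Analysis.Analysis" "HOL-Library.Function_Algebras"
begin

text \<open>Pointwise scalar multiplication: tangent vectors and vector fields are encoded below as
  functions, and this makes \<open>span\<close> and \<open>independent\<close> available for them.\<close>

instantiation "fun" :: (type, real_vector) real_vector
begin

definition "r *\<^sub>R f = (\<lambda>x. r *\<^sub>R f x)"

instance
  by standard (simp_all add: scaleR_fun_def fun_eq_iff algebra_simps)

end

lemma scaleR_fun_apply [simp]: "(r *\<^sub>R f) x = r *\<^sub>R f x"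
  by (simp add: scaleR_fun_def)


section \<open>Smooth functions on open subsets of normed spaces\<close>

text \<open>\<open>Ck_on k S f\<close> is only meant for open \<open>S\<close>.\<close>

primrec Ck_on ::
  "nat \<Rightarrow> 'a::real_normed_vector set \<Rightarrow> ('a \<Rightarrow> 'b::real_normed_vector) \<Rightarrow> bool" where
  "Ck_on 0 S f \<longleftrightarrow> continuous_on S f"
| "Ck_on (Suc k) S f \<longleftrightarrow> (\<forall>x\<in>S. f differentiable (at x)) \<and>
     (\<forall>v. Ck_on k S (\<lambda>x. frechet_derivative f (at x) v))"

definition smooth_on ::
  "'a::real_normed_vector set \<Rightarrow> ('a \<Rightarrow> 'b::real_normed_vector) \<Rightarrow> bool" where
  "smooth_on S f \<longleftrightarrow> (\<forall>k. Ck_on k S f)"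

definition partial :: "'n::finite \<Rightarrow> (real^'n \<Rightarrow> real) \<Rightarrow> real^'n \<Rightarrow> real" where
  "partial i f x = deriv (\<lambda>t. f (x + t *\<^sub>R axis i 1)) 0"


section \<open>Smooth manifolds and Lie groups\<close>

text \<open>A chart is a pair of a domain and a coordinate map; outside the domain the values of the
  coordinate map are irrelevant. The manifold is the whole type \<open>'a\<close>, with the smooth structure
  given by an atlas (not required to be maximal).\<close>

type_synonym ('a, 'n) chart = "'a set \<times> ('a \<Rightarrow> real^'n)"

definition chart_image :: "('a, 'n::finite) chart \<Rightarrow> (real^'n) set" where
  "chart_image c = snd c ` fst c"

definition chart_inv :: "('a, 'n::finite) chart \<Rightarrow> real^'n \<Rightarrow> 'a" where
  "chart_inv c = inv_into (fst c) (snd c)"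

definition is_chart :: "('a::topological_space, 'n::finite) chart \<Rightarrow> bool" where
  "is_chart c \<longleftrightarrow> open (fst c) \<and> open (chart_image c) \<and>
     homeomorphism (fst c) (chart_image c) (snd c) (chart_inv c)"

definition smooth_manifold ::
  "('a::{t2_space,second_countable_topology}, 'n::finite) chart set \<Rightarrow> bool" where
  "smooth_manifold A \<longleftrightarrow> (\<forall>c\<in>A. is_chart c) \<and> (\<Union>c\<in>A. fst c) = UNIV \<and>
     (\<forall>c\<in>A. \<forall>d\<in>A. smooth_on (snd c ` (fst c \<inter> fst d)) (snd d \<circ> chart_inv c))"

definition smooth_map ::
  "('a::topological_space, 'n::finite) chart set \<Rightarrow> ('a \<Rightarrow> 'a) \<Rightarrow> bool" where
  "smooth_map A f \<longleftrightarrow> continuous_on UNIV f \<and>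
     (\<forall>c\<in>A. \<forall>d\<in>A. smooth_on (snd c ` (fst c \<inter> f -` fst d)) (snd d \<circ> f \<circ> chart_inv c))"

definition smooth_map2 ::
  "('a::topological_space, 'n::finite) chart set \<Rightarrow> ('a \<Rightarrow> 'a \<Rightarrow> 'a) \<Rightarrow> bool" where
  "smooth_map2 A f \<longleftrightarrow> continuous_on UNIV (\<lambda>(x, y). f x y) \<and>
     (\<forall>c\<in>A. \<forall>d\<in>A. \<forall>e\<in>A.
        smooth_on {(u, v). u \<in> chart_image c \<and> v \<in> chart_image d \<and>
                           f (chart_inv c u) (chart_inv d v) \<in> fst e}
                  (\<lambda>(u, v). snd e (f (chart_inv c u) (chart_inv d v))))"

definition lie_group ::
  "('a::{t2_space,second_countable_topology}, 'n::finite) chart set \<Rightarrow>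
   ('a \<Rightarrow> 'a \<Rightarrow> 'a) \<Rightarrow> 'a \<Rightarrow> ('a \<Rightarrow> 'a) \<Rightarrow> bool" where
  "lie_group A mul e ginv \<longleftrightarrow> smooth_manifold A \<and> group mul e ginv \<and>
     smooth_map2 A mul \<and> smooth_map A ginv"


section \<open>Tangent vectors and vector fields\<close>

text \<open>A tangent vector at \<open>p\<close> is the family of its component vectors in all charts around \<open>p\<close>,
  related by the Jacobians of the coordinate changes (and \<open>0\<close> at all other charts, so that
  equality of families is equality of tangent vectors).\<close>

type_synonym ('a, 'n) tvec = "('a, 'n) chart \<Rightarrow> real^'n"
type_synonym ('a, 'n) vfield = "'a \<Rightarrow> ('a, 'n) tvec"

definition tangent_space :: "('a, 'n::finite) chart set \<Rightarrow> 'a \<Rightarrow> ('a, 'n) tvec set" where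
  "tangent_space A p = {v.
     (\<forall>c\<in>A. \<forall>d\<in>A. p \<in> fst c \<and> p \<in> fst d \<longrightarrow>
        v d = frechet_derivative (snd d \<circ> chart_inv c) (at (snd c p)) (v c)) \<and>
     (\<forall>c. \<not> (c \<in> A \<and> p \<in> fst c) \<longrightarrow> v c = 0)}"

text \<open>\<open>coord_vec A c p y\<close> is the tangent vector at \<open>p\<close> with components \<open>y\<close> in the chart \<open>c\<close>.\<close>

definition coord_vec ::
  "('a, 'n::finite) chart set \<Rightarrow> ('a, 'n) chart \<Rightarrow> 'a \<Rightarrow> real^'n \<Rightarrow> ('a, 'n) tvec" where
  "coord_vec A c p y = (\<lambda>d. if d \<in> A \<and> p \<in> fst d
     then frechet_derivative (snd d \<circ> chart_inv c) (at (snd c p)) y else 0)"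

text \<open>The differential of \<open>f\<close> at \<open>p\<close>; the choice of the chart \<open>c\<close> around \<open>p\<close> does not matter.\<close>

definition tangent_map ::
  "('a, 'n::finite) chart set \<Rightarrow> ('a \<Rightarrow> 'a) \<Rightarrow> 'a \<Rightarrow> ('a, 'n) tvec \<Rightarrow> ('a, 'n) tvec" where
  "tangent_map A f p v = (\<lambda>d. if d \<in> A \<and> f p \<in> fst d
     then (let c = (SOME c. c \<in> A \<and> p \<in> fst c)
           in frechet_derivative (snd d \<circ> f \<circ> chart_inv c) (at (snd c p)) (v c))
     else 0)"

definition smooth_vfield :: "('a, 'n::finite) chart set \<Rightarrow> ('a, 'n) vfield \<Rightarrow> bool" where
  "smooth_vfield A V \<longleftrightarrow> (\<forall>p. V p \<in> tangent_space A p) \<and>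
     (\<forall>c\<in>A. smooth_on (chart_image c) (\<lambda>u. V (chart_inv c u) c))"

definition lie_bracket ::
  "('a, 'n::finite) chart set \<Rightarrow> ('a, 'n) vfield \<Rightarrow> ('a, 'n) vfield \<Rightarrow> ('a, 'n) vfield" where
  "lie_bracket A V W = (\<lambda>p c. if c \<in> A \<and> p \<in> fst c
     then frechet_derivative (\<lambda>u. W (chart_inv c u) c) (at (snd c p)) (V p c)
        - frechet_derivative (\<lambda>u. V (chart_inv c u) c) (at (snd c p)) (W p c)
     else 0)"

definition lie_algebra ::
  "('a, 'n::finite) chart set \<Rightarrow> ('a \<Rightarrow> 'a \<Rightarrow> 'a) \<Rightarrow> ('a, 'n) vfield set" where
  "lie_algebra A mul = {V. smooth_vfield A V \<and>
     (\<forall>a p. V (mul a p) = tangent_map A (mul a) p (V p))}"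


section \<open>Riemannian, Finsler and Randers metrics\<close>

definition riemannian_metric ::
  "('a, 'n::finite) chart set \<Rightarrow> ('a \<Rightarrow> ('a, 'n) tvec \<Rightarrow> ('a, 'n) tvec \<Rightarrow> real) \<Rightarrow> bool" where
  "riemannian_metric A g \<longleftrightarrow>
     (\<forall>p. \<forall>u\<in>tangent_space A p. \<forall>v\<in>tangent_space A p.
        g p u v = g p v u \<and>
        (\<forall>w\<in>tangent_space A p. g p (u + v) w = g p u w + g p v w) \<and>
        (\<forall>r. g p (r *\<^sub>R u) v = r * g p u v) \<and>
        (u \<noteq> 0 \<longrightarrow> g p u u > 0)) \<and>
     (\<forall>c\<in>A. \<forall>i j. smooth_on (chart_image c)
        (\<lambda>x. g (chart_inv c x) (coord_vec A c (chart_inv c x) (axis i 1))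
                              (coord_vec A c (chart_inv c x) (axis j 1))))"

definition left_invariant_metric ::
  "('a, 'n::finite) chart set \<Rightarrow> ('a \<Rightarrow> 'a \<Rightarrow> 'a) \<Rightarrow> 'a \<Rightarrow> ('a \<Rightarrow> 'a) \<Rightarrow>
   ('a \<Rightarrow> ('a, 'n) tvec \<Rightarrow> ('a, 'n) tvec \<Rightarrow> real) \<Rightarrow> bool" where
  "left_invariant_metric A mul e ginv g \<longleftrightarrow>
     (\<forall>x. \<forall>y\<in>tangent_space A x. \<forall>z\<in>tangent_space A x.
        g x y z = g e (tangent_map A (mul (ginv x)) x y) (tangent_map A (mul (ginv x)) x z))"

text \<open>For a left invariant metric, orthonormality of left invariant vector fields can be tested
  at any single point, in particular at the unit element.\<close>

definition orthonormal_at ::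
  "('a \<Rightarrow> ('a, 'n::finite) tvec \<Rightarrow> ('a, 'n) tvec \<Rightarrow> real) \<Rightarrow> 'a \<Rightarrow> ('a, 'n) vfield list \<Rightarrow> bool" where
  "orthonormal_at g p Vs \<longleftrightarrow> (\<forall>i<length Vs. \<forall>j<length Vs.
     g p ((Vs ! i) p) ((Vs ! j) p) = (if i = j then 1 else 0))"

definition local_rep ::
  "('a, 'n::finite) chart set \<Rightarrow> ('a \<Rightarrow> ('a, 'n) tvec \<Rightarrow> real) \<Rightarrow> ('a, 'n) chart \<Rightarrow>
   real^'n \<Rightarrow> real^'n \<Rightarrow> real" where
  "local_rep A F c x y = F (chart_inv c x) (coord_vec A c (chart_inv c x) y)"

definition fund_matrix ::
  "(real^'n \<Rightarrow> real^'n \<Rightarrow> real) \<Rightarrow> real^'n \<Rightarrow> real^'n \<Rightarrow> real^'n^'n::finite" where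
  "fund_matrix L x y = (\<chi> i j. 1/2 * partial i (partial j (\<lambda>y. (L x y)\<^sup>2)) y)"

definition finsler_metric ::
  "('a, 'n::finite) chart set \<Rightarrow> ('a \<Rightarrow> ('a, 'n) tvec \<Rightarrow> real) \<Rightarrow> bool" where
  "finsler_metric A F \<longleftrightarrow>
     (\<forall>p. \<forall>y\<in>tangent_space A p. F p y \<ge> 0 \<and> (\<forall>r>0. F p (r *\<^sub>R y) = r * F p y)) \<and>
     (\<forall>c\<in>A. smooth_on (chart_image c \<times> (- {0})) (\<lambda>(x, y). local_rep A F c x y)) \<and>
     (\<forall>c\<in>A. \<forall>x\<in>chart_image c. \<forall>y. y \<noteq> 0 \<longrightarrow>
        (\<forall>v. v \<noteq> 0 \<longrightarrow> v \<bullet> (fund_matrix (local_rep A F c) x y *v v) > 0))"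

definition randers ::
  "('a \<Rightarrow> ('a, 'n::finite) tvec \<Rightarrow> ('a, 'n) tvec \<Rightarrow> real) \<Rightarrow> ('a, 'n) vfield \<Rightarrow>
   'a \<Rightarrow> ('a, 'n) tvec \<Rightarrow> real" where
  "randers g Q x y = sqrt (g x y y) + g x (Q x) y"


section \<open>The Chern connection\<close>

text \<open>Everything in this section is computed in one chart, from the coordinate expression
  \<open>L x y\<close> of a Finsler metric. With \<open>g\<close> the fundamental matrix:
  \<open>spray\<close> is \<open>G\<^sup>i = 1/2 \<gamma>\<^sup>i\<^sub>j\<^sub>k y\<^sup>j y\<^sup>k\<close> with \<open>\<gamma>\<close> the formal Christoffel symbols (the \<open>x\<close>-derivatives
  of \<open>g(x,y)\<close>), \<open>nonlin\<close> is the nonlinear connection \<open>N\<^sup>i\<^sub>j = \<partial>G\<^sup>i/\<partial>y\<^sup>j\<close>, \<open>hderiv\<close> is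
  \<open>\<delta>/\<delta>x\<^sup>j = \<partial>/\<partial>x\<^sup>j - N\<^sup>m\<^sub>j \<partial>/\<partial>y\<^sup>m\<close>, and \<open>chern L x y i j k\<close> is the coefficient \<open>\<Gamma>\<^sup>i\<^sub>j\<^sub>k(x,y)\<close> of the
  Chern connection (torsion free and almost compatible with \<open>g\<close>).\<close>

definition formal_christoffel ::
  "(real^'n \<Rightarrow> real^'n \<Rightarrow> real) \<Rightarrow> real^'n \<Rightarrow> real^'n \<Rightarrow> 'n::finite \<Rightarrow> 'n \<Rightarrow> 'n \<Rightarrow> real" where
  "formal_christoffel L x y i j k =
     (\<Sum>l\<in>UNIV. 1/2 * matrix_inv (fund_matrix L x y) $ i $ l *
        (partial j (\<lambda>x. fund_matrix L x y $ l $ k) x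
       + partial k (\<lambda>x. fund_matrix L x y $ j $ l) x
       - partial l (\<lambda>x. fund_matrix L x y $ j $ k) x))"

definition spray ::
  "(real^'n \<Rightarrow> real^'n \<Rightarrow> real) \<Rightarrow> real^'n \<Rightarrow> real^'n \<Rightarrow> 'n::finite \<Rightarrow> real" where
  "spray L x y i = 1/2 * (\<Sum>j\<in>UNIV. \<Sum>k\<in>UNIV. formal_christoffel L x y i j k * y $ j * y $ k)"

definition nonlin ::
  "(real^'n \<Rightarrow> real^'n \<Rightarrow> real) \<Rightarrow> real^'n \<Rightarrow> real^'n \<Rightarrow> 'n::finite \<Rightarrow> 'n \<Rightarrow> real" where
  "nonlin L x y i j = partial j (\<lambda>y. spray L x y i) y"

definition hderiv ::
  "(real^'n \<Rightarrow> real^'n \<Rightarrow> real) \<Rightarrow> 'n::finite \<Rightarrow> (real^'n \<Rightarrow> real^'n \<Rightarrow> real) \<Rightarrow>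
   real^'n \<Rightarrow> real^'n \<Rightarrow> real" where
  "hderiv L j f x y = partial j (\<lambda>x. f x y) x - (\<Sum>m\<in>UNIV. nonlin L x y m j * partial m (f x) y)"

definition chern ::
  "(real^'n \<Rightarrow> real^'n \<Rightarrow> real) \<Rightarrow> real^'n \<Rightarrow> real^'n \<Rightarrow> 'n::finite \<Rightarrow> 'n \<Rightarrow> 'n \<Rightarrow> real" where
  "chern L x y i j k =
     (\<Sum>l\<in>UNIV. 1/2 * matrix_inv (fund_matrix L x y) $ i $ l *
        (hderiv L j (\<lambda>x y. fund_matrix L x y $ l $ k) x y
       + hderiv L k (\<lambda>x y. fund_matrix L x y $ j $ l) x y
       - hderiv L l (\<lambda>x y. fund_matrix L x y $ j $ k) x y))"


section \<open>Berwald type, geodesics, flag curvature\<close>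

definition berwald_type ::
  "('a, 'n::finite) chart set \<Rightarrow> ('a \<Rightarrow> ('a, 'n) tvec \<Rightarrow> real) \<Rightarrow> bool" where
  "berwald_type A F \<longleftrightarrow> finsler_metric A F \<and>
     (\<forall>c\<in>A. \<forall>x\<in>chart_image c. \<forall>y y'. y \<noteq> 0 \<and> y' \<noteq> 0 \<longrightarrow>
        (\<forall>i j k. chern (local_rep A F c) x y i j k = chern (local_rep A F c) x y' i j k))"

text \<open>Geodesics \<open>\<sigma>\<close> on an open interval \<open>I\<close>: twice differentiable solutions of
  \<open>\<sigma>''\<^sup>i + \<Gamma>\<^sup>i\<^sub>j\<^sub>k(\<sigma>,\<sigma>') \<sigma>'\<^sup>j \<sigma>'\<^sup>k = 0\<close>. (Where \<open>\<sigma>'\<close> vanishes the second summand is \<open>0\<close>, whatever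
  value \<open>chern\<close> has at \<open>y = 0\<close>.)\<close>

definition geodesic_on ::
  "('a::topological_space, 'n::finite) chart set \<Rightarrow> ('a \<Rightarrow> ('a, 'n) tvec \<Rightarrow> real) \<Rightarrow>
   real set \<Rightarrow> (real \<Rightarrow> 'a) \<Rightarrow> bool" where
  "geodesic_on A F I \<sigma> \<longleftrightarrow> continuous_on I \<sigma> \<and>
     (\<forall>t\<in>I. \<forall>c\<in>A. \<sigma> t \<in> fst c \<longrightarrow>
        (let x = (\<lambda>s. snd c (\<sigma> s)); x' = (\<lambda>s. vector_derivative x (at s)) in
         x differentiable (at t) \<and> x' differentiable (at t) \<and>
         (\<forall>i. vector_derivative x' (at t) $ i +
              (\<Sum>j\<in>UNIV. \<Sum>k\<in>UNIV. chern (local_rep A F c) (x t) (x' t) i j k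
                                      * x' t $ j * x' t $ k) = 0)))"

definition geodesically_complete ::
  "('a::topological_space, 'n::finite) chart set \<Rightarrow> ('a \<Rightarrow> ('a, 'n) tvec \<Rightarrow> real) \<Rightarrow> bool" where
  "geodesically_complete A F \<longleftrightarrow>
     (\<forall>I \<sigma>. open I \<and> is_interval I \<and> I \<noteq> {} \<and> geodesic_on A F I \<sigma> \<longrightarrow>
        (\<exists>\<tau>. geodesic_on A F UNIV \<tau> \<and> (\<forall>t\<in>I. \<tau> t = \<sigma> t)))"

text \<open>The covariant derivative \<open>\<nabla>\<^sub>V W\<close> of the Chern connection with reference vector field \<open>U\<close>.
  For a metric of Berwald type it does not depend on \<open>U\<close> (as long as \<open>U\<close> has no zeros)
  and \<open>\<nabla>\<close> is an affine connection.\<close>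

definition cov_deriv ::
  "('a, 'n::finite) chart set \<Rightarrow> ('a \<Rightarrow> ('a, 'n) tvec \<Rightarrow> real) \<Rightarrow> ('a, 'n) vfield \<Rightarrow>
   ('a, 'n) vfield \<Rightarrow> ('a, 'n) vfield \<Rightarrow> ('a, 'n) vfield" where
  "cov_deriv A F U V W = (\<lambda>p c. if c \<in> A \<and> p \<in> fst c
     then frechet_derivative (\<lambda>x. W (chart_inv c x) c) (at (snd c p)) (V p c)
        + (\<chi> i. \<Sum>j\<in>UNIV. \<Sum>k\<in>UNIV. chern (local_rep A F c) (snd c p) (U p c) i j k
                                        * V p c $ j * W p c $ k)
     else 0)"

text \<open>\<open>curvature A F V U\<close> is \<open>R(V,U)U = \<nabla>\<^sub>V \<nabla>\<^sub>U U - \<nabla>\<^sub>U \<nabla>\<^sub>V U - \<nabla>\<^bsub>[V,U]\<^esub> U\<close>.\<close>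

definition curvature ::
  "('a, 'n::finite) chart set \<Rightarrow> ('a \<Rightarrow> ('a, 'n) tvec \<Rightarrow> real) \<Rightarrow>
   ('a, 'n) vfield \<Rightarrow> ('a, 'n) vfield \<Rightarrow> ('a, 'n) vfield" where
  "curvature A F V U =
     cov_deriv A F U V (cov_deriv A F U U U) - cov_deriv A F U U (cov_deriv A F U V U)
     - cov_deriv A F U (lie_bracket A V U) U"

definition fund_tensor ::
  "('a \<Rightarrow> ('a, 'n::finite) tvec \<Rightarrow> real) \<Rightarrow> 'a \<Rightarrow> ('a, 'n) tvec \<Rightarrow>
   ('a, 'n) tvec \<Rightarrow> ('a, 'n) tvec \<Rightarrow> real" where
  "fund_tensor F p u v w =
     1/2 * deriv (\<lambda>s. deriv (\<lambda>t. (F p (u + s *\<^sub>R v + t *\<^sub>R w))\<^sup>2) 0) 0"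

text \<open>\<open>flag_curvature A F p P u\<close> is \<open>K(P,u)\<close> for a plane \<open>P\<close> in the tangent space at \<open>p\<close> and
  \<open>0 \<noteq> u \<in> P\<close>: the common value of the defining quotient for all vector fields \<open>U\<close>, \<open>V\<close> with
  \<open>U(p) = u\<close> and \<open>P = span {U(p), V(p)}\<close>. Such a value exists for metrics of Berwald type.\<close>

definition flag_curvature ::
  "('a, 'n::finite) chart set \<Rightarrow> ('a \<Rightarrow> ('a, 'n) tvec \<Rightarrow> real) \<Rightarrow>
   'a \<Rightarrow> ('a, 'n) tvec set \<Rightarrow> ('a, 'n) tvec \<Rightarrow> real" where
  "flag_curvature A F p P u = (THE K. \<forall>U V.
     smooth_vfield A U \<and> smooth_vfield A V \<and> U p = u \<and> P = span {U p, V p} \<longrightarrow>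
     K = fund_tensor F p (U p) (curvature A F V U p) (V p) /
         (fund_tensor F p (U p) (U p) (U p) * fund_tensor F p (U p) (V p) (V p)
          - (fund_tensor F p (U p) (U p) (V p))\<^sup>2))"

definition nonneg_flag_curvature ::
  "('a, 'n::finite) chart set \<Rightarrow> ('a \<Rightarrow> ('a, 'n) tvec \<Rightarrow> real) \<Rightarrow> bool" where
  "nonneg_flag_curvature A F \<longleftrightarrow>
     (\<forall>p. \<forall>u\<in>tangent_space A p. \<forall>v\<in>tangent_space A p.
        u \<noteq> v \<and> independent {u, v} \<longrightarrow> flag_curvature A F p (span {u, v}) u \<ge> 0)"

end

theory Submission
  imports Defs
begin

text \<open>Identify the Lie algebra with \<open>\<real>\<^sup>4\<close> by the orthonormal frame. The metric is ad-invariant, so the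
  Levi-Civita connection is \<open>\<nabla>\<^sub>u v = [u, v] / 2\<close> on left invariant fields, and \<open>Q\<close>, being central, is
  parallel. In a chart, parallelism of \<open>g\<close> and \<open>Q\<close> says that the horizontal derivative
  \<open>\<partial>/\<partial>x\<^sup>j - \<Gamma>\<^sup>m\<^sub>j\<^sub>k y\<^sup>k \<partial>/\<partial>y\<^sup>m\<close> annihilates \<open>F\<close>; with the symmetry of \<open>\<Gamma>\<close> this forces the Chern coefficients of
  \<open>F\<close> to be the Christoffel symbols \<open>\<Gamma>\<close>. Hence \<open>R(V,U)U = [U,[V,U]] / 4\<close>, and evaluating \<open>g\<^sub>U\<close> gives the flag
  curvature. The velocity of a geodesic has constant coefficients in the frame, so geodesics are
  integral curves of left invariant fields, which extend by left translation.\<close>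

section \<open>Calculus of smooth functions\<close>

text \<open>\<open>flag_curvature\<close> ranges over all smooth fields extending a flag, not just
  left invariant ones. The curvature therefore has to be computed for coefficients that are
  arbitrary functions in the frame and must turn out to depend only on their values at the point;
  this is why symmetry of mixed derivatives is established for the iterated notion
  \<open>Ck_on\<close>. Such fields may also have zeros, where the Chern coefficients carry no
  information, so the computation is confined to an open set on which \<open>U\<close> does not
  vanish. The constant 1/4 arises as follows: \<open>\<nabla>_U U\<close> vanishes for left
  invariant \<open>U\<close>, the term \<open>\<nabla>_U \<nabla>_V U\<close> is
  \<open>[U,[V,U]] / 4\<close>, and \<open>\<nabla>_[V,U] U\<close> is
  \<open>-[U,[V,U]] / 2\<close>, so that \<open>R(V,U)U = (-1/4 + 1/2) [U,[V,U]]\<close>. For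
  completeness the given geodesic itself, moved to the unit element, supplies the local piece of a
  one-parameter subgroup; uniqueness of integral curves glues its translates.\<close>

lemma Ck_on_cong:
  assumes "open S" "\<And>x. x \<in> S \<Longrightarrow> f x = g x" "Ck_on k S f"
  shows "Ck_on k S g"
  using assms(2,3)
proof (induction k arbitrary: f g)
  case 0
  then show ?case by (simp cong: continuous_on_cong)
next
  case (Suc k)
  have d: "(g has_derivative frechet_derivative f (at x)) (at x)" if "x \<in> S" for x
  proof (rule has_derivative_transform_within_open[OF _ \<open>open S\<close> that Suc.prems(1)])
    show "(f has_derivative frechet_derivative f (at x)) (at x)"
      using Suc.prems(2) that by (simp add: frechet_derivative_works[symmetric])
  qed
  have "Ck_on k S (\<lambda>x. frechet_derivative g (at x) v)" for v
  proof (rule Suc.IH)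
    show "Ck_on k S (\<lambda>x. frechet_derivative f (at x) v)" using Suc.prems(2) by simp
  qed (simp add: frechet_derivative_at[OF d, symmetric])
  with d show ?case by (auto simp: differentiable_def)
qed

lemma Ck_on_SucD: "Ck_on (Suc k) S f \<Longrightarrow> Ck_on k S f"
proof (induction k arbitrary: f)
  case 0
  then show ?case
    by (simp add: differentiable_imp_continuous_on differentiable_on_def differentiable_at_withinI)
next
  case (Suc k)
  then show ?case unfolding Ck_on.simps(2)[of "Suc k"] Ck_on.simps(2)[of k S f] by blast
qed

lemma Ck_on_const: "Ck_on k S (\<lambda>x. c)"
  by (induction k arbitrary: c) auto

lemma Ck_on_bounded_linear_left:
  assumes "open S" and T: "bounded_linear T" and "Ck_on k S f"
  shows "Ck_on k S (\<lambda>x. T (f x))"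
  using assms(3)
proof (induction k arbitrary: f)
  case 0
  then show ?case by (simp add: bounded_linear.continuous_on[OF T])
next
  case (Suc k)
  have d: "((\<lambda>x. T (f x)) has_derivative (\<lambda>v. T (frechet_derivative f (at x) v))) (at x)"
    if "x \<in> S" for x
    using Suc.prems that by (intro bounded_linear.has_derivative[OF T]) (auto simp: frechet_derivative_works[symmetric])
  have "Ck_on k S (\<lambda>x. frechet_derivative (\<lambda>x. T (f x)) (at x) v)" for v
    by (rule Ck_on_cong[OF \<open>open S\<close>, of "\<lambda>x. T (frechet_derivative f (at x) v)"])
      (use Suc in \<open>auto simp: frechet_derivative_at[OF d, symmetric]\<close>)
  with d show ?case by (auto simp: differentiable_def)
qed

lemma Ck_on_bounded_linear: "open S \<Longrightarrow> bounded_linear T \<Longrightarrow> Ck_on k S T"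
proof (cases k)
  case (Suc j)
  assume T: "bounded_linear T"
  have "frechet_derivative T (at x) = T" for x
    using frechet_derivative_at[OF bounded_linear_imp_has_derivative[OF T]] by (rule sym)
  with T Suc show ?thesis
    by (auto simp: bounded_linear_imp_differentiable Ck_on_const)
qed (simp add: linear_continuous_on)

text \<open>For linear \<open>T\<close> the derivative of the composite is a derivative of
  \<open>f\<close>, in the fixed direction \<open>T v\<close>, again composed with \<open>T\<close>;
  so the induction closes. It serves to lift functions of the position to pairs of position and
  direction.\<close>

lemma Ck_on_compose_linear:
  assumes "open S" "open S'" and T: "bounded_linear T" and "T ` S' \<subseteq> S" and "Ck_on k S f"
  shows "Ck_on k S' (\<lambda>x. f (T x))"
  using assms(5)
proof (induction k arbitrary: f)
  case 0
  then show ?case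
    using assms(4) continuous_on_compose2[of S f S' T] linear_continuous_on[OF T] by auto
next
  case (Suc k)
  have d: "((\<lambda>x. f (T x)) has_derivative (\<lambda>v. frechet_derivative f (at (T x)) (T v))) (at x)"
    if "x \<in> S'" for x
    using Suc.prems that assms(4)
    by (intro has_derivative_compose[OF bounded_linear_imp_has_derivative[OF T]])
      (auto simp: frechet_derivative_works[symmetric])
  have "Ck_on k S' (\<lambda>x. frechet_derivative (\<lambda>x. f (T x)) (at x) v)" for v
    by (rule Ck_on_cong[OF \<open>open S'\<close>, of "\<lambda>x. frechet_derivative f (at (T x)) (T v)"])
      (use Suc in \<open>auto simp: frechet_derivative_at[OF d, symmetric]\<close>)
  with d show ?case by (auto simp: differentiable_def)
qed

text \<open>Lets the inductive steps below work with whatever derivative formula the product or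
  chain rule produces instead of the chosen \<open>frechet_derivative\<close>.\<close>

lemma Ck_on_SucI:
  assumes "open S"
    and d: "\<And>x. x \<in> S \<Longrightarrow> (f has_derivative f' x) (at x)"
    and f': "\<And>v. Ck_on k S (\<lambda>x. f' x v)"
  shows "Ck_on (Suc k) S f"
proof -
  have "Ck_on k S (\<lambda>x. frechet_derivative f (at x) v)" for v
    by (rule Ck_on_cong[OF \<open>open S\<close> _ f'[of v]]) (simp add: frechet_derivative_at[OF d, symmetric])
  with d show ?thesis by (auto simp: differentiable_def)
qed

lemma Ck_on_SucE:
  assumes "Ck_on (Suc k) S f"
  obtains "\<And>x. x \<in> S \<Longrightarrow> (f has_derivative frechet_derivative f (at x)) (at x)"
    "\<And>v. Ck_on k S (\<lambda>x. frechet_derivative f (at x) v)" "Ck_on k S f"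
  using assms Ck_on_SucD[OF assms] by (simp add: frechet_derivative_works[symmetric])

lemma Ck_on_add:
  assumes "open S" "Ck_on k S f" "Ck_on k S g"
  shows "Ck_on k S (\<lambda>x. f x + g x)"
  using assms(2,3)
proof (induction k arbitrary: f g)
  case 0
  then show ?case by (simp add: continuous_on_add)
next
  case (Suc k)
  show ?case
    by (rule Ck_on_SucE[OF Suc.prems(1)], rule Ck_on_SucE[OF Suc.prems(2)],
        rule Ck_on_SucI[OF \<open>open S\<close> has_derivative_add], assumption+, rule Suc.IH, assumption+)
qed

lemma Ck_on_scaleR:
  assumes "open S" "Ck_on k S f" "Ck_on k S g"
  shows "Ck_on k S (\<lambda>x. f x *\<^sub>R g x)"
  using assms(2,3)
proof (induction k arbitrary: f g)
  case 0
  then show ?case by (simp add: continuous_on_scaleR)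
next
  case (Suc k)
  show ?case
    by (rule Ck_on_SucE[OF Suc.prems(1)], rule Ck_on_SucE[OF Suc.prems(2)],
        rule Ck_on_SucI[OF \<open>open S\<close> has_derivative_scaleR], assumption+,
        rule Ck_on_add[OF \<open>open S\<close>]; rule Suc.IH; assumption)
qed

lemma Ck_on_mult:
  fixes f g :: "'a::real_normed_vector \<Rightarrow> real"
  shows "open S \<Longrightarrow> Ck_on k S f \<Longrightarrow> Ck_on k S g \<Longrightarrow> Ck_on k S (\<lambda>x. f x * g x)"
  using Ck_on_scaleR[of S k f g] by simp

text \<open>The derivative \<open>-f'/f^2\<close> is a product of \<open>f'\<close> and two factors
  \<open>1/f\<close>, so the induction hypothesis for \<open>1/f\<close> closes the step. The sign
  is written as a factor \<open>-1\<close> to stay within products.\<close>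

lemma Ck_on_inverse:
  fixes f :: "'a::real_normed_vector \<Rightarrow> real"
  assumes "open S" "\<And>x. x \<in> S \<Longrightarrow> f x \<noteq> 0" "Ck_on k S f"
  shows "Ck_on k S (\<lambda>x. inverse (f x))"
  using assms(3)
proof (induction k)
  case 0
  then show ?case using assms(2) by (simp add: continuous_on_inverse)
next
  case (Suc k)
  note E = Ck_on_SucE[OF Suc.prems]
  show ?case
  proof (rule Ck_on_SucI[OF \<open>open S\<close>])
    show "((\<lambda>x. inverse (f x)) has_derivative
      (\<lambda>v. (-1) * (inverse (f x) * frechet_derivative f (at x) v * inverse (f x)))) (at x)"
      if "x \<in> S" for x
    proof -
      have "(f has_derivative frechet_derivative f (at x)) (at x)" by (rule E) (use that in blast)
      from Deriv.has_derivative_inverse[OF assms(2)[OF that] this] show ?thesis by simp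
    qed
    show "Ck_on k S (\<lambda>x. (-1) * (inverse (f x) * frechet_derivative f (at x) v * inverse (f x)))" for v
      by (rule E, intro Ck_on_mult Ck_on_const \<open>open S\<close>) (rule Suc.IH | assumption)+
  qed
qed

text \<open>The same pattern with \<open>f' / (2 sqrt f)\<close>; positivity of \<open>f\<close>
  keeps the reciprocal of the root smooth.\<close>

lemma Ck_on_sqrt:
  fixes f :: "'a::real_normed_vector \<Rightarrow> real"
  assumes "open S" "\<And>x. x \<in> S \<Longrightarrow> f x > 0" "Ck_on k S f"
  shows "Ck_on k S (\<lambda>x. sqrt (f x))"
  using assms(3)
proof (induction k)
  case 0
  then show ?case by (simp add: continuous_on_real_sqrt)
next
  case (Suc k)
  note E = Ck_on_SucE[OF Suc.prems]
  show ?case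
  proof (rule Ck_on_SucI[OF \<open>open S\<close>])
    show "((\<lambda>x. sqrt (f x)) has_derivative
      (\<lambda>v. frechet_derivative f (at x) v * (inverse (sqrt (f x)) * (1/2)))) (at x)"
      if "x \<in> S" for x
    proof -
      have "(f has_derivative frechet_derivative f (at x)) (at x)" by (rule E) (use that in blast)
      from DERIV_compose_FDERIV[OF DERIV_real_sqrt[OF assms(2)[OF that]] this]
      show ?thesis by (rule back_subst) (simp add: fun_eq_iff)
    qed
    have "sqrt (f x) \<noteq> 0" if "x \<in> S" for x using assms(2)[OF that] by simp
    then show "Ck_on k S (\<lambda>x. frechet_derivative f (at x) v * (inverse (sqrt (f x)) * (1/2)))" for v
      by (rule_tac E, intro Ck_on_mult Ck_on_const Ck_on_inverse \<open>open S\<close>) (rule Suc.IH | assumption)+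
  qed
qed

section \<open>Closure properties of smooth functions\<close>

lemma smooth_on_cong:
  "open S \<Longrightarrow> (\<And>x. x \<in> S \<Longrightarrow> f x = g x) \<Longrightarrow> smooth_on S f \<Longrightarrow> smooth_on S g"
  unfolding smooth_on_def using Ck_on_cong by blast

lemma smooth_on_differentiable: "smooth_on S f \<Longrightarrow> x \<in> S \<Longrightarrow> f differentiable (at x)"
  unfolding smooth_on_def by (metis Ck_on.simps(2))

lemma smooth_on_frechet_derivative: "smooth_on S f \<Longrightarrow> smooth_on S (\<lambda>x. frechet_derivative f (at x) v)"
  unfolding smooth_on_def by (metis Ck_on.simps(2))

lemma smooth_on_continuous: "smooth_on S f \<Longrightarrow> continuous_on S f"
  unfolding smooth_on_def by (metis Ck_on.simps(1))

lemma smooth_on_const: "smooth_on S (\<lambda>x. c)"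
  by (simp add: smooth_on_def Ck_on_const)

lemma smooth_on_bounded_linear: "open S \<Longrightarrow> bounded_linear T \<Longrightarrow> smooth_on S T"
  by (simp add: smooth_on_def Ck_on_bounded_linear)

lemma smooth_on_bounded_linear_left:
  "open S \<Longrightarrow> bounded_linear T \<Longrightarrow> smooth_on S f \<Longrightarrow> smooth_on S (\<lambda>x. T (f x))"
  by (simp add: smooth_on_def Ck_on_bounded_linear_left)

lemma smooth_on_nth: "open S \<Longrightarrow> smooth_on S f \<Longrightarrow> smooth_on S (\<lambda>x. f x $ i)"
  by (rule smooth_on_bounded_linear_left[OF _ bounded_linear_vec_nth])

lemma smooth_on_compose_linear:
  "open S \<Longrightarrow> open S' \<Longrightarrow> bounded_linear T \<Longrightarrow> T ` S' \<subseteq> S \<Longrightarrow> smooth_on S f \<Longrightarrow>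
    smooth_on S' (\<lambda>x. f (T x))"
  by (simp add: smooth_on_def Ck_on_compose_linear)

lemma smooth_on_add:
  "open S \<Longrightarrow> smooth_on S f \<Longrightarrow> smooth_on S g \<Longrightarrow> smooth_on S (\<lambda>x. f x + g x)"
  by (simp add: smooth_on_def Ck_on_add)

lemma smooth_on_sum:
  assumes "open S" "\<And>i. i \<in> I \<Longrightarrow> smooth_on S (f i)"
  shows "smooth_on S (\<lambda>x. \<Sum>i\<in>I. f i x)"
  using assms(2)
  by (induction I rule: infinite_finite_induct)
    (auto intro: smooth_on_const smooth_on_add[OF \<open>open S\<close>])

lemma smooth_on_scaleR:
  "open S \<Longrightarrow> smooth_on S f \<Longrightarrow> smooth_on S g \<Longrightarrow> smooth_on S (\<lambda>x. f x *\<^sub>R g x)"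
  by (simp add: smooth_on_def Ck_on_scaleR)

lemma smooth_on_mult:
  fixes f g :: "'a::real_normed_vector \<Rightarrow> real"
  shows "open S \<Longrightarrow> smooth_on S f \<Longrightarrow> smooth_on S g \<Longrightarrow> smooth_on S (\<lambda>x. f x * g x)"
  by (simp add: smooth_on_def Ck_on_mult)

lemma smooth_on_sqrt:
  fixes f :: "'a::real_normed_vector \<Rightarrow> real"
  shows "open S \<Longrightarrow> (\<And>x. x \<in> S \<Longrightarrow> f x > 0) \<Longrightarrow> smooth_on S f \<Longrightarrow> smooth_on S (\<lambda>x. sqrt (f x))"
  by (simp add: smooth_on_def Ck_on_sqrt)

lemma smooth_on_divide:
  fixes f g :: "'a::real_normed_vector \<Rightarrow> real"
  shows "open S \<Longrightarrow> (\<And>x. x \<in> S \<Longrightarrow> g x \<noteq> 0) \<Longrightarrow> smooth_on S f \<Longrightarrow> smooth_on S g \<Longrightarrow>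
    smooth_on S (\<lambda>x. f x / g x)"
  by (simp add: smooth_on_def divide_inverse Ck_on_mult Ck_on_inverse)

section \<open>Symmetry of second derivatives\<close>

lemma frechet_derivative_line:
  assumes "f differentiable (at (p + s *\<^sub>R u))"
  shows "((\<lambda>s. f (p + s *\<^sub>R u)) has_vector_derivative frechet_derivative f (at (p + s *\<^sub>R u)) u) (at s)"
proof -
  let ?D = "frechet_derivative f (at (p + s *\<^sub>R u))"
  have f: "(f has_derivative ?D) (at (p + s *\<^sub>R u))"
    using assms frechet_derivative_works by blast
  have "((\<lambda>s. p + s *\<^sub>R u) has_derivative (\<lambda>t. t *\<^sub>R u)) (at s)"
    by (auto intro!: derivative_eq_intros)
  from has_derivative_compose[OF this f]
  show ?thesis
    using linear_scale[OF linear_frechet_derivative[OF assms]]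
    by (simp add: has_vector_derivative_def)
qed

text \<open>Both mixed derivatives are limits of the same second difference quotient.\<close>

lemma second_difference:
  fixes f :: "'a::real_normed_vector \<Rightarrow> real"
  assumes h: "h > 0"
    and d: "\<And>s t. \<lbrakk>0 \<le> s; s \<le> h; 0 \<le> t; t \<le> h\<rbrakk> \<Longrightarrow> f differentiable (at (p + s *\<^sub>R u + t *\<^sub>R v))"
    and d2: "\<And>s t. \<lbrakk>0 \<le> s; s \<le> h; 0 \<le> t; t \<le> h\<rbrakk> \<Longrightarrow>
      (\<lambda>x. frechet_derivative f (at x) u) differentiable (at (p + s *\<^sub>R u + t *\<^sub>R v))"
  shows "\<exists>s t. 0 \<le> s \<and> s \<le> h \<and> 0 \<le> t \<and> t \<le> h \<and>
    f (p + h *\<^sub>R u + h *\<^sub>R v) - f (p + h *\<^sub>R u) - f (p + h *\<^sub>R v) + f p =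
    h * (h * frechet_derivative (\<lambda>x. frechet_derivative f (at x) u) (at (p + s *\<^sub>R u + t *\<^sub>R v)) v)"
proof -
  let ?D = "\<lambda>x. frechet_derivative f (at x) u"
  \<comment> \<open>The difference in direction \<open>v\<close>, as a function of the parameter
    along \<open>u\<close>. One mean value step in \<open>s\<close> and one in \<open>t\<close> turn
    its increment into a mixed derivative at an interior point.\<close>
  let ?k = "\<lambda>s. f (p + s *\<^sub>R u + h *\<^sub>R v) - f (p + s *\<^sub>R u)"
  have "DERIV ?k s :> ?D (p + s *\<^sub>R u + h *\<^sub>R v) - ?D (p + s *\<^sub>R u)" if "0 \<le> s" "s \<le> h" for s
  proof -
    have "((\<lambda>s. f ((p + h *\<^sub>R v) + s *\<^sub>R u)) has_vector_derivative ?D ((p + h *\<^sub>R v) + s *\<^sub>R u)) (at s)"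
      using d[of s h] that h by (intro frechet_derivative_line) (simp add: add_ac)
    moreover have "((\<lambda>s. f (p + s *\<^sub>R u)) has_vector_derivative ?D (p + s *\<^sub>R u)) (at s)"
      using d[of s 0] that h by (intro frechet_derivative_line) simp
    ultimately show ?thesis
      unfolding has_real_derivative_iff_has_vector_derivative
      by (intro has_vector_derivative_diff) (simp_all add: add_ac)
  qed
  from MVT2[OF h this] obtain s where s: "0 < s" "s < h"
    "?k h - ?k 0 = h * (?D (p + s *\<^sub>R u + h *\<^sub>R v) - ?D (p + s *\<^sub>R u))" by auto
  have "DERIV (\<lambda>t. ?D (p + s *\<^sub>R u + t *\<^sub>R v)) t :> frechet_derivative ?D (at (p + s *\<^sub>R u + t *\<^sub>R v)) v"
    if "0 \<le> t" "t \<le> h" for t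
    unfolding has_real_derivative_iff_has_vector_derivative
    using d2[of s t] s that by (intro frechet_derivative_line) simp
  from MVT2[OF h this] obtain t where t: "0 < t" "t < h"
    "?D (p + s *\<^sub>R u + h *\<^sub>R v) - ?D (p + s *\<^sub>R u) = h * frechet_derivative ?D (at (p + s *\<^sub>R u + t *\<^sub>R v)) v"
    by auto
  show ?thesis
    using s t by (intro exI[of _ s] exI[of _ t]) auto
qed

lemma frechet_derivative_symmetric:
  fixes f :: "'a::real_normed_vector \<Rightarrow> real"
  assumes "open S" "p \<in> S" and f: "smooth_on S f"
  shows "frechet_derivative (\<lambda>x. frechet_derivative f (at x) u) (at p) v =
         frechet_derivative (\<lambda>x. frechet_derivative f (at x) v) (at p) u"
proof (rule ccontr)
  let ?D = "\<lambda>u v x. frechet_derivative (\<lambda>x. frechet_derivative f (at x) u) (at x) v"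
  assume "\<not> ?thesis"
  then have ne: "?D u v p \<noteq> ?D v u p" by simp
  \<comment> \<open>Half the supposed gap. Two points at which the mixed derivatives agree, each
    value within \<open>e\<close> of the corresponding one at \<open>p\<close>, contradict a gap of
    \<open>2 * e\<close>.\<close>
  define e where "e = \<bar>?D u v p - ?D v u p\<bar> / 2"
  have e: "e > 0" using ne by (simp add: e_def)
  have c: "continuous_on S (?D u v)" for u v
    by (intro smooth_on_continuous smooth_on_frechet_derivative f)
  obtain d0 where d0: "d0 > 0" "ball p d0 \<subseteq> S"
    using assms openE by blast
  obtain d1 where d1: "d1 > 0" "\<And>x. x \<in> S \<Longrightarrow> dist x p < d1 \<Longrightarrow> dist (?D u v x) (?D u v p) < e"
    using c[of u v] e \<open>p \<in> S\<close> unfolding continuous_on_iff by metis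
  obtain d2 where d2: "d2 > 0" "\<And>x. x \<in> S \<Longrightarrow> dist x p < d2 \<Longrightarrow> dist (?D v u x) (?D v u p) < e"
    using c[of v u] e \<open>p \<in> S\<close> unfolding continuous_on_iff by metis
  define d where "d = min d0 (min d1 d2)"
  \<comment> \<open>Keeps the whole parallelogram of side parameters up to \<open>h\<close> within
    distance \<open>d\<close> of \<open>p\<close>; the summand 1 guards against
    \<open>u = v = 0\<close>.\<close>
  define h where "h = d / 2 / (norm u + norm v + 1)"
  have d: "d > 0" using d0 d1 d2 by (simp add: d_def)
  have h: "h > 0" unfolding h_def by (intro divide_pos_pos d) (auto simp: d add_nonneg_pos)
  have near: "norm (s *\<^sub>R u + t *\<^sub>R v) < d" if "0 \<le> s" "s \<le> h" "0 \<le> t" "t \<le> h" for s t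
  proof -
    have "norm (s *\<^sub>R u + t *\<^sub>R v) \<le> s * norm u + t * norm v"
      using norm_triangle_ineq[of "s *\<^sub>R u" "t *\<^sub>R v"] that by simp
    also have "\<dots> \<le> h * norm u + h * norm v"
      using that by (intro add_mono mult_right_mono) auto
    also have "\<dots> \<le> h * (norm u + norm v + 1)" using h by (simp add: algebra_simps)
    also have "\<dots> = d / 2"
      using add_nonneg_pos[OF add_nonneg_nonneg[OF norm_ge_zero[of u] norm_ge_zero[of v]] zero_less_one]
      unfolding h_def by (simp add: field_simps)
    finally show ?thesis using d by simp
  qed
  have near': "p + s *\<^sub>R u + t *\<^sub>R v \<in> S" "dist (p + s *\<^sub>R u + t *\<^sub>R v) p < d"
    if "0 \<le> s" "s \<le> h" "0 \<le> t" "t \<le> h" for s t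
    using near[OF that] subsetD[OF d0(2), of "p + s *\<^sub>R u + t *\<^sub>R v"]
    by (simp_all add: mem_ball dist_commute[of p]) (simp_all add: dist_norm add.assoc d_def)
  note sm = smooth_on_differentiable[OF f] smooth_on_differentiable[OF smooth_on_frechet_derivative[OF f]]
  obtain s t where st: "0 \<le> s" "s \<le> h" "0 \<le> t" "t \<le> h"
    "f (p + h *\<^sub>R u + h *\<^sub>R v) - f (p + h *\<^sub>R u) - f (p + h *\<^sub>R v) + f p = h * (h * ?D u v (p + s *\<^sub>R u + t *\<^sub>R v))"
    using second_difference[OF h sm(1)[OF near'(1)] sm(2)[OF near'(1)]] by blast
  have near'': "p + s *\<^sub>R v + t *\<^sub>R u \<in> S" "dist (p + s *\<^sub>R v + t *\<^sub>R u) p < d"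
    if "0 \<le> s" "s \<le> h" "0 \<le> t" "t \<le> h" for s t
    using near'[of t s] that by (simp_all add: add_ac)
  obtain s' t' where st': "0 \<le> s'" "s' \<le> h" "0 \<le> t'" "t' \<le> h"
    "f (p + h *\<^sub>R v + h *\<^sub>R u) - f (p + h *\<^sub>R v) - f (p + h *\<^sub>R u) + f p = h * (h * ?D v u (p + s' *\<^sub>R v + t' *\<^sub>R u))"
    using second_difference[OF h sm(1)[OF near''(1)] sm(2)[OF near''(1)]] by blast
  have "h * (h * ?D u v (p + s *\<^sub>R u + t *\<^sub>R v)) = h * (h * ?D v u (p + s' *\<^sub>R v + t' *\<^sub>R u))"
    unfolding st(5)[symmetric] st'(5)[symmetric] by (simp add: add.commute add.left_commute)
  then have "?D u v (p + s *\<^sub>R u + t *\<^sub>R v) = ?D v u (p + s' *\<^sub>R v + t' *\<^sub>R u)"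
    using h by simp
  moreover have "dist (?D u v p) (?D u v (p + s *\<^sub>R u + t *\<^sub>R v)) < e"
    by (subst dist_commute, rule d1(2)[OF near'(1)[OF st(1-4)]])
      (use near'(2)[OF st(1-4)] in \<open>simp add: d_def\<close>)
  moreover have "dist (?D v u p) (?D v u (p + s' *\<^sub>R v + t' *\<^sub>R u)) < e"
    by (subst dist_commute, rule d2(2)[OF near''(1)[OF st'(1-4)]])
      (use near''(2)[OF st'(1-4)] in \<open>simp add: d_def\<close>)
  ultimately have "dist (?D u v p) (?D v u p) < e + e"
    by (intro dist_triangle_less_add) simp_all
  then show False
    by (simp add: e_def dist_real_def)
qed

lemma frechet_derivative_nth:
  assumes "f differentiable (at x)"
  shows "frechet_derivative (\<lambda>x. f x $ i) (at x) v = frechet_derivative f (at x) v $ i"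
proof -
  have "((\<lambda>x. f x $ i) has_derivative (\<lambda>v. frechet_derivative f (at x) v $ i)) (at x)"
    using assms by (intro bounded_linear.has_derivative[OF bounded_linear_vec_nth])
      (simp add: frechet_derivative_works[symmetric])
  from frechet_derivative_at[OF this] show ?thesis by metis
qed

lemma frechet_derivative_symmetric_vec:
  fixes f :: "'a::real_normed_vector \<Rightarrow> real^'n"
  assumes S: "open S" "p \<in> S" and f: "smooth_on S f"
  shows "frechet_derivative (\<lambda>x. frechet_derivative f (at x) u) (at p) v =
         frechet_derivative (\<lambda>x. frechet_derivative f (at x) v) (at p) u"
proof -
  have *: "frechet_derivative (\<lambda>x. frechet_derivative f (at x) u) (at p) v $ i =
      frechet_derivative (\<lambda>x. frechet_derivative (\<lambda>x. f x $ i) (at x) u) (at p) v" for u v i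
  proof -
    let ?D = "\<lambda>x. frechet_derivative f (at x) u"
    have d: "?D differentiable (at p)"
      using smooth_on_differentiable[OF smooth_on_frechet_derivative[OF f]] S by blast
    have "((\<lambda>x. ?D x $ i) has_derivative (\<lambda>v. frechet_derivative ?D (at p) v $ i)) (at p)"
      using d by (intro bounded_linear.has_derivative[OF bounded_linear_vec_nth])
        (simp add: frechet_derivative_works[symmetric])
    from has_derivative_transform_within_open[OF this S]
    have "((\<lambda>x. frechet_derivative (\<lambda>x. f x $ i) (at x) u) has_derivative
        (\<lambda>v. frechet_derivative ?D (at p) v $ i)) (at p)"
      by (simp add: frechet_derivative_nth smooth_on_differentiable[OF f])
    from frechet_derivative_at[OF this] show ?thesis by metis
  qed
  show ?thesis
    unfolding vec_eq_iff * by (intro allI frechet_derivative_symmetric[OF S] smooth_on_nth S f)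
qed

text \<open>The device for removing indices: the coordinate sums in the definitions of spray, Chern
  coefficients and covariant derivative collapse to values of linear maps.\<close>

lemma linear_axis_sum_vec:
  fixes f :: "real^'n::finite \<Rightarrow> 'b::real_vector"
  assumes "linear f"
  shows "(\<Sum>k\<in>UNIV. y $ k *\<^sub>R f (axis k 1)) = f y"
proof -
  have "f y = f (\<Sum>k\<in>UNIV. y $ k *\<^sub>R axis k 1)"
    using basis_expansion[of y] by (simp add: scalar_mult_eq_scaleR)
  also have "\<dots> = (\<Sum>k\<in>UNIV. y $ k *\<^sub>R f (axis k 1))"
    by (simp add: linear_sum[OF assms] linear_scale[OF assms])
  finally show ?thesis by simp
qed

text \<open>Product rule for a linear map and its argument both depending on \<open>x\<close>.
  Expanding the argument in the standard basis reduces it to differentiability of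
  \<open>\<Phi>\<close> along each fixed basis vector.\<close>

lemma has_derivative_linear_family:
  fixes \<Phi> :: "'b::real_normed_vector \<Rightarrow> real^'n::finite \<Rightarrow> 'c::real_normed_vector"
  assumes S: "open S" "x \<in> S" and l: "\<And>x. x \<in> S \<Longrightarrow> linear (\<Phi> x)"
    and \<Phi>: "\<And>k. ((\<lambda>x. \<Phi> x (axis k 1)) has_derivative \<Phi>' k) (at x)"
    and w: "(w has_derivative w') (at x)"
  shows "((\<lambda>x. \<Phi> x (w x)) has_derivative (\<lambda>\<xi>. (\<Sum>k\<in>UNIV. w x $ k *\<^sub>R \<Phi>' k \<xi>) + \<Phi> x (w' \<xi>))) (at x)"
proof -
  have "((\<lambda>x. \<Sum>k\<in>UNIV. w x $ k *\<^sub>R \<Phi> x (axis k 1)) has_derivative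
      (\<lambda>\<xi>. \<Sum>k\<in>UNIV. w x $ k *\<^sub>R \<Phi>' k \<xi> + w' \<xi> $ k *\<^sub>R \<Phi> x (axis k 1))) (at x)"
    by (intro has_derivative_sum has_derivative_scaleR \<Phi> bounded_linear.has_derivative[OF bounded_linear_vec_nth w])
  also have "(\<lambda>\<xi>. \<Sum>k\<in>UNIV. w x $ k *\<^sub>R \<Phi>' k \<xi> + w' \<xi> $ k *\<^sub>R \<Phi> x (axis k 1)) =
      (\<lambda>\<xi>. (\<Sum>k\<in>UNIV. w x $ k *\<^sub>R \<Phi>' k \<xi>) + \<Phi> x (w' \<xi>))"
    by (simp add: sum.distrib linear_axis_sum_vec[OF l[OF S(2)]])
  finally show ?thesis
    by (rule has_derivative_transform_within_open[OF _ S]) (rule linear_axis_sum_vec[OF l])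
qed

text \<open>Derivative of a directional derivative along a moving vector. Symmetry of second
  derivatives moves \<open>V x\<close> into the outer slot, where linearity is available to collapse
  the basis sum.\<close>

lemma has_derivative_frechet_derivative:
  fixes f :: "real^'n::finite \<Rightarrow> real^'m"
  assumes S: "open S" "x \<in> S" and f: "smooth_on S f" and V: "(V has_derivative V') (at x)"
  shows "((\<lambda>x. frechet_derivative f (at x) (V x)) has_derivative (\<lambda>\<xi>.
    frechet_derivative (\<lambda>x. frechet_derivative f (at x) \<xi>) (at x) (V x) + frechet_derivative f (at x) (V' \<xi>))) (at x)"
proof -
  let ?D = "\<lambda>v x. frechet_derivative f (at x) v"
  have d: "?D v differentiable (at x)" for v
    using smooth_on_differentiable[OF smooth_on_frechet_derivative[OF f]] S by blast
  have 1: "((\<lambda>x. frechet_derivative f (at x) (V x)) has_derivative (\<lambda>\<xi>.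
    (\<Sum>k\<in>UNIV. V x $ k *\<^sub>R frechet_derivative (?D (axis k 1)) (at x) \<xi>) + frechet_derivative f (at x) (V' \<xi>))) (at x)"
    using d by (intro has_derivative_linear_family[OF S _ _ V] linear_frechet_derivative
        smooth_on_differentiable[OF f]) (simp_all add: frechet_derivative_works[symmetric])
  have 2: "(\<Sum>k\<in>UNIV. V x $ k *\<^sub>R frechet_derivative (?D (axis k 1)) (at x) \<xi>) =
      frechet_derivative (?D \<xi>) (at x) (V x)" for \<xi>
    by (simp add: frechet_derivative_symmetric_vec[OF S f, of _ \<xi>]
        linear_axis_sum_vec[OF linear_frechet_derivative[OF d]])
  show ?thesis using 1 unfolding 2 .
qed

section \<open>Randers metrics in a chart\<close>

lemma partial_eq: "(f has_derivative f') (at x) \<Longrightarrow> partial i f x = f' (axis i 1)"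
proof -
  assume f: "(f has_derivative f') (at x)"
  have "((\<lambda>t. x + t *\<^sub>R axis i 1) has_derivative (\<lambda>t. t *\<^sub>R axis i 1)) (at 0)"
    by (auto intro!: derivative_eq_intros)
  from has_derivative_compose[OF this, of f f'] f
  have "((\<lambda>t. f (x + t *\<^sub>R axis i 1)) has_derivative (\<lambda>t. f' (t *\<^sub>R axis i 1))) (at 0)" by simp
  then have "((\<lambda>t. f (x + t *\<^sub>R axis i 1)) has_real_derivative f' (axis i 1)) (at 0)"
    using linear_scale[OF has_derivative_linear[OF f]]
    by (simp add: has_field_derivative_def mult_commute_abs)
  then show ?thesis unfolding partial_def by (rule DERIV_imp_deriv)
qed

lemma linear_axis_sum:
  fixes f :: "real^'n::finite \<Rightarrow> real"
  shows "linear f \<Longrightarrow> (\<Sum>k\<in>UNIV. y $ k * f (axis k 1)) = f y"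
  using linear_axis_sum_vec[of f y] by simp

lemma has_derivative_line:
  fixes f :: "'a::real_normed_vector \<Rightarrow> real"
  assumes "(f has_derivative f') (at x)"
  shows "DERIV (\<lambda>s. f (x + s *\<^sub>R u)) 0 :> f' u"
proof -
  have "((\<lambda>s. x + s *\<^sub>R u) has_derivative (\<lambda>s. s *\<^sub>R u)) (at 0)"
    by (auto intro!: derivative_eq_intros)
  from has_derivative_compose[OF this, of f f'] assms
  show ?thesis
    using linear_scale[OF has_derivative_linear[OF assms]]
    by (simp add: has_field_derivative_def mult_commute_abs)
qed

text \<open>\<open>B\<close> and \<open>\<beta>\<close> are the coordinate expressions of the
  Riemannian metric and of the one-form dual to \<open>Q\<close>. The strict inequality
  \<open>bound\<close> encodes both that \<open>\<beta>\<close> has norm below 1 and that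
  \<open>B\<close> is positive definite. Linearity is asked at every \<open>x\<close>, also outside
  \<open>U\<close>, so that it can be used as a rewrite rule without side conditions.\<close>

locale randers_chart =
  fixes U :: "(real^'n::finite) set"
    and B :: "real^'n \<Rightarrow> real^'n \<Rightarrow> real^'n \<Rightarrow> real"
    and \<beta> :: "real^'n \<Rightarrow> real^'n \<Rightarrow> real"
    and L :: "real^'n \<Rightarrow> real^'n \<Rightarrow> real"
  assumes open_U: "open U"
    and lin_B: "linear (B x v)"
    and sym_B: "B x v w = B x w v"
    and lin_\<beta>: "linear (\<beta> x)"
    and bound: "x \<in> U \<Longrightarrow> y \<noteq> 0 \<Longrightarrow> \<bar>\<beta> x y\<bar> < sqrt (B x y y)"
    and smooth_B: "smooth_on U (\<lambda>x. B x v w)"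
    and smooth_\<beta>: "smooth_on U (\<lambda>x. \<beta> x v)"
    and L_eq: "x \<in> U \<Longrightarrow> L x y = sqrt (B x y y) + \<beta> x y"
begin

lemma lin_B': "linear (\<lambda>v. B x v w)"
  by (rule linearI) (simp_all add: sym_B[of x _ w] linear_add[OF lin_B] linear_scale[OF lin_B])

lemmas B_simps =
  linear_add[OF lin_B] linear_diff[OF lin_B] linear_scale[OF lin_B] linear_0[OF lin_B] linear_neg[OF lin_B]
  linear_add[OF lin_B'] linear_diff[OF lin_B'] linear_scale[OF lin_B'] linear_0[OF lin_B'] linear_neg[OF lin_B']
  linear_add[OF lin_\<beta>] linear_diff[OF lin_\<beta>] linear_scale[OF lin_\<beta>] linear_0[OF lin_\<beta>] linear_neg[OF lin_\<beta>]

lemma B_pos: "x \<in> U \<Longrightarrow> y \<noteq> 0 \<Longrightarrow> B x y y > 0"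
  using le_less_trans[OF abs_ge_zero bound[of x y]] by simp

definition norm_B :: "real^'n \<Rightarrow> real^'n \<Rightarrow> real" where
  "norm_B x y = sqrt (B x y y)"

definition rnorm :: "real^'n \<Rightarrow> real^'n \<Rightarrow> real" where
  "rnorm x y = norm_B x y + \<beta> x y"

definition rnorm' :: "real^'n \<Rightarrow> real^'n \<Rightarrow> real^'n \<Rightarrow> real" where
  "rnorm' x y v = B x v y / norm_B x y + \<beta> x v"

text \<open>The Hessian of half the square, in the form (norm times its second derivative) plus
  (product of first derivatives). The one-form is linear in \<open>y\<close>, hence it enters the
  second derivative only through the factor \<open>rnorm x y\<close>.\<close>

definition fund :: "real^'n \<Rightarrow> real^'n \<Rightarrow> real^'n \<Rightarrow> real^'n \<Rightarrow> real" where
  "fund x y v w = rnorm x y / norm_B x y * (B x v w - B x v y * B x w y / B x y y)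
    + rnorm' x y v * rnorm' x y w"

lemma norm_B_pos: "x \<in> U \<Longrightarrow> y \<noteq> 0 \<Longrightarrow> norm_B x y > 0"
  by (simp add: norm_B_def B_pos)

lemma norm_B_sq: "x \<in> U \<Longrightarrow> y \<noteq> 0 \<Longrightarrow> norm_B x y * norm_B x y = B x y y"
  using B_pos[of x y] by (simp add: norm_B_def)

lemma rnorm_pos: "x \<in> U \<Longrightarrow> y \<noteq> 0 \<Longrightarrow> rnorm x y > 0"
  using bound[of x y] by (simp add: rnorm_def norm_B_def)

lemma fund_sym: "fund x y v w = fund x y w v"
  by (simp add: fund_def sym_B[of x v w] mult.commute)

lemma linear_rnorm': "linear (rnorm' x y)"
  by (rule linearI) (simp_all add: rnorm'_def B_simps add_divide_distrib algebra_simps)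

lemma linear_fund: "linear (fund x y v)"
  by (rule linearI) (simp_all add: fund_def B_simps linear_add[OF linear_rnorm'] linear_scale[OF linear_rnorm']
      algebra_simps add_divide_distrib)

lemma linear_fund': "linear (\<lambda>v. fund x y v w)"
  by (rule linearI) (simp_all add: fund_sym[of x y _ w] linear_add[OF linear_fund] linear_scale[OF linear_fund])

lemma rnorm_DERIV:
  assumes "x \<in> U" "y \<noteq> 0"
  shows "DERIV (\<lambda>t. norm_B x (y + t *\<^sub>R v)) 0 :> B x v y / norm_B x y"
    and "DERIV (\<lambda>t. rnorm x (y + t *\<^sub>R v)) 0 :> rnorm' x y v"
proof -
  have e: "B x (y + t *\<^sub>R v) (y + t *\<^sub>R v) = B x y y + 2 * t * B x v y + t\<^sup>2 * B x v v" for t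
    by (simp add: B_simps sym_B[of x y v] algebra_simps power2_eq_square)
  have "DERIV (\<lambda>t. B x y y + 2 * t * B x v y + t\<^sup>2 * B x v v) 0 :> 2 * B x v y"
    by (auto intro!: derivative_eq_intros)
  from DERIV_chain2[OF DERIV_real_sqrt this] B_pos[OF assms]
  have "DERIV (\<lambda>t. norm_B x (y + t *\<^sub>R v)) 0 :> inverse (norm_B x y) / 2 * (2 * B x v y)"
    unfolding norm_B_def e by simp
  then show 1: "DERIV (\<lambda>t. norm_B x (y + t *\<^sub>R v)) 0 :> B x v y / norm_B x y"
    by (simp add: field_simps)
  have "DERIV (\<lambda>t. norm_B x (y + t *\<^sub>R v) + (\<beta> x y + t * \<beta> x v)) 0 :> B x v y / norm_B x y + \<beta> x v"
    by (auto intro!: derivative_eq_intros 1)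
  then show "DERIV (\<lambda>t. rnorm x (y + t *\<^sub>R v)) 0 :> rnorm' x y v"
    by (simp add: rnorm_def rnorm'_def B_simps)
qed

lemma rnorm_mult_rnorm'_DERIV:
  assumes "x \<in> U" "y \<noteq> 0"
  shows "DERIV (\<lambda>t. rnorm x (y + t *\<^sub>R v) * rnorm' x (y + t *\<^sub>R v) w) 0 :> fund x y v w"
proof -
  note n = norm_B_pos[OF assms]
  have "DERIV (\<lambda>t. rnorm x (y + t *\<^sub>R v) *
      ((B x w y + t * B x w v) / norm_B x (y + t *\<^sub>R v) + \<beta> x w)) 0 :>
      rnorm' x y v * rnorm' x y w + (B x w v * norm_B x y - B x w y * (B x v y / norm_B x y)) /
        (norm_B x y * norm_B x y) * rnorm x y"
    using n by (auto intro!: derivative_eq_intros rnorm_DERIV[OF assms] simp: rnorm'_def)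
  also have "rnorm' x y v * rnorm' x y w + (B x w v * norm_B x y - B x w y * (B x v y / norm_B x y)) /
        (norm_B x y * norm_B x y) * rnorm x y = fund x y v w"
    using n B_pos[OF assms] by (simp add: fund_def norm_B_sq[OF assms, symmetric] sym_B[of x w v] field_simps)
  finally show ?thesis by (simp add: rnorm'_def B_simps)
qed

lemma rnorm_line:
  assumes "x \<in> U" "y \<noteq> 0"
  shows "DERIV (\<lambda>t. (rnorm x (y + t *\<^sub>R w))\<^sup>2) 0 :> 2 * (rnorm x y * rnorm' x y w)"
  by (auto intro!: derivative_eq_intros rnorm_DERIV[OF assms])

lemma eventually_line_nonzero:
  fixes y :: "real^'n"
  assumes "y \<noteq> 0"
  shows "eventually (\<lambda>s. y + s *\<^sub>R v \<noteq> 0) (nhds (0::real))"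
proof -
  have "isCont (\<lambda>s. y + s *\<^sub>R v) 0" by (intro continuous_intros)
  then have "(\<lambda>s. y + s *\<^sub>R v) \<midarrow>0\<rightarrow> y" by (simp add: isCont_def)
  then show ?thesis
    using assms tendsto_imp_eventually_ne[of "\<lambda>s. y + s *\<^sub>R v" y "at 0" 0]
    by (auto simp: eventually_at_filter elim: eventually_mono)
qed

lemma fund_eq_deriv:
  assumes "x \<in> U" "y \<noteq> 0"
  shows "1/2 * deriv (\<lambda>s. deriv (\<lambda>t. (L x (y + s *\<^sub>R v + t *\<^sub>R w))\<^sup>2) 0) 0 = fund x y v w"
proof -
  have "deriv (\<lambda>t. (L x (z + t *\<^sub>R w))\<^sup>2) 0 = 2 * (rnorm x z * rnorm' x z w)" if "z \<noteq> 0" for z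
    using DERIV_imp_deriv[OF rnorm_line[OF assms(1) that]] L_eq[OF assms(1)]
    by (simp add: rnorm_def norm_B_def)
  \<comment> \<open>The inner derivative has the explicit form only off the zero vector, which is
    enough since the outer one sees only small \<open>s\<close>.\<close>
  then have "eventually (\<lambda>s. deriv (\<lambda>t. (L x (y + s *\<^sub>R v + t *\<^sub>R w))\<^sup>2) 0 =
      2 * (rnorm x (y + s *\<^sub>R v) * rnorm' x (y + s *\<^sub>R v) w)) (nhds 0)"
    using eventually_line_nonzero[OF assms(2), of v] by (auto elim: eventually_mono)
  then have "deriv (\<lambda>s. deriv (\<lambda>t. (L x (y + s *\<^sub>R v + t *\<^sub>R w))\<^sup>2) 0) 0 =
      deriv (\<lambda>s. 2 * (rnorm x (y + s *\<^sub>R v) * rnorm' x (y + s *\<^sub>R v) w)) 0"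
    by (rule deriv_cong_ev) simp
  also have "\<dots> = 2 * fund x y v w"
    by (intro DERIV_imp_deriv DERIV_cmult rnorm_mult_rnorm'_DERIV assms)
  finally show ?thesis by simp
qed

lemma fund_matrix_eq:
  assumes "x \<in> U" "y \<noteq> 0"
  shows "fund_matrix L x y $ i $ j = fund x y (axis i 1) (axis j 1)"
  using fund_eq_deriv[OF assms] by (simp add: fund_matrix_def partial_def)

text \<open>Euler's relations: by homogeneity of degree 1 the derivative of the norm at
  \<open>y\<close> in direction \<open>y\<close> is the norm itself, and its second derivative
  annihilates \<open>y\<close>.\<close>

lemma fund_self:
  assumes "x \<in> U" "y \<noteq> 0"
  shows "fund x y v y = rnorm x y * rnorm' x y v"
    and "fund x y y y = (rnorm x y)\<^sup>2"
proof -
  have "rnorm' x y y = rnorm x y"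
    using norm_B_pos[OF assms] norm_B_sq[OF assms]
    by (simp add: rnorm'_def rnorm_def field_simps)
  then show "fund x y v y = rnorm x y * rnorm' x y v"
    using B_pos[OF assms] by (simp add: fund_def)
  then show "fund x y y y = (rnorm x y)\<^sup>2"
    using \<open>rnorm' x y y = rnorm x y\<close>
    using B_pos[OF assms] by (simp add: fund_def power2_eq_square)
qed

text \<open>Remove from \<open>v\<close> its \<open>B\<close>-component along \<open>y\<close>. The
  bracket in \<open>fund\<close> is then the squared length of the remainder \<open>w\<close>, and
  the other summand is a square. If \<open>w = 0\<close>, then \<open>v\<close> is a multiple of
  \<open>y\<close> and Euler's relation gives a positive value.\<close>

lemma fund_pos:
  assumes "x \<in> U" "y \<noteq> 0" "v \<noteq> 0"
  shows "fund x y v v > 0"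
proof -
  define c where "c = B x v y / B x y y"
  define w where "w = v - c *\<^sub>R y"
  note p = B_pos[OF assms(1,2)]
  have e: "B x v v - B x v y * B x v y / B x y y = B x w w"
    using p by (simp add: w_def B_simps c_def field_simps sym_B[of x y v])
  have f: "fund x y v v = rnorm x y / norm_B x y * B x w w + (rnorm' x y v)\<^sup>2"
    by (simp add: fund_def e power2_eq_square)
  note q = divide_pos_pos[OF rnorm_pos[OF assms(1,2)] norm_B_pos[OF assms(1,2)]]
  show ?thesis
  proof (cases "w = 0")
    case True
    then have v: "v = c *\<^sub>R y" by (simp add: w_def)
    then have "c \<noteq> 0" using assms by auto
    moreover have "fund x y v v = c\<^sup>2 * (rnorm x y)\<^sup>2"
      using fund_self(2)[OF assms(1,2)]
      by (simp add: v linear_scale[OF linear_fund] linear_scale[OF linear_fund'] power2_eq_square)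
    ultimately show ?thesis using rnorm_pos[OF assms(1,2)] by simp
  next
    case False
    then have "rnorm x y / norm_B x y * B x w w > 0"
      by (intro mult_pos_pos q B_pos assms)
    then show ?thesis unfolding f by (simp add: add_pos_nonneg)
  qed
qed

lemma fund_matrix_mult:
  assumes "x \<in> U" "y \<noteq> 0"
  shows "(fund_matrix L x y *v v) $ i = fund x y (axis i 1) v"
  using linear_axis_sum[OF linear_fund[of x y "axis i 1"], of v]
  by (simp add: matrix_vector_mult_def fund_matrix_eq[OF assms] mult.commute)

lemma inner_fund_matrix:
  assumes "x \<in> U" "y \<noteq> 0"
  shows "v \<bullet> (fund_matrix L x y *v v) = fund x y v v"
  using linear_axis_sum[OF linear_fund', of v x y v]
  by (simp add: inner_vec_def fund_matrix_mult[OF assms])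

text \<open>Positive definiteness makes the matrix invertible. In this form the inverse merely
  raises an index, and all later occurrences of \<open>matrix_inv\<close> are eliminated by
  it.\<close>

lemma matrix_inv_fund_matrix:
  assumes "x \<in> U" "y \<noteq> 0"
  shows "(\<Sum>l\<in>UNIV. matrix_inv (fund_matrix L x y) $ i $ l * fund x y (axis l 1) u) = u $ i"
proof -
  let ?g = "fund_matrix L x y"
  have "v = 0" if "?g *v v = 0" for v
    using fund_pos[OF assms, of v] inner_fund_matrix[OF assms, of v] that by (cases "v = 0") auto
  then have "invertible ?g"
    by (simp add: invertible_left_inverse matrix_left_invertible_ker)
  then have "matrix_inv ?g ** ?g = mat 1"
    unfolding matrix_inv_def invertible_def by (rule someI2_ex) auto
  then have "matrix_inv ?g *v (?g *v u) = u"
    by (simp add: matrix_vector_mul_assoc)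
  then have "(matrix_inv ?g *v (?g *v u)) $ i = u $ i" by simp
  then show ?thesis
    by (simp add: matrix_vector_mult_def[of "matrix_inv ?g"] fund_matrix_mult[OF assms])
qed

section \<open>Smoothness and derivatives of the fundamental tensor off the zero section\<close>

abbreviation Z :: "((real^'n) \<times> (real^'n)) set" where
  "Z \<equiv> U \<times> - {0}"

lemma open_Z: "open Z"
  by (intro open_Times open_U open_Compl closed_singleton)

lemma smooth_fst:
  assumes "smooth_on U f"
  shows "smooth_on Z (\<lambda>z. f (fst z))"
  by (rule smooth_on_compose_linear[OF open_U open_Z bounded_linear_fst _ assms]) auto

lemma smooth_snd: "smooth_on Z (\<lambda>z. snd z $ k)"
  by (intro smooth_on_bounded_linear open_Z
      bounded_linear_compose[OF bounded_linear_vec_nth bounded_linear_snd])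

lemma smooth_B_snd: "smooth_on Z (\<lambda>z. B (fst z) v (snd z))"
proof -
  have "smooth_on Z (\<lambda>z. \<Sum>k\<in>UNIV. snd z $ k * B (fst z) v (axis k 1))"
    by (intro smooth_on_sum smooth_on_mult open_Z smooth_snd smooth_fst smooth_B)
  then show ?thesis by (simp add: linear_axis_sum[OF lin_B])
qed

lemma smooth_B_snd2: "smooth_on Z (\<lambda>z. B (fst z) (snd z) (snd z))"
proof -
  have "smooth_on Z (\<lambda>z. \<Sum>k\<in>UNIV. snd z $ k * B (fst z) (axis k 1) (snd z))"
    by (intro smooth_on_sum smooth_on_mult open_Z smooth_snd smooth_B_snd)
  then show ?thesis by (simp add: linear_axis_sum[OF lin_B'])
qed

lemma smooth_\<beta>_snd: "smooth_on Z (\<lambda>z. \<beta> (fst z) (snd z))"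
proof -
  have "smooth_on Z (\<lambda>z. \<Sum>k\<in>UNIV. snd z $ k * \<beta> (fst z) (axis k 1))"
    by (intro smooth_on_sum smooth_on_mult open_Z smooth_snd smooth_fst smooth_\<beta>)
  then show ?thesis by (simp add: linear_axis_sum[OF lin_\<beta>])
qed

lemma smooth_norm_B: "smooth_on Z (\<lambda>z. norm_B (fst z) (snd z))"
  unfolding norm_B_def
  by (intro smooth_on_sqrt open_Z smooth_B_snd2) (auto intro: B_pos)

lemma smooth_rnorm: "smooth_on Z (\<lambda>z. rnorm (fst z) (snd z))"
  unfolding rnorm_def by (intro smooth_on_add open_Z smooth_norm_B smooth_\<beta>_snd)

lemma smooth_rnorm': "smooth_on Z (\<lambda>z. rnorm' (fst z) (snd z) v)"
  unfolding rnorm'_def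
  by (intro smooth_on_add smooth_on_divide open_Z smooth_norm_B smooth_B_snd smooth_fst smooth_\<beta>)
    (auto dest: norm_B_pos)

lemma smooth_fund: "smooth_on Z (\<lambda>z. fund (fst z) (snd z) v w)"
proof -
  have "smooth_on Z (\<lambda>z. rnorm (fst z) (snd z) / norm_B (fst z) (snd z) * (B (fst z) v w +
      (-1) * (B (fst z) v (snd z) * B (fst z) w (snd z) / B (fst z) (snd z) (snd z)))
      + rnorm' (fst z) (snd z) v * rnorm' (fst z) (snd z) w)"
    by (intro smooth_on_add smooth_on_mult smooth_on_divide smooth_on_const open_Z smooth_rnorm smooth_norm_B
        smooth_rnorm' smooth_B_snd smooth_B_snd2 smooth_fst[OF smooth_B])
      (auto dest: norm_B_pos B_pos)
  then show ?thesis by (simp add: fund_def)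
qed

text \<open>A single derivative in the pair \<open>(x, y)\<close>: \<open>(\<xi>, 0)\<close> varies
  the position and \<open>(0, \<eta>)\<close> the direction, so that a horizontal derivative is just
  the value at \<open>(\<xi>, - \<Gamma> \<xi> y)\<close>.\<close>

definition D :: "real^'n \<Rightarrow> real^'n \<Rightarrow> (real^'n) \<times> (real^'n) \<Rightarrow> (real^'n) \<times> (real^'n) \<Rightarrow> real" where
  "D v w z = frechet_derivative (\<lambda>z. fund (fst z) (snd z) v w) (at z)"

lemma D_works:
  "x \<in> U \<Longrightarrow> y \<noteq> 0 \<Longrightarrow>
    ((\<lambda>z. fund (fst z) (snd z) v w) has_derivative D v w (x, y)) (at (x, y))"
  using smooth_on_differentiable[OF smooth_fund, of "(x, y)"]
  by (simp add: D_def frechet_derivative_works[symmetric])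

lemma linear_D: "x \<in> U \<Longrightarrow> y \<noteq> 0 \<Longrightarrow> linear (D v w (x, y))"
  by (rule has_derivative_linear[OF D_works])

lemma D_sym: "D v w z = D w v z"
  by (simp add: D_def fund_sym[of _ _ v w])

lemma linear_D':
  assumes "x \<in> U" "y \<noteq> 0"
  shows "linear (\<lambda>w. D v w (x, y) \<zeta>)"
proof (rule linearI)
  fix a b :: "real^'n" and r :: real
  have "((\<lambda>z. fund (fst z) (snd z) v (a + b)) has_derivative (\<lambda>\<zeta>. D v a (x, y) \<zeta> + D v b (x, y) \<zeta>)) (at (x, y))"
    using has_derivative_add[OF D_works[OF assms, of v a] D_works[OF assms, of v b]]
    by (simp add: linear_add[OF linear_fund])
  from has_derivative_unique[OF D_works[OF assms] this]
  show "D v (a + b) (x, y) \<zeta> = D v a (x, y) \<zeta> + D v b (x, y) \<zeta>" by simp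
  have "((\<lambda>z. fund (fst z) (snd z) v (r *\<^sub>R a)) has_derivative (\<lambda>\<zeta>. r *\<^sub>R D v a (x, y) \<zeta>)) (at (x, y))"
    using has_derivative_scaleR_right[OF D_works[OF assms, of v a], of r]
    by (simp add: linear_scale[OF linear_fund])
  from has_derivative_unique[OF D_works[OF assms] this]
  show "D v (r *\<^sub>R a) (x, y) \<zeta> = r *\<^sub>R D v a (x, y) \<zeta>" by simp
qed

lemma linear_D'':
  assumes "x \<in> U" "y \<noteq> 0"
  shows "linear (\<lambda>v. D v w (x, y) \<zeta>)"
  using linear_D'[OF assms, of w \<zeta>] by (simp add: D_sym[of w])

lemma linear_D_Pair:
  assumes "x \<in> U" "y \<noteq> 0"
  shows "linear (\<lambda>\<xi>. D v w (x, y) (\<xi>, 0))" "linear (\<lambda>\<eta>. D v w (x, y) (0, \<eta>))"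
  using linear_compose[OF _ linear_D[OF assms], of "\<lambda>\<xi>. (\<xi>, 0)" v w]
    linear_compose[OF _ linear_D[OF assms], of "\<lambda>\<eta>. (0, \<eta>)" v w]
  by (simp_all add: o_def linear_iff)

lemma partial_fund:
  assumes "x \<in> U" "y \<noteq> 0"
  shows "partial m (\<lambda>y. fund x y v w) y = D v w (x, y) (0, axis m 1)"
    and "partial m (\<lambda>x. fund x y v w) x = D v w (x, y) (axis m 1, 0)"
proof -
  have "((\<lambda>y. (x, y)) has_derivative (\<lambda>\<eta>. (0, \<eta>))) (at y)"
    by (auto intro!: derivative_eq_intros)
  from partial_eq[OF has_derivative_compose[OF this D_works[OF assms]], of m v w]
  show "partial m (\<lambda>y. fund x y v w) y = D v w (x, y) (0, axis m 1)" by simp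
  have "((\<lambda>x. (x, y)) has_derivative (\<lambda>\<xi>. (\<xi>, 0))) (at x)"
    by (auto intro!: derivative_eq_intros)
  from partial_eq[OF has_derivative_compose[OF this D_works[OF assms]], of m v w]
  show "partial m (\<lambda>x. fund x y v w) x = D v w (x, y) (axis m 1, 0)" by simp
qed

text \<open>Differentiating \<open>fund_self\<close> replaces the symmetry of the third derivatives of \<open>L\<^sup>2\<close>.\<close>

lemma D_self:
  assumes "x \<in> U" "y \<noteq> 0"
  shows "D v y (x, y) (0, \<eta>) = 0"
proof -
  \<comment> \<open>The tensor at the moving direction, with that same direction in the last slot.
    The product rule yields \<open>fund x y v \<eta>\<close> plus the term in question, Euler's
    relation yields \<open>fund x y \<eta> v\<close>; symmetry leaves 0.\<close>
  let ?f = "\<lambda>t. \<Sum>k\<in>UNIV. (y + t *\<^sub>R \<eta>) $ k * fund x (y + t *\<^sub>R \<eta>) v (axis k 1)"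
  have d: "DERIV (\<lambda>t. fund x (y + t *\<^sub>R \<eta>) v w) 0 :> D v w (x, y) (0, \<eta>)" for w
    using has_derivative_line[OF D_works[OF assms, of v w], of "(0, \<eta>)"] by simp
  have "DERIV ?f 0 :> (\<Sum>k\<in>UNIV. \<eta> $ k * fund x y v (axis k 1) + y $ k * D v (axis k 1) (x, y) (0, \<eta>))"
    by (auto intro!: derivative_eq_intros d simp: mult.commute)
  also have "(\<Sum>k\<in>UNIV. \<eta> $ k * fund x y v (axis k 1) + y $ k * D v (axis k 1) (x, y) (0, \<eta>)) =
      fund x y v \<eta> + D v y (x, y) (0, \<eta>)"
    by (simp add: sum.distrib linear_axis_sum[OF linear_fund] linear_axis_sum[OF linear_D'[OF assms]])
  finally have 1: "DERIV ?f 0 :> fund x y v \<eta> + D v y (x, y) (0, \<eta>)" .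
  have "?f t = fund x (y + t *\<^sub>R \<eta>) v (y + t *\<^sub>R \<eta>)" for t
    by (rule linear_axis_sum[OF linear_fund])
  then have ev: "eventually (\<lambda>t. ?f t = rnorm x (y + t *\<^sub>R \<eta>) * rnorm' x (y + t *\<^sub>R \<eta>) v) (nhds 0)"
    using eventually_line_nonzero[OF assms(2), of \<eta>]
    by (auto elim!: eventually_mono simp: fund_self[OF assms(1)])
  have "DERIV ?f 0 :> fund x y \<eta> v"
    using rnorm_mult_rnorm'_DERIV[OF assms, of \<eta> v] DERIV_cong_ev[OF refl ev refl] by blast
  with 1 show ?thesis
    using DERIV_unique fund_sym[of x y v \<eta>] by fastforce
qed

end

text \<open>The hypotheses say that the torsion free connection \<open>\<Gamma>\<close> at \<open>x\<close> makes \<open>B\<close> and \<open>\<beta>\<close> parallel.\<close>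

locale randers_parallel = randers_chart +
  fixes x and \<Gamma> :: "real^'a \<Rightarrow> real^'a \<Rightarrow> real^'a"
  assumes x: "x \<in> U"
    and linear_\<Gamma>: "linear (\<Gamma> \<xi>)"
    and \<Gamma>_sym: "\<Gamma> \<xi> v = \<Gamma> v \<xi>"
    and B_parallel: "((\<lambda>x. B x v w) has_derivative (\<lambda>\<xi>. B x (\<Gamma> \<xi> v) w + B x v (\<Gamma> \<xi> w))) (at x)"
    and \<beta>_parallel: "((\<lambda>x. \<beta> x v) has_derivative (\<lambda>\<xi>. \<beta> x (\<Gamma> \<xi> v))) (at x)"
begin

text \<open>The direction is moved by infinitesimal parallel transport. Along this curve the length
  of \<open>y\<close>, the value of \<open>\<beta>\<close> on it and hence the Randers norm are
  stationary, so only the fixed arguments \<open>v\<close> and \<open>w\<close> contribute.\<close>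

lemma fund_parallel_DERIV:
  assumes y: "y \<noteq> 0"
  shows "DERIV (\<lambda>s. fund (x + s *\<^sub>R \<xi>) (y - s *\<^sub>R \<Gamma> \<xi> y) v w) 0 :> fund x y (\<Gamma> \<xi> v) w + fund x y v (\<Gamma> \<xi> w)"
proof -
  let ?N = "\<Gamma> \<xi> y"
  let ?x = "\<lambda>s. x + s *\<^sub>R \<xi>" and ?y = "\<lambda>s. y - s *\<^sub>R \<Gamma> \<xi> y"
  have dB: "DERIV (\<lambda>s. B (?x s) v w) 0 :> B x (\<Gamma> \<xi> v) w + B x v (\<Gamma> \<xi> w)" for v w
    by (rule has_derivative_line[OF B_parallel])
  have db: "DERIV (\<lambda>s. \<beta> (?x s) v) 0 :> \<beta> x (\<Gamma> \<xi> v)" for v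
    by (rule has_derivative_line[OF \<beta>_parallel])
  have dp: "DERIV (\<lambda>s. B (?x s) v (?y s)) 0 :> B x (\<Gamma> \<xi> v) y" for v
    unfolding B_simps by (auto intro!: derivative_eq_intros dB)
  have dA: "DERIV (\<lambda>s. B (?x s) (?y s) (?y s)) 0 :> 0"
    unfolding B_simps by (auto intro!: derivative_eq_intros dB simp: sym_B[of x y])
  have d\<beta>: "DERIV (\<lambda>s. \<beta> (?x s) (?y s)) 0 :> 0"
    unfolding B_simps by (auto intro!: derivative_eq_intros db)
  note n = norm_B_pos[OF x y] B_pos[OF x y]
  have dn: "DERIV (\<lambda>s. norm_B (?x s) (?y s)) 0 :> 0"
    using DERIV_chain2[OF DERIV_real_sqrt dA] n(2) unfolding norm_B_def by simp
  have dr: "DERIV (\<lambda>s. rnorm (?x s) (?y s)) 0 :> 0"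
    unfolding rnorm_def using DERIV_add[OF dn d\<beta>] by simp
  have dr': "DERIV (\<lambda>s. rnorm' (?x s) (?y s) v) 0 :> rnorm' x y (\<Gamma> \<xi> v)" for v
    unfolding rnorm'_def using n by (auto intro!: derivative_eq_intros dn dp db)
  show ?thesis
    unfolding fund_def using n
    by (auto intro!: derivative_eq_intros dn dp dB dr dr' dA simp: field_simps)
qed

text \<open>Splitting the horizontal direction into its two parts expresses a position derivative by
  \<open>\<Gamma>\<close>-terms and a derivative in \<open>y\<close>. The latter is the Cartan
  tensor up to a factor, the deviation of the Randers metric from a Riemannian one.\<close>

lemma D_parallel:
  assumes y: "y \<noteq> 0"
  shows "D v w (x, y) (\<xi>, 0) = fund x y (\<Gamma> \<xi> v) w + fund x y v (\<Gamma> \<xi> w) + D v w (x, y) (0, \<Gamma> \<xi> y)"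
proof -
  have "DERIV (\<lambda>s. fund (x + s *\<^sub>R \<xi>) (y - s *\<^sub>R \<Gamma> \<xi> y) v w) 0 :> D v w (x, y) (\<xi>, - \<Gamma> \<xi> y)"
    using has_derivative_line[OF D_works[OF x y, of v w], of "(\<xi>, - \<Gamma> \<xi> y)"] by simp
  then have "fund x y (\<Gamma> \<xi> v) w + fund x y v (\<Gamma> \<xi> w) = D v w (x, y) (\<xi>, - \<Gamma> \<xi> y)"
    using DERIV_unique[OF fund_parallel_DERIV[OF y]] by blast
  also have "\<dots> = D v w (x, y) (\<xi>, 0) - D v w (x, y) (0, \<Gamma> \<xi> y)"
    by (simp add: linear_diff[OF linear_D[OF x y], symmetric])
  finally show ?thesis by simp
qed

lemma partial_fund_matrix:
  assumes y: "y \<noteq> 0"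
  shows "partial m (\<lambda>x. fund_matrix L x y $ i $ j) x = D (axis i 1) (axis j 1) (x, y) (axis m 1, 0)"
    and "partial m (\<lambda>y. fund_matrix L x y $ i $ j) y = D (axis i 1) (axis j 1) (x, y) (0, axis m 1)"
proof -
  have "((\<lambda>t. x + t *\<^sub>R axis m 1) \<longlongrightarrow> x + 0 *\<^sub>R axis m 1) (nhds (0::real))"
    by (intro tendsto_intros filterlim_ident)
  then have "eventually (\<lambda>t. x + t *\<^sub>R axis m 1 \<in> U) (nhds (0::real))"
    using open_U x by (auto intro: topological_tendstoD)
  then have "partial m (\<lambda>x. fund_matrix L x y $ i $ j) x = partial m (\<lambda>x. fund x y (axis i 1) (axis j 1)) x"
    unfolding partial_def
    by (intro deriv_cong_ev) (auto elim!: eventually_mono simp: fund_matrix_eq[OF _ y])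
  then show "partial m (\<lambda>x. fund_matrix L x y $ i $ j) x = D (axis i 1) (axis j 1) (x, y) (axis m 1, 0)"
    by (simp add: partial_fund[OF x y])
  have "partial m (\<lambda>y. fund_matrix L x y $ i $ j) y = partial m (\<lambda>y. fund x y (axis i 1) (axis j 1)) y"
    unfolding partial_def
    by (intro deriv_cong_ev eventually_mono[OF eventually_line_nonzero[OF y, of "axis m 1"]])
      (auto simp: fund_matrix_eq[OF x])
  then show "partial m (\<lambda>y. fund_matrix L x y $ i $ j) y = D (axis i 1) (axis j 1) (x, y) (0, axis m 1)"
    by (simp add: partial_fund[OF x y])
qed

text \<open>Contracting twice with \<open>y\<close> puts \<open>y\<close> into a slot of every
  Cartan term, which \<open>D_self\<close> annihilates. The remaining terms combine as in the
  Riemannian Koszul formula.\<close>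

lemma spray_eq:
  assumes y: "y \<noteq> 0"
  shows "spray L x y i = 1/2 * \<Gamma> y y $ i"
proof -
  let ?T = "\<lambda>u v w. D v w (x, y) (u, 0)" and ?e = "\<lambda>i. axis i 1 :: real^'a"
  let ?g = "\<lambda>i l. matrix_inv (fund_matrix L x y) $ i $ l"
  have l: "linear (\<lambda>v. ?T v u w)" "linear (\<lambda>v. ?T u v w)" "linear (\<lambda>v. ?T u w v)" for u w
    using linear_D_Pair[OF x y] linear_D'[OF x y] linear_D''[OF x y] by auto
  note ls = linear_axis_sum[OF l(1)] linear_axis_sum[OF l(2)] linear_axis_sum[OF l(3)]
  have *: "(\<Sum>j\<in>UNIV. \<Sum>k\<in>UNIV. y $ j * (y $ k * f (?e j) (?e k))) = f y y"
    if "\<And>u. linear (f u)" "\<And>u. linear (\<lambda>v. f v u)" for f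
    by (simp add: sum_distrib_left[symmetric] linear_axis_sum[OF that(1)] linear_axis_sum[OF that(2)])
  have "(\<Sum>j\<in>UNIV. \<Sum>k\<in>UNIV. y $ j * (y $ k * (?T (?e j) (?e l) (?e k) + ?T (?e k) (?e j) (?e l)
      - ?T (?e l) (?e j) (?e k)))) = ?T y (?e l) y + ?T y y (?e l) - ?T (?e l) y y" for l
    unfolding ring_distribs sum_subtractf sum.distrib
    using *[OF l(3) l(1), of "?e l"] *[OF l(1) l(2), of "?e l"] *[OF l(3) l(2), of "?e l"] 
    by simp
  also have "?T y (?e l) y + ?T y y (?e l) - ?T (?e l) y y = 2 * fund x y (?e l) (\<Gamma> y y)" for l
    unfolding D_parallel[OF y]
    by (simp add: D_self[OF x y] D_sym[of y "?e l"] \<Gamma>_sym[of "?e l" y]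
        fund_sym[of x y "\<Gamma> y y" "?e l"] fund_sym[of x y y "\<Gamma> y (?e l)"])
  finally have **: "(\<Sum>j\<in>UNIV. \<Sum>k\<in>UNIV. y $ j * (y $ k * (?T (?e j) (?e l) (?e k) + ?T (?e k) (?e j) (?e l)
      - ?T (?e l) (?e j) (?e k)))) = 2 * fund x y (?e l) (\<Gamma> y y)" for l .
  have "spray L x y i = (\<Sum>j\<in>UNIV. \<Sum>k\<in>UNIV. \<Sum>l\<in>UNIV. 1/4 * ?g i l *
      (y $ j * (y $ k * (?T (?e j) (?e l) (?e k) + ?T (?e k) (?e j) (?e l) - ?T (?e l) (?e j) (?e k)))))"
    unfolding spray_def formal_christoffel_def partial_fund_matrix[OF y] sum_distrib_left sum_distrib_right
    by (intro sum.cong refl) (simp add: field_simps)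
  also have "\<dots> = (\<Sum>l\<in>UNIV. 1/4 * ?g i l * (\<Sum>j\<in>UNIV. \<Sum>k\<in>UNIV. 
      (y $ j * (y $ k * (?T (?e j) (?e l) (?e k) + ?T (?e k) (?e j) (?e l) - ?T (?e l) (?e j) (?e k))))))"
    unfolding sum_distrib_left
    by (subst sum.swap[of _ UNIV "UNIV::'a set"], subst (2) sum.swap)
      (rule refl)
  also have "\<dots> = 1/2 * (\<Sum>l\<in>UNIV. ?g i l * fund x y (?e l) (\<Gamma> y y))"
    unfolding ** sum_distrib_left by (intro sum.cong refl) simp
  finally show ?thesis
    by (simp add: matrix_inv_fund_matrix[OF x y])
qed

lemma nonlin_eq:
  assumes y: "y \<noteq> 0"
  shows "nonlin L x y i j = \<Gamma> (axis j 1) y $ i"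
proof -
  have e: "\<Gamma> (y + t *\<^sub>R v) (y + t *\<^sub>R v) $ i = \<Gamma> y y $ i + 2 * t * \<Gamma> v y $ i + t\<^sup>2 * \<Gamma> v v $ i" for t v
  proof -
    have "\<Gamma> (y + t *\<^sub>R v) (y + t *\<^sub>R v) = \<Gamma> y (y + t *\<^sub>R v) + t *\<^sub>R \<Gamma> v (y + t *\<^sub>R v)"
      by (simp only: \<Gamma>_sym[of "y + t *\<^sub>R v"] linear_add[OF linear_\<Gamma>] linear_scale[OF linear_\<Gamma>])
    then show ?thesis
      by (simp add: linear_add[OF linear_\<Gamma>] linear_scale[OF linear_\<Gamma>] \<Gamma>_sym[of y v] algebra_simps power2_eq_square)
  qed
  have "nonlin L x y i j = deriv (\<lambda>t. 1/2 * \<Gamma> (y + t *\<^sub>R axis j 1) (y + t *\<^sub>R axis j 1) $ i) 0"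
    unfolding nonlin_def partial_def
    by (intro deriv_cong_ev eventually_mono[OF eventually_line_nonzero[OF y, of "axis j 1"]])
      (auto simp: spray_eq)
  also have "\<dots> = \<Gamma> (axis j 1) y $ i"
    unfolding e by (rule DERIV_imp_deriv) (auto intro!: derivative_eq_intros)
  finally show ?thesis .
qed

text \<open>As the nonlinear connection is \<open>\<Gamma>\<close> applied to \<open>y\<close>, its
  correction cancels precisely the Cartan term of \<open>D_parallel\<close>.\<close>

lemma hderiv_fund:
  assumes y: "y \<noteq> 0"
  shows "hderiv L j (\<lambda>x y. fund_matrix L x y $ l $ k) x y =
    fund x y (\<Gamma> (axis j 1) (axis l 1)) (axis k 1) + fund x y (axis l 1) (\<Gamma> (axis j 1) (axis k 1))"
  using linear_axis_sum[OF linear_D_Pair(2)[OF x y], of "\<Gamma> (axis j 1) y" "axis l 1" "axis k 1"]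
  by (simp add: hderiv_def partial_fund_matrix[OF y] nonlin_eq[OF y] D_parallel[OF y])

text \<open>Of the six \<open>\<Gamma>\<close>-terms in the Koszul combination four cancel by
  symmetry of \<open>\<Gamma>\<close>. The other two are equal and absorb the factor 1/2, and
  inverting the fundamental matrix recovers \<open>\<Gamma>\<close>, with no trace of
  \<open>y\<close>.\<close>

theorem chern_eq:
  assumes y: "y \<noteq> 0"
  shows "chern L x y i j k = \<Gamma> (axis j 1) (axis k 1) $ i"
proof -
  have "chern L x y i j k =
      (\<Sum>l\<in>UNIV. matrix_inv (fund_matrix L x y) $ i $ l * fund x y (axis l 1) (\<Gamma> (axis j 1) (axis k 1)))"
    unfolding chern_def hderiv_fund[OF y]
    by (intro sum.cong refl)
      (simp add: fund_sym[of x y "\<Gamma> a b" for a b] \<Gamma>_sym[of "axis k 1"] \<Gamma>_sym[of _ "axis j 1"])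
  then show ?thesis by (simp add: matrix_inv_fund_matrix[OF x y])
qed

end

section \<open>Frames with constant structure functions\<close>

text \<open>\<open>br_inv\<close> says that every \<open>br u\<close> is skew for the Euclidean
  product: the Lie algebra form of bi-invariance of the metric. \<open>\<kappa>\<close> holds the
  frame coefficients of \<open>Q\<close>.\<close>

locale ad_invariant =
  fixes br :: "real^'n::finite \<Rightarrow> real^'n \<Rightarrow> real^'n"
    and \<kappa> :: "real^'n"
  assumes bilinear_br: "bounded_bilinear br"
    and br_antisym: "br u v = - br v u"
    and br_inv: "br u v \<bullet> w = - (br u w \<bullet> v)"
    and \<kappa>_central: "br \<kappa> u = 0"
    and norm_\<kappa>: "norm \<kappa> < 1"
begin

lemmas br_simps =
  bounded_bilinear.add_left[OF bilinear_br] bounded_bilinear.add_right[OF bilinear_br]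
  bounded_bilinear.diff_left[OF bilinear_br] bounded_bilinear.diff_right[OF bilinear_br]
  bounded_bilinear.scaleR_left[OF bilinear_br] bounded_bilinear.scaleR_right[OF bilinear_br]
  bounded_bilinear.minus_left[OF bilinear_br] bounded_bilinear.minus_right[OF bilinear_br]
  bounded_bilinear.zero_left[OF bilinear_br] bounded_bilinear.zero_right[OF bilinear_br]

lemma br_self: "br u u = 0"
  using br_antisym[of u u] by (simp add: eq_neg_iff_add_eq_0 scaleR_2[symmetric])

lemma br_inner_self: "br u v \<bullet> u = 0" "br u v \<bullet> v = 0"
proof -
  show "br u v \<bullet> v = 0" for u v using br_inv[of u v v] by simp
  from this[of v u] show "br u v \<bullet> u = 0" using br_antisym[of u v] by simp
qed

text \<open>Skewness turns centrality of \<open>\<kappa>\<close> into orthogonality to all brackets,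
  which is what makes \<open>Q\<close> parallel.\<close>

lemma \<kappa>_br: "\<kappa> \<bullet> br u v = 0"
  using br_inv[of u v \<kappa>] br_antisym[of u \<kappa>] by (simp add: inner_commute \<kappa>_central)

lemma \<kappa>_bound: "a \<noteq> 0 \<Longrightarrow> \<bar>\<kappa> \<bullet> a\<bar> < norm a"
proof -
  assume "a \<noteq> 0"
  then have "norm \<kappa> * norm a < 1 * norm a" by (intro mult_strict_right_mono norm_\<kappa>) simp
  with Cauchy_Schwarz_ineq2[of \<kappa> a] show ?thesis by simp
qed

end

text \<open>A frame is given by the linear family \<open>u \<mapsto> E x u\<close> of its constant combinations, with the dual
  frame \<open>co x\<close>; \<open>br\<close> is the bracket of such combinations and \<open>E x \<kappa>\<close> is the field \<open>Q\<close>.\<close>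

locale frame_chart = ad_invariant br \<kappa>
  for br :: "real^'n::finite \<Rightarrow> real^'n \<Rightarrow> real^'n" and \<kappa> :: "real^'n" +
  fixes U :: "(real^'n) set"
    and E co :: "real^'n \<Rightarrow> real^'n \<Rightarrow> real^'n"
    and L :: "real^'n \<Rightarrow> real^'n \<Rightarrow> real"
  assumes open_U: "open U"
    and linear_E: "linear (E x)"
    and linear_co: "linear (co x)"
    and co_E [simp]: "x \<in> U \<Longrightarrow> co x (E x u) = u"
    and E_co [simp]: "x \<in> U \<Longrightarrow> E x (co x v) = v"
    and smooth_E: "smooth_on U (\<lambda>x. E x u)"
    and smooth_co: "smooth_on U (\<lambda>x. co x v)"
    and bracket: "x \<in> U \<Longrightarrow> frechet_derivative (\<lambda>x. E x v) (at x) (E x u)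
      - frechet_derivative (\<lambda>x. E x u) (at x) (E x v) = E x (br u v)"
    and L_eq: "x \<in> U \<Longrightarrow> L x y = norm (co x y) + \<kappa> \<bullet> co x y"
begin

definition DE :: "real^'n \<Rightarrow> real^'n \<Rightarrow> real^'n \<Rightarrow> real^'n" where
  "DE x u = frechet_derivative (\<lambda>x. E x u) (at x)"

lemmas lin_simps =
  linear_add[OF linear_E] linear_diff[OF linear_E] linear_scale[OF linear_E] linear_0[OF linear_E] linear_neg[OF linear_E]
  linear_add[OF linear_co] linear_diff[OF linear_co] linear_scale[OF linear_co] linear_0[OF linear_co] linear_neg[OF linear_co]

lemma DE: "x \<in> U \<Longrightarrow> ((\<lambda>x. E x u) has_derivative DE x u) (at x)"
  using smooth_on_differentiable[OF smooth_E] by (simp add: DE_def frechet_derivative_works[symmetric])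

lemma linear_DE: "x \<in> U \<Longrightarrow> linear (DE x u)"
  by (rule has_derivative_linear[OF DE])

lemma DE_eq_sum:
  assumes "x \<in> U"
  shows "DE x u \<xi> = (\<Sum>k\<in>UNIV. u $ k *\<^sub>R DE x (axis k 1) \<xi>)"
  using has_derivative_unique[OF DE[OF assms]
      has_derivative_linear_family[OF open_U assms linear_E DE[OF assms] has_derivative_const[of u]]]
  by (simp add: lin_simps)

lemma linear_DE':
  assumes "x \<in> U"
  shows "linear (\<lambda>u. DE x u \<xi>)"
proof -
  have e: "(\<lambda>u. DE x u \<xi>) = (\<lambda>u. \<Sum>k\<in>UNIV. u $ k *\<^sub>R DE x (axis k 1) \<xi>)"
    by (intro ext DE_eq_sum assms)
  show ?thesis
    by (subst e, rule linearI) (simp_all add: scaleR_left_distrib sum.distrib scaleR_sum_right)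
qed

lemma bracket_DE: "x \<in> U \<Longrightarrow> DE x v (E x u) = DE x u (E x v) + E x (br u v)"
  using bracket[of x v u] by (simp add: DE_def algebra_simps)

lemma has_derivative_E:
  assumes "x \<in> U" "(w has_derivative w') (at x)"
  shows "((\<lambda>x. E x (w x)) has_derivative (\<lambda>\<xi>. DE x (w x) \<xi> + E x (w' \<xi>))) (at x)"
  using has_derivative_linear_family[OF open_U assms(1) linear_E DE[OF assms(1)] assms(2)]
  by (simp add: DE_eq_sum[OF assms(1), symmetric])

text \<open>Differentiating the constant \<open>E x (co x v) = v\<close> expresses the derivative of
  the dual frame by that of the frame.\<close>

lemma has_derivative_co_const:
  assumes "x \<in> U"
  shows "((\<lambda>x. co x v) has_derivative (\<lambda>\<xi>. - co x (DE x (co x v) \<xi>))) (at x)"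
proof -
  let ?D = "frechet_derivative (\<lambda>x. co x v) (at x)"
  have d: "((\<lambda>x. co x v) has_derivative ?D) (at x)"
    using smooth_on_differentiable[OF smooth_co assms] by (simp add: frechet_derivative_works[symmetric])
  from has_derivative_transform_within_open[OF has_derivative_E[OF assms d] open_U assms, of "\<lambda>x. v"]
  have "((\<lambda>x. v) has_derivative (\<lambda>\<xi>. DE x (co x v) \<xi> + E x (?D \<xi>))) (at x)" by simp
  from has_derivative_unique[OF this has_derivative_const]
  have "co x (DE x (co x v) \<xi> + E x (?D \<xi>)) = 0" for \<xi>
    by (simp add: fun_eq_iff lin_simps)
  then have "co x (DE x (co x v) \<xi>) + ?D \<xi> = 0" for \<xi>
    using assms by (simp add: lin_simps)
  then have "?D = (\<lambda>\<xi>. - co x (DE x (co x v) \<xi>))"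
    by (simp add: fun_eq_iff eq_neg_iff_add_eq_0 add.commute)
  with d show ?thesis by simp
qed

lemma smooth_co_vec:
  assumes "smooth_on U W"
  shows "smooth_on U (\<lambda>x. co x (W x))"
proof -
  have "smooth_on U (\<lambda>x. \<Sum>k\<in>UNIV. W x $ k *\<^sub>R co x (axis k 1))"
    by (intro smooth_on_sum smooth_on_scaleR smooth_on_nth open_U smooth_co assms)
  then show ?thesis by (simp add: linear_axis_sum_vec[OF linear_co])
qed

lemma smooth_inner:
  fixes f g :: "real^'n \<Rightarrow> real^'n"
  shows "smooth_on U f \<Longrightarrow> smooth_on U g \<Longrightarrow> smooth_on U (\<lambda>x. f x \<bullet> g x)"
  unfolding inner_vec_def inner_real_def
  by (intro smooth_on_sum smooth_on_mult smooth_on_nth open_U)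

text \<open>The Levi-Civita connection of an ad-invariant metric: \<open>\<nabla>\<^sub>E\<^sub>u E\<^sub>v = E\<^bsub>br u v / 2\<^esub>\<close>.\<close>

definition \<Gamma> :: "real^'n \<Rightarrow> real^'n \<Rightarrow> real^'n \<Rightarrow> real^'n" where
  "\<Gamma> x \<xi> v = - (1/2) *\<^sub>R (DE x (co x v) \<xi> + DE x (co x \<xi>) v)"

lemma \<Gamma>_commute: "\<Gamma> x \<xi> v = \<Gamma> x v \<xi>"
  by (simp add: \<Gamma>_def add.commute)

text \<open>The bracket relation exchanges the two arguments of the \<open>DE\<close> term at the
  cost of a bracket. Adding the derivative of the frame field thus leaves half the bracket, as a
  bi-invariant metric requires.\<close>

lemma \<Gamma>_eq:
  assumes "x \<in> U"
  shows "\<Gamma> x \<xi> v = E x ((1/2) *\<^sub>R br (co x \<xi>) (co x v)) - DE x (co x v) \<xi>"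
  using bracket_DE[OF assms, of "co x v" "co x \<xi>"] assms
  by (simp add: \<Gamma>_def lin_simps algebra_simps)

lemma co_\<Gamma>:
  "x \<in> U \<Longrightarrow> co x (\<Gamma> x \<xi> v) = (1/2) *\<^sub>R br (co x \<xi>) (co x v) - co x (DE x (co x v) \<xi>)"
  by (simp add: \<Gamma>_eq lin_simps)

lemma co_eq_0_iff: "x \<in> U \<Longrightarrow> co x y = 0 \<longleftrightarrow> y = 0"
  using E_co[of x y] linear_0[OF linear_E, of x] linear_0[OF linear_co, of x] by (metis (no_types))

sublocale randers_chart U "\<lambda>x v w. co x v \<bullet> co x w" "\<lambda>x v. \<kappa> \<bullet> co x v" L
proof (rule randers_chart.intro)
  show "linear (\<lambda>w. co x v \<bullet> co x w)" for x v
    by (rule linearI) (simp_all add: lin_simps inner_add_right)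
  show "linear (\<lambda>v. \<kappa> \<bullet> co x v)" for x
    by (rule linearI) (simp_all add: lin_simps inner_add_right)
  show "\<bar>\<kappa> \<bullet> co x y\<bar> < sqrt (co x y \<bullet> co x y)" if "x \<in> U" "y \<noteq> 0" for x y
    using \<kappa>_bound[of "co x y"] that by (simp add: co_eq_0_iff norm_eq_sqrt_inner)
qed (auto simp: open_U inner_commute L_eq norm_eq_sqrt_inner intro!: smooth_inner smooth_co smooth_on_const)

lemma norm_B_eq: "norm_B x y = norm (co x y)"
  by (simp add: norm_B_def norm_eq_sqrt_inner)

text \<open>The \<open>DE\<close> terms are accounted for by the derivative of \<open>co\<close>.
  What is left of metric compatibility is the skewness \<open>br_inv\<close>, and what is left of
  parallelism of the one-form is \<open>\<kappa>_br\<close>.\<close>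

lemma randers_parallel:
  assumes x: "x \<in> U"
  shows "randers_parallel U (\<lambda>x v w. co x v \<bullet> co x w) (\<lambda>x v. \<kappa> \<bullet> co x v) L x (\<Gamma> x)"
proof (intro randers_parallel.intro randers_parallel_axioms.intro randers_chart_axioms)
  show "x \<in> U" by fact
  show "linear (\<Gamma> x \<xi>)" for \<xi>
    using linear_compose[OF linear_co linear_DE'[OF x], of \<xi> x] linear_DE[OF x, of "co x \<xi>"]
    by (simp add: linear_iff \<Gamma>_def algebra_simps)
  show "\<Gamma> x \<xi> v = \<Gamma> x v \<xi>" for \<xi> v
    by (rule \<Gamma>_commute)
  show "((\<lambda>x. co x v \<bullet> co x w) has_derivative
      (\<lambda>\<xi>. co x (\<Gamma> x \<xi> v) \<bullet> co x w + co x v \<bullet> co x (\<Gamma> x \<xi> w))) (at x)" for v w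
  proof -
    have "co x v \<bullet> - co x (DE x (co x w) \<xi>) + - co x (DE x (co x v) \<xi>) \<bullet> co x w =
        co x (\<Gamma> x \<xi> v) \<bullet> co x w + co x v \<bullet> co x (\<Gamma> x \<xi> w)" for \<xi>
      using br_inv[of "co x \<xi>" "co x v" "co x w"]
      by (simp add: co_\<Gamma>[OF x] inner_diff_left inner_diff_right inner_commute)
    with has_derivative_inner[OF has_derivative_co_const[OF x] has_derivative_co_const[OF x], of v w]
    show ?thesis by simp
  qed
  show "((\<lambda>x. \<kappa> \<bullet> co x v) has_derivative (\<lambda>\<xi>. \<kappa> \<bullet> co x (\<Gamma> x \<xi> v))) (at x)" for v
    using has_derivative_inner_right[OF has_derivative_co_const[OF x], of \<kappa> v]
    by (simp add: co_\<Gamma>[OF x] inner_diff_right \<kappa>_br)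
qed

lemma chern_eq_\<Gamma>:
  "x \<in> U \<Longrightarrow> y \<noteq> 0 \<Longrightarrow> chern L x y i j k = \<Gamma> x (axis j 1) (axis k 1) $ i"
  by (rule randers_parallel.chern_eq[OF randers_parallel])

lemma linear_\<Gamma>:
  assumes "x \<in> U" shows "linear (\<Gamma> x \<xi>)" "linear (\<lambda>\<xi>. \<Gamma> x \<xi> v)"
proof -
  show l: "linear (\<Gamma> x \<xi>)" for \<xi>
    using randers_parallel[OF assms] by (simp add: randers_parallel_def randers_parallel_axioms_def)
  have "(\<lambda>\<xi>. \<Gamma> x \<xi> v) = \<Gamma> x v"
    by (intro ext \<Gamma>_commute)
  with l show "linear (\<lambda>\<xi>. \<Gamma> x \<xi> v)" by simp
qed

lemma sum_chern:
  assumes "x \<in> U" "y \<noteq> 0"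
  shows "(\<Sum>j\<in>UNIV. \<Sum>k\<in>UNIV. chern L x y i j k * v $ j * w $ k) = \<Gamma> x v w $ i"
proof -
  have "(\<Sum>j\<in>UNIV. \<Sum>k\<in>UNIV. chern L x y i j k * v $ j * w $ k) =
      (\<Sum>j\<in>UNIV. v $ j *\<^sub>R (\<Sum>k\<in>UNIV. w $ k *\<^sub>R \<Gamma> x (axis j 1) (axis k 1))) $ i"
    by (simp add: chern_eq_\<Gamma>[OF assms] sum_distrib_left mult_ac)
  also have "\<dots> = \<Gamma> x v w $ i"
    by (simp only: linear_axis_sum_vec[OF linear_\<Gamma>(1)[OF assms(1)]]
        linear_axis_sum_vec[OF linear_\<Gamma>(2)[OF assms(1)]])
  finally show ?thesis .
qed

text \<open>In frame coefficients, \<open>nabla v w\<close> is \<open>\<nabla>\<^sub>V W\<close> for \<open>V = E v\<close>, \<open>W = E w\<close>.\<close>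

definition nabla :: "(real^'n \<Rightarrow> real^'n) \<Rightarrow> (real^'n \<Rightarrow> real^'n) \<Rightarrow> real^'n \<Rightarrow> real^'n" where
  "nabla v w x = frechet_derivative w (at x) (E x (v x)) + (1/2) *\<^sub>R br (v x) (w x)"

lemma E_nabla:
  assumes x: "x \<in> U" and w: "w differentiable (at x)"
  shows "frechet_derivative (\<lambda>x. E x (w x)) (at x) (E x (v x)) + \<Gamma> x (E x (v x)) (E x (w x)) = E x (nabla v w x)"
proof -
  have "frechet_derivative (\<lambda>x. E x (w x)) (at x) =
      (\<lambda>\<xi>. DE x (w x) \<xi> + E x (frechet_derivative w (at x) \<xi>))"
    using w by (intro frechet_derivative_at[symmetric] has_derivative_E[OF x])
      (simp add: frechet_derivative_works[symmetric])
  then show ?thesis by (simp add: \<Gamma>_eq[OF x] nabla_def x lin_simps)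
qed

text \<open>Torsion freeness. The bracket is kept as a difference of two \<open>nabla\<close>, valid
  for non-constant coefficients, to match the last term of the curvature.\<close>

lemma E_bracket:
  assumes x: "x \<in> U" and v: "v differentiable (at x)" and w: "w differentiable (at x)"
  shows "frechet_derivative (\<lambda>x. E x (w x)) (at x) (E x (v x)) - frechet_derivative (\<lambda>x. E x (v x)) (at x) (E x (w x))
    = E x (nabla v w x - nabla w v x)"
proof -
  have "frechet_derivative (\<lambda>x. E x (w x)) (at x) (E x (v x)) = E x (nabla v w x) - \<Gamma> x (E x (v x)) (E x (w x))"
    and "frechet_derivative (\<lambda>x. E x (v x)) (at x) (E x (w x)) = E x (nabla w v x) - \<Gamma> x (E x (v x)) (E x (w x))"
    using E_nabla[OF x w, of v] E_nabla[OF x v, of w] \<Gamma>_commute[of x "E x (w x)" "E x (v x)"]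
    by (simp_all add: eq_diff_eq)
  then show ?thesis by (simp add: lin_simps)
qed

lemma has_derivative_nabla:
  assumes x: "x \<in> U" and v: "smooth_on U v" and w: "smooth_on U w"
  shows "(nabla v w has_derivative (\<lambda>\<xi>. 
    frechet_derivative (\<lambda>x. frechet_derivative w (at x) \<xi>) (at x) (E x (v x))
    + frechet_derivative w (at x) (DE x (v x) \<xi> + E x (frechet_derivative v (at x) \<xi>))
    + (1/2) *\<^sub>R (br (v x) (frechet_derivative w (at x) \<xi>) + br (frechet_derivative v (at x) \<xi>) (w x)))) (at x)"
proof -
  have d: "(v has_derivative frechet_derivative v (at x)) (at x)" "(w has_derivative frechet_derivative w (at x)) (at x)"
    using smooth_on_differentiable[OF v x] smooth_on_differentiable[OF w x]
    by (simp_all add: frechet_derivative_works[symmetric])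
  show ?thesis
    unfolding nabla_def[abs_def]
    by (intro has_derivative_add has_derivative_frechet_derivative[OF open_U x w] has_derivative_E x d
        has_derivative_scaleR_right bounded_bilinear.FDERIV[OF bilinear_br])
qed

text \<open>All derivatives cancel: the second ones by symmetry, the first ones by torsion freeness.\<close>

theorem curvature_nabla:
  assumes x: "x \<in> U" and v: "smooth_on U v" and u: "smooth_on U u"
  shows "nabla v (nabla u u) x - nabla u (nabla v u) x - nabla (\<lambda>x. nabla v u x - nabla u v x) u x
    = (1/4) *\<^sub>R br (u x) (br (v x) (u x))"
proof -
  note d = frechet_derivative_at[OF has_derivative_nabla[OF x u u], symmetric]
    frechet_derivative_at[OF has_derivative_nabla[OF x v u], symmetric]
  have l: "linear (frechet_derivative u (at x))" "linear (frechet_derivative v (at x))"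
    by (intro linear_frechet_derivative smooth_on_differentiable[OF _ x] u v)+
  note l' = linear_add[OF l(1)] linear_diff[OF l(1)] linear_scale[OF l(1)]
  let ?u = "u x" and ?v = "v x" and ?U = "E x (u x)" and ?V = "E x (v x)"
  let ?du = "frechet_derivative u (at x)" and ?dv = "frechet_derivative v (at x)"
  have s: "frechet_derivative (\<lambda>x. frechet_derivative u (at x) ?V) (at x) ?U =
      frechet_derivative (\<lambda>x. frechet_derivative u (at x) ?U) (at x) ?V"
    by (rule frechet_derivative_symmetric_vec[OF open_U x u])
  \<comment> \<open>One fixed orientation for every bracket that occurs, so that antisymmetric
    partners cancel as linear terms.\<close>
  have b: "br (?du ?V) ?u = - br ?u (?du ?V)" "br (?dv ?U) ?u = - br ?u (?dv ?U)"
    "br (?du ?U) ?u = - br ?u (?du ?U)" "br (?du ?U) ?v = - br ?v (?du ?U)"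
    "br ?v ?u = - br ?u ?v" "br (br ?v ?u) ?u = - br ?u (br ?v ?u)" "br (br ?u ?v) ?u = - br ?u (br ?u ?v)"
    by (rule br_antisym)+
  show ?thesis
    unfolding nabla_def[of v "nabla u u"] nabla_def[of u "nabla v u"] nabla_def[of "\<lambda>x. nabla v u x - nabla u v x"] d
    by (simp add: nabla_def s bracket_DE[OF x, of ?u ?v] lin_simps br_simps l' br_self b)
      (simp add: algebra_simps scaleR_left_distrib[symmetric])
qed

lemma fund_eq:
  assumes x: "x \<in> U" "u \<noteq> 0"
  shows "fund x (E x u) (E x v) (E x w) = (norm u + \<kappa> \<bullet> u) / norm u * (v \<bullet> w - (u \<bullet> v) * (u \<bullet> w) / (norm u)\<^sup>2)
    + ((u \<bullet> v) / norm u + \<kappa> \<bullet> v) * ((u \<bullet> w) / norm u + \<kappa> \<bullet> w)"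
  using x by (simp add: fund_def rnorm_def rnorm'_def norm_B_eq inner_commute power2_norm_eq_inner)

text \<open>For \<open>y = x'\<close> it shows that the velocity has stationary frame coefficients
  exactly if \<open>x''\<close> equals \<open>DE x (co x x') x'\<close>. This is the geodesic
  equation, since \<open>\<Gamma> x x' x'\<close> is the negative of that vector.\<close>

lemma has_vector_derivative_co:
  assumes U: "x t \<in> U" and x: "(x has_vector_derivative x') (at t)" and y: "(y has_vector_derivative y') (at t)"
  shows "((\<lambda>s. co (x s) (y s)) has_vector_derivative co (x t) (y' - DE (x t) (co (x t) (y t)) x')) (at t)"
proof -
  have l: "linear (\<lambda>v. co (x t) (DE (x t) (co (x t) v) \<xi>))" for \<xi>
    using linear_compose[OF linear_compose[OF linear_co linear_DE'[OF U]] linear_co] by (simp add: o_def)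
  have "((\<lambda>s. co (x s) (axis k 1)) has_derivative
      (\<lambda>r. - co (x t) (DE (x t) (co (x t) (axis k 1)) (r *\<^sub>R x')))) (at t)" for k
    by (rule has_derivative_compose[OF x[unfolded has_vector_derivative_def] has_derivative_co_const[OF U]])
  from has_derivative_linear_family[OF open_UNIV UNIV_I linear_co this y[unfolded has_vector_derivative_def]]
  show ?thesis
    unfolding has_vector_derivative_def scaleR_minus_right sum_negf linear_axis_sum_vec[OF l]
    by (simp add: lin_simps linear_scale[OF linear_DE[OF U]] scaleR_diff_right)
qed

end

section \<open>Charts and tangent vectors\<close>

lemma is_chartD:
  assumes "is_chart c"
  shows "open (fst c)" "open (chart_image c)" "homeomorphism (fst c) (chart_image c) (snd c) (chart_inv c)"
    and "p \<in> fst c \<Longrightarrow> snd c p \<in> chart_image c" "p \<in> fst c \<Longrightarrow> chart_inv c (snd c p) = p"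
    and "x \<in> chart_image c \<Longrightarrow> chart_inv c x \<in> fst c" "x \<in> chart_image c \<Longrightarrow> snd c (chart_inv c x) = x"
  using assms unfolding is_chart_def homeomorphism_def by auto

lemma smooth_manifold_chart: "smooth_manifold A \<Longrightarrow> c \<in> A \<Longrightarrow> is_chart c"
  by (simp add: smooth_manifold_def)

lemma smooth_manifold_cover: "smooth_manifold A \<Longrightarrow> \<exists>c\<in>A. p \<in> fst c"
  unfolding smooth_manifold_def by blast

lemma transition_differentiable:
  assumes "smooth_manifold A" "c \<in> A" "d \<in> A" "p \<in> fst c" "p \<in> fst d"
  shows "(snd d \<circ> chart_inv c) differentiable (at (snd c p))"
proof (rule smooth_on_differentiable)
  show "smooth_on (snd c ` (fst c \<inter> fst d)) (snd d \<circ> chart_inv c)"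
    using assms by (simp add: smooth_manifold_def)
  show "snd c p \<in> snd c ` (fst c \<inter> fst d)" using assms by blast
qed

lemma coord_vec_component:
  assumes "smooth_manifold A" "v \<in> tangent_space A p" "c \<in> A" "p \<in> fst c"
  shows "coord_vec A c p (v c) = v"
proof
  fix d
  have "d \<in> A \<and> p \<in> fst d \<longrightarrow> frechet_derivative (snd d \<circ> chart_inv c) (at (snd c p)) (v c) = v d"
    and "\<not> (d \<in> A \<and> p \<in> fst d) \<longrightarrow> v d = 0"
    using assms(2-4) unfolding tangent_space_def mem_Collect_eq by metis+
  then show "coord_vec A c p (v c) d = v d"
    by (simp add: coord_vec_def)
qed

lemma tangent_space_outside: "v \<in> tangent_space A p \<Longrightarrow> \<not> (c \<in> A \<and> p \<in> fst c) \<Longrightarrow> v c = 0"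
  unfolding tangent_space_def by blast

lemma tangent_space_eqI:
  assumes "smooth_manifold A" "v \<in> tangent_space A p" "w \<in> tangent_space A p" "c \<in> A" "p \<in> fst c" "v c = w c"
  shows "v = w"
proof -
  have "v = coord_vec A c p (v c)" by (rule coord_vec_component[OF assms(1,2,4,5), symmetric])
  also have "\<dots> = coord_vec A c p (w c)" by (simp only: assms(6))
  also have "\<dots> = w" by (rule coord_vec_component[OF assms(1,3-5)])
  finally show ?thesis .
qed

section \<open>Lie groups with a bi-invariant metric\<close>

locale lie_group_frame = ad_invariant br \<kappa>
  for br :: "real^'n::finite \<Rightarrow> real^'n \<Rightarrow> real^'n" and \<kappa> :: "real^'n" +
  fixes A :: "('a::{t2_space,second_countable_topology}, 'n) chart set"
    and mul :: "'a \<Rightarrow> 'a \<Rightarrow> 'a" and e :: 'a and ginv :: "'a \<Rightarrow> 'a"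
    and E :: "real^'n \<Rightarrow> ('a, 'n) vfield"
    and g :: "'a \<Rightarrow> ('a, 'n) tvec \<Rightarrow> ('a, 'n) tvec \<Rightarrow> real"
  assumes lie_group: "lie_group A mul e ginv"
    and linear_E: "linear E"
    and E_lie_algebra: "E u \<in> lie_algebra A mul"
    and E_bracket: "lie_bracket A (E u) (E v) = E (br u v)"
    and g_left_invariant: "left_invariant_metric A mul e ginv g"
    and g_riemannian: "riemannian_metric A g"
    and g_E_unit: "g e (E u e) (E v e) = u \<bullet> v"
begin

definition F :: "'a \<Rightarrow> ('a, 'n) tvec \<Rightarrow> real" where
  "F = randers g (E \<kappa>)"

lemma manifold: "smooth_manifold A"
  using lie_group by (simp add: lie_group_def)

sublocale group mul e ginv
  using lie_group by (simp add: lie_group_def)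

lemmas chart = is_chartD[OF smooth_manifold_chart[OF manifold]]

lemma obtain_chart: obtains c where "c \<in> A" "p \<in> fst c"
  using smooth_manifold_cover[OF manifold] by blast

lemma E_smooth: "smooth_vfield A (E u)"
  using E_lie_algebra by (simp add: lie_algebra_def)

lemma E_tangent: "E u p \<in> tangent_space A p"
  using E_smooth by (simp add: smooth_vfield_def)

lemma E_mul: "E u (mul a p) = tangent_map A (mul a) p (E u p)"
  using E_lie_algebra by (simp add: lie_algebra_def)

text \<open>Translation by \<open>ginv p\<close> carries \<open>p\<close> to the unit, where the
  frame is orthonormal; the fields and the metric are both invariant under it.\<close>

lemma g_E: "g p (E u p) (E v p) = u \<bullet> v"
proof -
  have "g p (E u p) (E v p) = g e (E u (mul (ginv p) p)) (E v (mul (ginv p) p))"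
    using g_left_invariant E_tangent unfolding left_invariant_metric_def E_mul by blast
  then show ?thesis by (simp add: g_E_unit)
qed

lemmas E_simps = linear_add[OF linear_E] linear_diff[OF linear_E] linear_scale[OF linear_E] linear_0[OF linear_E]

lemma linear_E_chart: "linear (\<lambda>u. E u p c)"
  by (rule linearI) (simp_all add: E_simps)

text \<open>A combination with zero components in one chart is the zero tangent vector, hence has
  length 0, and \<open>g_E\<close> forces its coefficients to vanish.\<close>

lemma inj_E_chart:
  assumes "c \<in> A" "p \<in> fst c"
  shows "inj (\<lambda>u. E u p c)"
proof (rule injI)
  fix u v assume "E u p c = E v p c"
  then have "E (u - v) p c = E 0 p c" by (simp add: E_simps)
  from tangent_space_eqI[OF manifold E_tangent E_tangent assms this]
  have "g p (E (u - v) p) (E (u - v) p) = g p (E 0 p) (E 0 p)" by (simp only:)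
  then have "(u - v) \<bullet> (u - v) = 0" unfolding g_E by simp
  then show "u = v" by simp
qed

lemma surj_E_chart: "c \<in> A \<Longrightarrow> p \<in> fst c \<Longrightarrow> surj (\<lambda>u. E u p c)"
  by (rule linear_inj_imp_surj[OF linear_E_chart inj_E_chart])

text \<open>The dual frame. The value 0 outside the chart image keeps it linear at every
  \<open>x\<close>, as \<open>frame_chart\<close> demands.\<close>

definition co :: "('a, 'n) chart \<Rightarrow> real^'n \<Rightarrow> real^'n \<Rightarrow> real^'n" where
  "co c x y = (if x \<in> chart_image c then inv (\<lambda>u. E u (chart_inv c x) c) y else 0)"

lemma co_E: "c \<in> A \<Longrightarrow> x \<in> chart_image c \<Longrightarrow> co c x (E u (chart_inv c x) c) = u"
  by (simp add: co_def inv_f_f[OF inj_E_chart] chart)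

lemma E_co: "c \<in> A \<Longrightarrow> x \<in> chart_image c \<Longrightarrow> E (co c x y) (chart_inv c x) c = y"
  using surj_f_inv_f[OF surj_E_chart[of c "chart_inv c x"], of y] by (simp add: co_def chart)

lemma linear_co:
  assumes "c \<in> A" shows "linear (co c x)"
proof (cases "x \<in> chart_image c")
  case True
  note l = linear_add[OF linear_E_chart] linear_scale[OF linear_E_chart]
  show ?thesis
  proof (rule linearI)
    show "co c x (a + b) = co c x a + co c x b" for a b
      using co_E[OF assms True, of "co c x a + co c x b"] by (simp only: l E_co[OF assms True])
    show "co c x (r *\<^sub>R a) = r *\<^sub>R co c x a" for r a
      using co_E[OF assms True, of "r *\<^sub>R co c x a"] by (simp only: l E_co[OF assms True])
  qed
next
  case False
  then show ?thesis by (simp add: co_def linear_iff)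
qed

lemma tangent_space_E:
  assumes "v \<in> tangent_space A p" obtains u where "v = E u p"
proof -
  obtain c where c: "c \<in> A" "p \<in> fst c" by (rule obtain_chart)
  obtain u where "v c = E u p c" using surj_E_chart[OF c] unfolding surj_def by blast
  then show ?thesis
    using tangent_space_eqI[OF manifold assms E_tangent c] that by blast
qed

lemma coord_vec_E: "c \<in> A \<Longrightarrow> p \<in> fst c \<Longrightarrow> coord_vec A c p (E u p c) = E u p"
  by (rule coord_vec_component[OF manifold E_tangent])

lemma coord_vec_co:
  assumes "c \<in> A" "x \<in> chart_image c"
  shows "coord_vec A c (chart_inv c x) y = E (co c x y) (chart_inv c x)"
  using coord_vec_E[OF assms(1), of "chart_inv c x" "co c x y"] assms by (simp add: E_co chart)

lemma smooth_E_chart: "c \<in> A \<Longrightarrow> smooth_on (chart_image c) (\<lambda>x. E u (chart_inv c x) c)"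
  using E_smooth by (simp add: smooth_vfield_def)

text \<open>By orthonormality the i-th coefficient of \<open>y\<close> is its
  \<open>g\<close>-product with the i-th frame field. Expanded in the coordinate basis, this is a
  polynomial in the smooth metric coefficients and the smooth components of the frame.\<close>

lemma smooth_co:
  assumes c: "c \<in> A"
  shows "smooth_on (chart_image c) (\<lambda>x. co c x y)"
proof -
  let ?U = "chart_image c"
  note o = chart(2)[OF c]
  have G: "smooth_on ?U (\<lambda>x. co c x (axis k 1) \<bullet> co c x (axis l 1))" for k l
  proof (rule smooth_on_cong[OF o])
    show "smooth_on ?U (\<lambda>x. g (chart_inv c x) (coord_vec A c (chart_inv c x) (axis k 1))
        (coord_vec A c (chart_inv c x) (axis l 1)))"
      using g_riemannian c by (simp add: riemannian_metric_def)
  qed (simp add: coord_vec_co[OF c] g_E)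
  have l: "linear (\<lambda>z. z \<bullet> w)" for w :: "real^'n" by (simp add: linear_iff inner_add_left)
  have *: "co c x y \<bullet> co c x z = (\<Sum>k\<in>UNIV. y $ k * (\<Sum>l\<in>UNIV. z $ l * (co c x (axis k 1) \<bullet> co c x (axis l 1))))" for x z
  proof -
    have l1: "linear (\<lambda>v. co c x v \<bullet> w)" for w
      using linear_compose[OF linear_co[OF c] l] by (simp add: o_def)
    then have l2: "linear (\<lambda>v. w \<bullet> co c x v)" for w
      by (simp add: inner_commute)
    show ?thesis by (simp only: linear_axis_sum[OF l1] linear_axis_sum[OF l2])
  qed
  have "smooth_on ?U (\<lambda>x. \<Sum>i\<in>UNIV. (\<Sum>k\<in>UNIV. y $ k * (\<Sum>l\<in>UNIV. E (axis i 1) (chart_inv c x) c $ l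
      * (co c x (axis k 1) \<bullet> co c x (axis l 1)))) *\<^sub>R axis i 1 :: real^'n)"
    by (intro smooth_on_sum smooth_on_scaleR smooth_on_mult smooth_on_const o G smooth_on_nth smooth_E_chart c)
  then show ?thesis
  proof (rule smooth_on_cong[OF o, rotated])
    fix x assume "x \<in> ?U"
    then have "(\<Sum>i\<in>UNIV. (co c x y \<bullet> co c x (E (axis i 1) (chart_inv c x) c)) *\<^sub>R axis i 1) = co c x y"
      using basis_expansion[of "co c x y"] by (simp add: co_E[OF c] inner_axis scalar_mult_eq_scaleR)
    then show "(\<Sum>i\<in>UNIV. (\<Sum>k\<in>UNIV. y $ k * (\<Sum>l\<in>UNIV. E (axis i 1) (chart_inv c x) c $ l
      * (co c x (axis k 1) \<bullet> co c x (axis l 1)))) *\<^sub>R axis i 1) = co c x y"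
      by (simp only: *)
  qed
qed

section \<open>The left invariant Randers metric is Finsler and of Berwald type\<close>

lemma F_E: "F p (E u p) = norm u + \<kappa> \<bullet> u"
  by (simp add: F_def randers_def g_E norm_eq_sqrt_inner)

lemma local_rep_F:
  "c \<in> A \<Longrightarrow> x \<in> chart_image c \<Longrightarrow> local_rep A F c x y = norm (co c x y) + \<kappa> \<bullet> co c x y"
  by (simp add: local_rep_def coord_vec_co F_E)

lemma frame_chart:
  assumes c: "c \<in> A"
  shows "frame_chart br \<kappa> (chart_image c) (\<lambda>x u. E u (chart_inv c x) c) (co c) (local_rep A F c)"
proof (intro frame_chart.intro frame_chart_axioms.intro ad_invariant_axioms)
  fix x u v assume x: "x \<in> chart_image c"
  then show "frechet_derivative (\<lambda>x. E v (chart_inv c x) c) (at x) (E u (chart_inv c x) c)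
     - frechet_derivative (\<lambda>x. E u (chart_inv c x) c) (at x) (E v (chart_inv c x) c)
     = E (br u v) (chart_inv c x) c"
    using c by (simp add: E_bracket[symmetric] lie_bracket_def chart)
qed (simp_all add: c chart linear_E_chart linear_co smooth_E_chart smooth_co co_E E_co local_rep_F)

lemma F_finsler: "finsler_metric A F"
  unfolding finsler_metric_def
proof (intro conjI allI ballI impI)
  fix p y assume "y \<in> tangent_space A p"
  then obtain u where y: "y = E u p" by (rule tangent_space_E)
  have "\<bar>\<kappa> \<bullet> u\<bar> \<le> norm u"
    using Cauchy_Schwarz_ineq2[of \<kappa> u] mult_right_mono[of "norm \<kappa>" 1 "norm u"] norm_\<kappa> by simp
  then show "F p y \<ge> 0" by (simp add: y F_E)
  fix r :: real assume "r > 0"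
  then show "F p (r *\<^sub>R y) = r * F p y"
    using F_E[of p "r *\<^sub>R u"] by (simp add: y F_E E_simps algebra_simps)
next
  fix c assume c: "c \<in> A"
  interpret frame_chart br \<kappa> "chart_image c" "\<lambda>x u. E u (chart_inv c x) c" "co c" "local_rep A F c"
    by (rule frame_chart[OF c])
  show "smooth_on (chart_image c \<times> - {0}) (\<lambda>(x, y). local_rep A F c x y)"
    using open_Z by (rule smooth_on_cong[OF _ _ smooth_rnorm])
      (auto simp: rnorm_def norm_B_eq local_rep_F[OF c])
  fix x y v :: "real^'n"
  assume "x \<in> chart_image c" "y \<noteq> 0" "v \<noteq> 0"
  then show "v \<bullet> (fund_matrix (local_rep A F c) x y *v v) > 0"
    by (simp add: inner_fund_matrix fund_pos)
qed

theorem F_berwald: "berwald_type A F"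
  unfolding berwald_type_def
proof (intro conjI F_finsler ballI allI impI)
  fix c and x y y' :: "real^'n" and i j k
  assume c: "c \<in> A" and x: "x \<in> chart_image c" and y: "y \<noteq> 0 \<and> y' \<noteq> 0"
  interpret frame_chart br \<kappa> "chart_image c" "\<lambda>x u. E u (chart_inv c x) c" "co c" "local_rep A F c"
    by (rule frame_chart[OF c])
  show "chern (local_rep A F c) x y i j k = chern (local_rep A F c) x y' i j k"
    using x y by (simp add: chern_eq_\<Gamma>)
qed

text \<open>The coefficients of \<open>W\<close> are prescribed only on an open set
  \<open>S\<close>, because \<open>W\<close> may itself be a covariant derivative, whose form is
  known only where the reference field \<open>U\<close> is nonzero.\<close>

lemma cov_deriv_eq:
  assumes c: "c \<in> A" and S: "open S" "S \<subseteq> chart_image c" "x \<in> S"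
    and W: "\<And>x. x \<in> S \<Longrightarrow> W (chart_inv c x) c = E (w x) (chart_inv c x) c"
    and w: "w differentiable (at x)"
    and V: "V (chart_inv c x) c = E (v x) (chart_inv c x) c"
    and U: "U (chart_inv c x) c \<noteq> 0"
  shows "cov_deriv A F U V W (chart_inv c x) c =
    E (frame_chart.nabla br (\<lambda>x u. E u (chart_inv c x) c) v w x) (chart_inv c x) c"
proof -
  interpret frame_chart br \<kappa> "chart_image c" "\<lambda>x u. E u (chart_inv c x) c" "co c" "local_rep A F c"
    by (rule frame_chart[OF c])
  have x: "x \<in> chart_image c" using S by blast
  have "(\<lambda>x. E (w x) (chart_inv c x) c) differentiable (at x)"
    using has_derivative_E[OF x] w unfolding differentiable_def by blast
  then have d: "frechet_derivative (\<lambda>x. W (chart_inv c x) c) (at x) =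
      frechet_derivative (\<lambda>x. E (w x) (chart_inv c x) c) (at x)"
    by (rule frechet_derivative_transform_within_open[OF _ S(1,3), symmetric]) (simp add: W)
  show ?thesis
    using c x d W[OF S(3)] V U
    by (simp add: cov_deriv_def chart E_nabla[OF x w, symmetric] sum_chern)
qed

theorem curvature_eq:
  assumes U: "smooth_vfield A U" and V: "smooth_vfield A V"
    and a: "U p = E a p" "a \<noteq> 0" and b: "V p = E b p"
  shows "curvature A F V U p = E ((1/4) *\<^sub>R br a (br b a)) p"
proof
  fix c :: "('a, 'n) chart"
  show "curvature A F V U p c = E ((1/4) *\<^sub>R br a (br b a)) p c"
  proof (cases "c \<in> A \<and> p \<in> fst c")
    case False
    then show ?thesis
      using tangent_space_outside[OF E_tangent] by (auto simp: curvature_def cov_deriv_def)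
  next
    case True
    then have c: "c \<in> A" and p: "p \<in> fst c" by auto
    interpret frame_chart br \<kappa> "chart_image c" "\<lambda>x u. E u (chart_inv c x) c" "co c" "local_rep A F c"
      by (rule frame_chart[OF c])
    define x where "x = snd c p"
    have x: "x \<in> chart_image c" "chart_inv c x = p" using c p by (simp_all add: x_def chart)
    define u where "u x = co c x (U (chart_inv c x) c)" for x
    define v where "v x = co c x (V (chart_inv c x) c)" for x
    have sm: "smooth_on (chart_image c) u" "smooth_on (chart_image c) v"
      unfolding u_def[abs_def] v_def[abs_def] using U V c by (auto intro!: smooth_co_vec simp: smooth_vfield_def)
    have ux: "u x = a" "v x = b"
      using co_E[OF x(1), of a] co_E[OF x(1), of b] by (simp_all add: u_def v_def x(2) a b)
    \<comment> \<open>\<open>U\<close> is nonzero at \<open>p\<close> but may vanish elsewhere in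
      the chart. On this open set the inner covariant derivatives are explicit, so that they can be
      differentiated once more at \<open>x\<close>.\<close>
    define N where "N = {x \<in> chart_image c. U (chart_inv c x) c \<noteq> 0}"
    have "continuous_on (chart_image c) (\<lambda>x. U (chart_inv c x) c)"
      using U c by (auto intro!: smooth_on_continuous simp: smooth_vfield_def)
    from continuous_open_preimage[OF this open_U open_Compl[OF closed_singleton[of 0]]]
    have N: "open N" "N \<subseteq> chart_image c"
      by (auto simp: N_def vimage_def Int_def)
    have "E a p c \<noteq> 0"
      using injD[OF inj_E_chart[OF c p], of a 0] a(2) by (auto simp: E_simps)
    then have xN: "x \<in> N" by (simp add: N_def x a)
    have Ueq: "U (chart_inv c x) c = E (u x) (chart_inv c x) c"
      and Veq: "V (chart_inv c x) c = E (v x) (chart_inv c x) c" if "x \<in> N" for x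
      using that N(2) by (auto simp: u_def v_def)
    have d: "u differentiable (at x)" "v differentiable (at x)" if "x \<in> N" for x
      using that N(2) smooth_on_differentiable sm by blast+
    have dn: "nabla u u differentiable (at x)" "nabla v u differentiable (at x)"
      using has_derivative_nabla[OF x(1) sm(1) sm(1)] has_derivative_nabla[OF x(1) sm(2) sm(1)]
      unfolding differentiable_def by blast+
    have UU: "cov_deriv A F U U U (chart_inv c x) c = E (nabla u u x) (chart_inv c x) c" if "x \<in> N" for x
      by (rule cov_deriv_eq[where w = u and v = u and W = U and V = U and U = U and c = c,
            OF c N that Ueq d(1)[OF that] Ueq[OF that]]) (use that in \<open>auto simp: N_def\<close>)
    have VU: "cov_deriv A F U V U (chart_inv c x) c = E (nabla v u x) (chart_inv c x) c" if "x \<in> N" for x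
      by (rule cov_deriv_eq[where w = u and v = v and W = U and V = V and U = U and c = c,
            OF c N that Ueq d(1)[OF that] Veq[OF that]]) (use that in \<open>auto simp: N_def\<close>)
    have U0: "U (chart_inv c x) c \<noteq> 0" using xN by (simp add: N_def)
    have fd: "frechet_derivative (\<lambda>x. U (chart_inv c x) c) (at x) = frechet_derivative (\<lambda>x. E (u x) (chart_inv c x) c) (at x)"
      "frechet_derivative (\<lambda>x. V (chart_inv c x) c) (at x) = frechet_derivative (\<lambda>x. E (v x) (chart_inv c x) c) (at x)"
    proof -
      have *: "(\<lambda>x. E (u x) (chart_inv c x) c) differentiable (at x)" "(\<lambda>x. E (v x) (chart_inv c x) c) differentiable (at x)"
        using has_derivative_E[OF x(1)] d[OF xN] unfolding differentiable_def by blast+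
      show "frechet_derivative (\<lambda>x. U (chart_inv c x) c) (at x) = frechet_derivative (\<lambda>x. E (u x) (chart_inv c x) c) (at x)"
        by (rule frechet_derivative_transform_within_open[OF *(1) N(1) xN, symmetric]) (rule Ueq[symmetric])
      show "frechet_derivative (\<lambda>x. V (chart_inv c x) c) (at x) = frechet_derivative (\<lambda>x. E (v x) (chart_inv c x) c) (at x)"
        by (rule frechet_derivative_transform_within_open[OF *(2) N(1) xN, symmetric]) (rule Veq[symmetric])
    qed
    have "lie_bracket A V U (chart_inv c x) c = E (nabla v u x - nabla u v x) (chart_inv c x) c"
      using E_bracket[OF x(1) d(2)[OF xN] d(1)[OF xN]] c p
      by (simp add: lie_bracket_def x_def[symmetric] x(2) fd Ueq[OF xN, unfolded x(2)] Veq[OF xN, unfolded x(2)])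
    note VUc = this
    have VUU: "cov_deriv A F U (lie_bracket A V U) U (chart_inv c x) c =
        E (nabla (\<lambda>x. nabla v u x - nabla u v x) u x) (chart_inv c x) c"
      by (rule cov_deriv_eq[where w = u and v = "\<lambda>x. nabla v u x - nabla u v x" and W = U
            and V = "lie_bracket A V U" and U = U and c = c, OF c N xN Ueq d(1)[OF xN] VUc U0])
    have VUU': "cov_deriv A F U V (cov_deriv A F U U U) (chart_inv c x) c = E (nabla v (nabla u u) x) (chart_inv c x) c"
      by (rule cov_deriv_eq[where w = "nabla u u" and v = v and W = "cov_deriv A F U U U"
            and V = V and U = U and c = c, OF c N xN UU dn(1) Veq[OF xN] U0])
    have UVU: "cov_deriv A F U U (cov_deriv A F U V U) (chart_inv c x) c = E (nabla u (nabla v u) x) (chart_inv c x) c"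
      by (rule cov_deriv_eq[where w = "nabla v u" and v = u and W = "cov_deriv A F U V U"
            and V = U and U = U and c = c, OF c N xN VU dn(2) Ueq[OF xN] U0])
    have "curvature A F V U (chart_inv c x) c = E (nabla v (nabla u u) x - nabla u (nabla v u) x
        - nabla (\<lambda>x. nabla v u x - nabla u v x) u x) (chart_inv c x) c"
      by (simp add: curvature_def linear_diff[OF linear_E_chart] VUU VUU' UVU)
    then show ?thesis
      unfolding curvature_nabla[OF x(1) sm(2,1)] x(2) ux .
  qed
qed

section \<open>Flag curvature in frame coefficients\<close>

lemma E_inj: "E a p = E b p \<Longrightarrow> a = b"
  using obtain_chart[of p] inj_E_chart by (metis injD)

lemma norm_add_\<kappa>_pos: "a \<noteq> 0 \<Longrightarrow> norm a + \<kappa> \<bullet> a > 0"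
  using \<kappa>_bound[of a] by linarith

lemma fund_tensor_E:
  assumes "a \<noteq> 0"
  shows "fund_tensor F p (E a p) (E b p) (E d p) =
    (norm a + \<kappa> \<bullet> a) / norm a * (b \<bullet> d - (a \<bullet> b) * (a \<bullet> d) / (norm a)\<^sup>2)
    + ((a \<bullet> b) / norm a + \<kappa> \<bullet> b) * ((a \<bullet> d) / norm a + \<kappa> \<bullet> d)"
proof -
  obtain c where c: "c \<in> A" and p: "p \<in> fst c" by (rule obtain_chart)
  interpret frame_chart br \<kappa> "chart_image c" "\<lambda>x u. E u (chart_inv c x) c" "co c" "local_rep A F c"
    by (rule frame_chart[OF c])
  define x where "x = snd c p"
  have x: "x \<in> chart_image c" "chart_inv c x = p" using c p by (simp_all add: x_def chart)
  have "F p (E a p + s *\<^sub>R E b p + t *\<^sub>R E d p) = local_rep A F c x (E a p c + s *\<^sub>R E b p c + t *\<^sub>R E d p c)" for s t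
  proof -
    have "E a p + s *\<^sub>R E b p + t *\<^sub>R E d p = E (a + s *\<^sub>R b + t *\<^sub>R d) p"
      by (simp add: E_simps)
    moreover have "E a p c + s *\<^sub>R E b p c + t *\<^sub>R E d p c = E (a + s *\<^sub>R b + t *\<^sub>R d) p c"
      by (simp add: E_simps)
    ultimately show ?thesis
      by (simp only: local_rep_def x(2) coord_vec_E[OF c p])
  qed
  moreover have "E a p c \<noteq> 0"
    using co_E[OF x(1), of a] assms by (auto simp: x(2) lin_simps)
  ultimately show ?thesis
    using fund_eq_deriv[OF x(1), of "E a p c" "E b p c" "E d p c"] fund_eq[OF x(1) assms, of b d]
    by (simp add: fund_tensor_def x(2))
qed

text \<open>The sectional curvature of the bi-invariant metric, a quarter of the squared bracket
  over the Gram determinant, times the squared ratio of Riemannian to Randers norm of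
  \<open>a\<close>. The Gram determinant makes it meaningful for any basis of the flag.\<close>

definition flagK :: "real^'n \<Rightarrow> real^'n \<Rightarrow> real" where
  "flagK a b = (norm a)\<^sup>2 * (norm (br a b))\<^sup>2 /
    (4 * (norm a + \<kappa> \<bullet> a)\<^sup>2 * ((norm a)\<^sup>2 * (norm b)\<^sup>2 - (a \<bullet> b)\<^sup>2))"

lemma flagK_nonneg: "flagK a b \<ge> 0"
  using Cauchy_Schwarz_ineq[of a b]
  by (simp add: flagK_def power2_norm_eq_inner)

lemma flag_quotient:
  assumes U: "smooth_vfield A U" and V: "smooth_vfield A V"
    and a: "U p = E a p" "a \<noteq> 0" and b: "V p = E b p"
  shows "fund_tensor F p (U p) (curvature A F V U p) (V p) /
         (fund_tensor F p (U p) (U p) (U p) * fund_tensor F p (U p) (V p) (V p)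
          - (fund_tensor F p (U p) (U p) (V p))\<^sup>2) = flagK a b"
proof -
  define N where "N = norm a"
  define \<nu> where "\<nu> = N + \<kappa> \<bullet> a"
  define X where "X = (norm (br a b))\<^sup>2"
  define h where "h = (a \<bullet> b) / N + \<kappa> \<bullet> b"
  define D where "D = N\<^sup>2 * (norm b)\<^sup>2 - (a \<bullet> b)\<^sup>2"
  have N: "N > 0" "a \<bullet> a = N\<^sup>2" and \<nu>: "\<nu> > 0"
    using a(2) norm_add_\<kappa>_pos by (simp_all add: N_def \<nu>_def power2_norm_eq_inner)
  \<comment> \<open>The curvature vector is orthogonal to \<open>a\<close> and to
    \<open>\<kappa>\<close>, so only the Euclidean product with \<open>b\<close> survives in the
    numerator; skewness turns it into the squared bracket.\<close>
  have R: "a \<bullet> br a (br b a) = 0" "br a (br b a) \<bullet> b = X" "\<kappa> \<bullet> br a (br b a) = 0"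
    using br_inner_self(1)[of a "br b a"] br_inv[of a "br b a" b] br_antisym[of b a]
    by (simp_all add: inner_commute \<kappa>_br X_def power2_norm_eq_inner)
  have "fund_tensor F p (U p) (curvature A F V U p) (V p) = \<nu> / N * (X / 4)"
    unfolding curvature_eq[OF assms] a(1) b fund_tensor_E[OF a(2)] by (simp add: R \<nu>_def N_def)
  moreover have "fund_tensor F p (U p) (U p) (U p) = \<nu>\<^sup>2"
    unfolding a(1) fund_tensor_E[OF a(2)] using N
    by (simp add: \<nu>_def[symmetric] N_def[symmetric] power2_eq_square)
  moreover have "fund_tensor F p (U p) (U p) (V p) = \<nu> * h"
    unfolding a(1) b fund_tensor_E[OF a(2)] using N
    by (simp add: \<nu>_def[symmetric] N_def[symmetric] h_def power2_eq_square)
  moreover have "fund_tensor F p (U p) (V p) (V p) = \<nu> / N * (D / N\<^sup>2) + h\<^sup>2"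
    unfolding a(1) b fund_tensor_E[OF a(2)] using N(1)
    by (simp add: \<nu>_def[symmetric] N_def[symmetric] h_def D_def power2_norm_eq_inner)
      (simp add: field_simps power2_eq_square)
  \<comment> \<open>The square of the mixed term cancels the \<open>h\<close> contribution, leaving
    a multiple of the Euclidean Gram determinant.\<close>
  moreover have "\<nu> / N * (X / 4) / (\<nu>\<^sup>2 * (\<nu> / N * (D / N\<^sup>2) + h\<^sup>2) - (\<nu> * h)\<^sup>2) = N\<^sup>2 * X / (4 * \<nu>\<^sup>2 * D)"
  proof -
    have "\<nu>\<^sup>2 * (\<nu> / N * (D / N\<^sup>2) + h\<^sup>2) - (\<nu> * h)\<^sup>2 = \<nu>\<^sup>2 * (\<nu> / N * (D / N\<^sup>2))"
      by (simp add: algebra_simps)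
    then show ?thesis using N(1) \<nu> by (simp add: divide_simps)
  qed
  ultimately show ?thesis
    by (simp add: flagK_def X_def[symmetric] N_def[symmetric] D_def[symmetric] \<nu>_def[symmetric])
qed

text \<open>Every admissible second vector is \<open>s a + t b\<close> with
  \<open>t \<noteq> 0\<close>; bracket square and Gram determinant both scale by \<open>t^2\<close>,
  so the quotient is the same. The pair \<open>E a\<close>, \<open>E b\<close> is itself admissible,
  which pins down the value.\<close>

theorem flag_curvature_E:
  assumes a: "a \<noteq> 0" and b: "\<And>r. b \<noteq> r *\<^sub>R a"
  shows "flag_curvature A F p (span {E a p, E b p}) (E a p) = flagK a b"
  unfolding flag_curvature_def
proof (rule the_equality)
  show "\<forall>U V. smooth_vfield A U \<and> smooth_vfield A V \<and> U p = E a p \<and> span {E a p, E b p} = span {U p, V p} \<longrightarrow>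
     flagK a b = fund_tensor F p (U p) (curvature A F V U p) (V p) /
         (fund_tensor F p (U p) (U p) (U p) * fund_tensor F p (U p) (V p) (V p)
          - (fund_tensor F p (U p) (U p) (V p))\<^sup>2)"
  proof (intro allI impI, elim conjE)
    fix U V assume U: "smooth_vfield A U" and V: "smooth_vfield A V" and Up: "U p = E a p"
      and P: "span {E a p, E b p} = span {U p, V p}"
    have "V p \<in> tangent_space A p" using V by (simp add: smooth_vfield_def)
    then obtain b' where b': "V p = E b' p" by (rule tangent_space_E)
    have sp: "E z p \<in> span {E a p, E w p} \<Longrightarrow> \<exists>s t. z = s *\<^sub>R a + t *\<^sub>R w" for z w
    proof -
      assume "E z p \<in> span {E a p, E w p}"
      then obtain s t where "E z p - s *\<^sub>R E a p = t *\<^sub>R E w p"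
        by (auto simp: span_insert[of "E a p"] span_singleton)
      then have "E z p = E (s *\<^sub>R a + t *\<^sub>R w) p"
        by (simp add: E_simps algebra_simps)
      then show ?thesis using E_inj by blast
    qed
    have "E b' p \<in> span {E a p, E b p}" unfolding P b' by (rule span_base) simp
    then obtain s t where st: "b' = s *\<^sub>R a + t *\<^sub>R b" using sp by blast
    have "E b p \<in> span {E a p, E b' p}" using P unfolding Up b' by (metis insertCI span_base)
    then obtain s' t' where "b = s' *\<^sub>R a + t' *\<^sub>R b'" using sp by blast
    \<comment> \<open>Otherwise \<open>b\<close>, lying in the span of \<open>a\<close> and
      \<open>b'\<close>, would be a multiple of \<open>a\<close>.\<close>
    have "t \<noteq> 0"
    proof
      assume "t = 0"
      then have "b = (s' + t' * s) *\<^sub>R a"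
        using \<open>b = s' *\<^sub>R a + t' *\<^sub>R b'\<close> st by (simp add: algebra_simps)
      with b show False by blast
    qed
    have "br a b' = t *\<^sub>R br a b"
      by (simp add: st br_simps br_self)
    moreover have "(norm a)\<^sup>2 * (norm b')\<^sup>2 - (a \<bullet> b')\<^sup>2 = t\<^sup>2 * ((norm a)\<^sup>2 * (norm b)\<^sup>2 - (a \<bullet> b)\<^sup>2)"
      unfolding power2_norm_eq_inner st
      by (simp add: inner_add_left inner_add_right inner_commute[of b a] power2_eq_square algebra_simps)
    ultimately have "flagK a b' = flagK a b"
      using \<open>t \<noteq> 0\<close> by (simp add: flagK_def power_mult_distrib)
    then show "flagK a b = fund_tensor F p (U p) (curvature A F V U p) (V p) /
         (fund_tensor F p (U p) (U p) (U p) * fund_tensor F p (U p) (V p) (V p)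
          - (fund_tensor F p (U p) (U p) (V p))\<^sup>2)"
      by (simp only: flag_quotient[OF U V Up a b'])
  qed
  fix K
  assume "\<forall>U V. smooth_vfield A U \<and> smooth_vfield A V \<and> U p = E a p \<and> span {E a p, E b p} = span {U p, V p} \<longrightarrow>
     K = fund_tensor F p (U p) (curvature A F V U p) (V p) /
         (fund_tensor F p (U p) (U p) (U p) * fund_tensor F p (U p) (V p) (V p)
          - (fund_tensor F p (U p) (U p) (V p))\<^sup>2)"
  from this[rule_format, of "E a" "E b"] show "K = flagK a b"
    unfolding flag_quotient[OF E_smooth E_smooth refl a refl] using E_smooth by blast
qed

theorem F_nonneg_flag_curvature: "nonneg_flag_curvature A F"
  unfolding nonneg_flag_curvature_def
proof (intro allI ballI impI)
  fix p u v assume u: "u \<in> tangent_space A p" and v: "v \<in> tangent_space A p" and ind: "u \<noteq> v \<and> independent {u, v}"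
  obtain a where a: "u = E a p" using tangent_space_E[OF u] by blast
  obtain b where b: "v = E b p" using tangent_space_E[OF v] by blast
  have "a \<noteq> 0" using ind dependent_zero[of "{u, v}"] by (auto simp: a E_simps)
  moreover have "b \<noteq> r *\<^sub>R a" for r
  proof
    assume "b = r *\<^sub>R a"
    then have "v = r *\<^sub>R u" by (simp add: a b E_simps)
    then have "v \<in> span {u}" by (simp add: span_base span_scale)
    with ind show False by (metis independent_insert insert_commute singletonD)
  qed
  ultimately show "flag_curvature A F p (span {u, v}) u \<ge> 0"
    by (simp add: a b flag_curvature_E flagK_nonneg)
qed

end

section \<open>Integral curves and geodesics\<close>

text \<open>The squared length of \<open>w\<close> times an exponential is monotone: nondecreasing
  with rate \<open>2 * K\<close>, nonincreasing with rate \<open>- 2 * K\<close>. The former handles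
  \<open>s\<close> before \<open>t\<close>, the latter \<open>s\<close> after \<open>t\<close>,
  since the product vanishes at \<open>t\<close>.\<close>

lemma gronwall_zero:
  fixes w :: "real \<Rightarrow> 'b::real_inner"
  assumes d: "\<And>s. a < s \<Longrightarrow> s < b \<Longrightarrow> (w has_vector_derivative w' s) (at s)"
    and K: "\<And>s. a < s \<Longrightarrow> s < b \<Longrightarrow> norm (w' s) \<le> K * norm (w s)"
    and t: "a < t" "t < b" "w t = 0" and s: "a < s" "s < b"
  shows "w s = 0"
proof -
  define \<phi> where "\<phi> c s = (w s \<bullet> w s) * exp (c * s)" for c s
  have d\<phi>: "DERIV (\<phi> c) s :> (2 * (w s \<bullet> w' s) + c * (w s \<bullet> w s)) * exp (c * s)" if "a < s" "s < b" for c s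
  proof -
    have "DERIV (\<lambda>s. w s \<bullet> w s) s :> w s \<bullet> w' s + w' s \<bullet> w s"
      unfolding has_real_derivative_iff_has_vector_derivative
      by (rule bounded_bilinear.has_vector_derivative[OF bounded_bilinear_inner d[OF that] d[OF that]])
    moreover have "DERIV (\<lambda>s. exp (c * s)) s :> exp (c * s) * c"
      by (auto intro!: derivative_eq_intros)
    ultimately have "DERIV (\<phi> c) s :> (w s \<bullet> w' s + w' s \<bullet> w s) * exp (c * s) + exp (c * s) * c * (w s \<bullet> w s)"
      unfolding \<phi>_def[abs_def] by (rule DERIV_mult)
    also have "(w s \<bullet> w' s + w' s \<bullet> w s) * exp (c * s) + exp (c * s) * c * (w s \<bullet> w s) =
        (2 * (w s \<bullet> w' s) + c * (w s \<bullet> w s)) * exp (c * s)"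
      by (simp add: inner_commute[of "w' s"] algebra_simps)
    finally show ?thesis .
  qed
  have bound: "\<bar>w s \<bullet> w' s\<bar> \<le> K * (w s \<bullet> w s)" if "a < s" "s < b" for s
  proof -
    have "\<bar>w s \<bullet> w' s\<bar> \<le> norm (w s) * norm (w' s)" by (rule Cauchy_Schwarz_ineq2)
    also have "\<dots> \<le> norm (w s) * (K * norm (w s))" by (intro mult_left_mono K that norm_ge_zero)
    finally show ?thesis by (simp add: power2_norm_eq_inner[symmetric] power2_eq_square mult_ac)
  qed
  have "\<phi> (2 * K) s \<le> 0 \<or> \<phi> (- 2 * K) s \<le> 0"
  proof (cases "s \<le> t")
    case True
    have "\<phi> (2 * K) s \<le> \<phi> (2 * K) t"
    proof (rule DERIV_nonneg_imp_nondecreasing[OF True])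
      fix r assume r: "s \<le> r" "r \<le> t"
      then have "a < r" "r < b" using s t by simp_all
      then show "\<exists>y. DERIV (\<phi> (2 * K)) r :> y \<and> 0 \<le> y"
        by (intro exI[of _ "(2 * (w r \<bullet> w' r) + 2 * K * (w r \<bullet> w r)) * exp (2 * K * r)"] conjI d\<phi> mult_nonneg_nonneg)
          (use bound[of r] in auto)
    qed
    then show ?thesis by (simp add: \<phi>_def t)
  next
    case False
    then have "t \<le> s" by simp
    have "\<phi> (- 2 * K) s \<le> \<phi> (- 2 * K) t"
    proof (rule DERIV_nonpos_imp_nonincreasing[OF \<open>t \<le> s\<close>])
      fix r assume r: "t \<le> r" "r \<le> s"
      then have "a < r" "r < b" using s t by simp_all
      then show "\<exists>y. DERIV (\<phi> (- 2 * K)) r :> y \<and> y \<le> 0"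
        by (intro exI[of _ "(2 * (w r \<bullet> w' r) + - 2 * K * (w r \<bullet> w r)) * exp (- 2 * K * r)"] conjI d\<phi> mult_nonpos_nonneg)
          (use bound[of r] in auto)
    qed
    then show ?thesis by (simp add: \<phi>_def t)
  qed
  then have "w s \<bullet> w s \<le> 0" by (auto simp: \<phi>_def mult_le_0_iff not_le[symmetric])
  then show ?thesis by (metis inner_eq_zero_iff inner_ge_zero order_antisym)
qed

lemma has_vector_derivative_compose_derivative:
  assumes "(x has_vector_derivative x') (at t)" "(f has_derivative f') (at (x t))"
  shows "((\<lambda>s. f (x s)) has_vector_derivative f' x') (at t)"
  using vector_derivative_diff_chain_within[OF assms(1) has_derivative_at_withinI[OF assms(2)]]
  by (simp add: o_def)

lemma isCont_eventually:
  assumes "isCont f t" "open S" "f t \<in> S"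
  shows "eventually (\<lambda>s. f s \<in> S) (nhds t)"
  using assms unfolding continuous_at_open eventually_nhds by blast

text \<open>On the compact ball the derivatives along the axes are bounded by continuity; their
  bounds add up to a bound of the operator norm, and convexity allows the mean value
  inequality.\<close>

lemma smooth_on_Lipschitz_cball:
  fixes V :: "real^'n::finite \<Rightarrow> 'b::real_normed_vector"
  assumes V: "smooth_on U V" and r: "cball x0 r \<subseteq> U"
  shows "\<exists>K. \<forall>x\<in>cball x0 r. \<forall>y\<in>cball x0 r. norm (V x - V y) \<le> K * norm (x - y)"
proof -
  let ?D = "\<lambda>x. frechet_derivative V (at x)"
  have d: "(V has_derivative ?D x) (at x)" if "x \<in> cball x0 r" for x
    using smooth_on_differentiable[OF V] that r by (auto simp: frechet_derivative_works[symmetric])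
  have "\<exists>M. \<forall>x\<in>cball x0 r. norm (?D x (axis k 1)) \<le> M" for k
  proof -
    have "continuous_on (cball x0 r) (\<lambda>x. ?D x (axis k 1))"
      using smooth_on_continuous[OF smooth_on_frechet_derivative[OF V]] r by (rule continuous_on_subset)
    then have "bounded ((\<lambda>x. ?D x (axis k 1)) ` cball x0 r)"
      by (intro compact_imp_bounded compact_continuous_image compact_cball)
    then show ?thesis by (auto simp: bounded_iff)
  qed
  then obtain M where M: "\<And>k x. x \<in> cball x0 r \<Longrightarrow> norm (?D x (axis k 1)) \<le> M k" by metis
  have "onorm (?D x) \<le> (\<Sum>k\<in>UNIV. M k)" if x: "x \<in> cball x0 r" for x
  proof (rule onorm_le)
    fix v
    have "?D x v = (\<Sum>k\<in>UNIV. v $ k *\<^sub>R ?D x (axis k 1))"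
      by (rule linear_axis_sum_vec[OF has_derivative_linear[OF d[OF x]], symmetric])
    also have "norm \<dots> \<le> (\<Sum>k\<in>UNIV. norm v * M k)"
      by (intro sum_norm_le) (simp add: mult_mono M[OF x] component_le_norm_cart)
    finally show "norm (?D x v) \<le> (\<Sum>k\<in>UNIV. M k) * norm v"
      by (simp add: sum_distrib_left mult.commute)
  qed
  then show ?thesis
    using differentiable_bound[OF convex_cball has_derivative_at_withinI[OF d]] by blast
qed

section \<open>Integral curves of left invariant fields\<close>

context lie_group_frame
begin

text \<open>Continuity is a separate clause because a coordinate map has arbitrary values outside
  its domain: differentiable coordinates alone do not keep the curve in the chart.\<close>

definition integral_curve_at :: "real^'n \<Rightarrow> (real \<Rightarrow> 'a) \<Rightarrow> real \<Rightarrow> bool" where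
  "integral_curve_at u \<sigma> t \<longleftrightarrow> isCont \<sigma> t \<and>
     (\<forall>c\<in>A. \<sigma> t \<in> fst c \<longrightarrow> ((\<lambda>s. snd c (\<sigma> s)) has_vector_derivative E u (\<sigma> t) c) (at t))"

lemma integral_curve_atI:
  assumes "isCont \<sigma> t" and c: "c \<in> A" "\<sigma> t \<in> fst c"
    and x: "((\<lambda>s. snd c (\<sigma> s)) has_vector_derivative E u (\<sigma> t) c) (at t)"
  shows "integral_curve_at u \<sigma> t"
  unfolding integral_curve_at_def
proof (intro conjI ballI impI assms(1))
  fix d assume d: "d \<in> A" "\<sigma> t \<in> fst d"
  let ?f = "snd d \<circ> chart_inv c"
  have "(?f has_derivative frechet_derivative ?f (at (snd c (\<sigma> t)))) (at (snd c (\<sigma> t)))"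
    using transition_differentiable[OF manifold c(1) d(1) c(2) d(2)] frechet_derivative_works by blast
  from has_vector_derivative_compose_derivative[OF x this]
  have "((\<lambda>s. ?f (snd c (\<sigma> s))) has_vector_derivative frechet_derivative ?f (at (snd c (\<sigma> t))) (E u (\<sigma> t) c)) (at t)" .
  also have "frechet_derivative ?f (at (snd c (\<sigma> t))) (E u (\<sigma> t) c) = E u (\<sigma> t) d"
    using coord_vec_E[OF c, of u] d by (metis coord_vec_def)
  finally have 1: "((\<lambda>s. ?f (snd c (\<sigma> s))) has_vector_derivative E u (\<sigma> t) d) (at t)" .
  have "eventually (\<lambda>s. \<sigma> s \<in> fst c) (nhds t)"
    by (rule isCont_eventually[OF assms(1) chart(1)[OF c(1)] c(2)])
  then have "eventually (\<lambda>s. s \<in> UNIV \<longrightarrow> ?f (snd c (\<sigma> s)) = snd d (\<sigma> s)) (nhds t)"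
    by (rule eventually_mono) (simp add: chart(5)[OF c(1)])
  from has_vector_derivative_cong_ev[OF this] 1 c
  show "((\<lambda>s. snd d (\<sigma> s)) has_vector_derivative E u (\<sigma> t) d) (at t)"
    by (simp add: chart(5)[OF c(1)])
qed

lemma integral_curve_at_cong:
  assumes "integral_curve_at u \<sigma> t" "open S" "t \<in> S" "\<And>s. s \<in> S \<Longrightarrow> \<sigma> s = \<tau> s"
  shows "integral_curve_at u \<tau> t"
proof -
  have ev: "eventually (\<lambda>s. \<sigma> s = \<tau> s) (nhds t)"
    using assms(2-4) by (auto simp: eventually_nhds)
  have "((\<lambda>s. snd c (\<tau> s)) has_vector_derivative E u (\<tau> t) c) (at t)" if "c \<in> A" "\<tau> t \<in> fst c" for c
  proof (rule has_vector_derivative_transform_within_open[OF _ assms(2,3)])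
    show "((\<lambda>s. snd c (\<sigma> s)) has_vector_derivative E u (\<tau> t) c) (at t)"
      using assms(1) that unfolding integral_curve_at_def assms(4)[OF assms(3)] by blast
  qed (simp add: assms(4))
  moreover have "isCont \<tau> t"
    using assms(1) isCont_cong[OF ev] by (simp add: integral_curve_at_def)
  ultimately show ?thesis by (simp add: integral_curve_at_def)
qed

lemma integral_curve_at_shift:
  assumes "integral_curve_at u \<sigma> (t + r)"
  shows "integral_curve_at u (\<lambda>s. \<sigma> (s + r)) t"
proof -
  have "isCont (\<lambda>s. \<sigma> (s + r)) t"
    using assms isCont_o2[of t "\<lambda>s. s + r" \<sigma>] by (simp add: integral_curve_at_def)
  moreover have "((\<lambda>s. snd c (\<sigma> (s + r))) has_vector_derivative E u (\<sigma> (t + r)) c) (at t)"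
    if "c \<in> A" "\<sigma> (t + r) \<in> fst c" for c
  proof -
    have "((\<lambda>s. s + r) has_vector_derivative 1) (at t)"
      by (auto intro!: derivative_eq_intros)
    moreover have "((\<lambda>s. snd c (\<sigma> s)) has_vector_derivative E u (\<sigma> (t + r)) c) (at (t + r))"
      using assms that by (simp add: integral_curve_at_def)
    ultimately show ?thesis
      using vector_diff_chain_at[of "\<lambda>s. s + r" 1 t "\<lambda>s. snd c (\<sigma> s)"] by (simp add: o_def)
  qed
  ultimately show ?thesis by (simp add: integral_curve_at_def)
qed

lemma isCont_mul: "isCont (mul a) p"
proof -
  have "continuous_on UNIV (\<lambda>(x, y). mul x y)"
    using lie_group by (simp add: lie_group_def smooth_map2_def)
  then have "continuous_on UNIV (\<lambda>y. (\<lambda>(x, y). mul x y) (a, y))"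
    by (rule continuous_on_compose2) (auto intro!: continuous_intros)
  then show ?thesis by (simp add: continuous_on_eq_continuous_at)
qed

lemma mul_differentiable:
  assumes c: "c \<in> A" "p \<in> fst c" and d: "d \<in> A" "mul a p \<in> fst d"
  shows "(snd d \<circ> mul a \<circ> chart_inv c) differentiable (at (snd c p))"
proof -
  obtain b where b: "b \<in> A" "a \<in> fst b" by (rule obtain_chart)
  let ?f = "\<lambda>(u, v). snd d (mul (chart_inv b u) (chart_inv c v))"
  let ?S = "{(u, v). u \<in> chart_image b \<and> v \<in> chart_image c \<and> mul (chart_inv b u) (chart_inv c v) \<in> fst d}"
  have "smooth_on ?S ?f"
    using lie_group b c d by (simp add: lie_group_def smooth_map2_def)
  then have "?f differentiable (at (snd b a, snd c p))"
    by (rule smooth_on_differentiable) (use b c d in \<open>simp add: chart\<close>)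
  then obtain f' where f': "(?f has_derivative f') (at (snd b a, snd c p))"
    by (auto simp: differentiable_def)
  have "((\<lambda>v. (snd b a, v)) has_derivative (\<lambda>\<eta>. (0, \<eta>))) (at (snd c p))"
    by (auto intro!: derivative_eq_intros)
  from has_derivative_compose[OF this f'] b
  show ?thesis by (auto simp: differentiable_def o_def chart)
qed

lemma integral_curve_at_mul:
  assumes \<sigma>: "integral_curve_at u \<sigma> t"
  shows "integral_curve_at u (\<lambda>s. mul a (\<sigma> s)) t"
  unfolding integral_curve_at_def
proof (intro conjI ballI impI)
  have cont: "isCont \<sigma> t" using \<sigma> by (simp add: integral_curve_at_def)
  then show "isCont (\<lambda>s. mul a (\<sigma> s)) t" by (rule isCont_o2[OF _ isCont_mul])
  fix d assume d: "d \<in> A" "mul a (\<sigma> t) \<in> fst d"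
  \<comment> \<open>The very chart chosen inside \<open>tangent_map\<close>, so that
    \<open>E_mul\<close> applies literally.\<close>
  define c where "c = (SOME c. c \<in> A \<and> \<sigma> t \<in> fst c)"
  have "\<exists>c. c \<in> A \<and> \<sigma> t \<in> fst c" using obtain_chart by metis
  from someI_ex[OF this] have c: "c \<in> A" "\<sigma> t \<in> fst c" by (simp_all add: c_def)
  let ?f = "snd d \<circ> mul a \<circ> chart_inv c"
  have "(?f has_derivative frechet_derivative ?f (at (snd c (\<sigma> t)))) (at (snd c (\<sigma> t)))"
    using mul_differentiable[OF c d] frechet_derivative_works by blast
  note fd = this
  have "((\<lambda>s. snd c (\<sigma> s)) has_vector_derivative E u (\<sigma> t) c) (at t)"
    using \<sigma> c by (simp add: integral_curve_at_def)
  from has_vector_derivative_compose_derivative[OF this fd] have "((\<lambda>s. ?f (snd c (\<sigma> s))) has_vector_derivative frechet_derivative ?f (at (snd c (\<sigma> t))) (E u (\<sigma> t) c)) (at t)" .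
  also have "frechet_derivative ?f (at (snd c (\<sigma> t))) (E u (\<sigma> t) c) = E u (mul a (\<sigma> t)) d"
    using d by (simp add: E_mul tangent_map_def c_def[symmetric])
  finally have 1: "((\<lambda>s. ?f (snd c (\<sigma> s))) has_vector_derivative E u (mul a (\<sigma> t)) d) (at t)" .
  have "eventually (\<lambda>s. \<sigma> s \<in> fst c) (nhds t)"
    by (rule isCont_eventually[OF cont chart(1)[OF c(1)] c(2)])
  then have "eventually (\<lambda>s. s \<in> UNIV \<longrightarrow> ?f (snd c (\<sigma> s)) = snd d (mul a (\<sigma> s))) (nhds t)"
    by (rule eventually_mono) (simp add: chart(5)[OF c(1)])
  from has_vector_derivative_cong_ev[OF this] 1 c
  show "((\<lambda>s. snd d (mul a (\<sigma> s))) has_vector_derivative E u (mul a (\<sigma> t)) d) (at t)"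
    by (simp add: chart(5)[OF c(1)])
qed

text \<open>In one chart both curves solve the same equation with a right hand side that is
  Lipschitz on a ball, so \<open>gronwall_zero\<close> applies to their difference.\<close>

lemma integral_curve_unique_near:
  assumes I: "open I" "t \<in> I" and \<sigma>: "\<And>s. s \<in> I \<Longrightarrow> integral_curve_at u \<sigma> s"
    and \<tau>: "\<And>s. s \<in> I \<Longrightarrow> integral_curve_at u \<tau> s" and eq: "\<sigma> t = \<tau> t"
  shows "eventually (\<lambda>s. \<sigma> s = \<tau> s) (nhds t)"
proof -
  obtain c where c: "c \<in> A" "\<sigma> t \<in> fst c" by (rule obtain_chart)
  let ?V = "\<lambda>x. E u (chart_inv c x) c"
  let ?x = "\<lambda>s. snd c (\<sigma> s)" and ?y = "\<lambda>s. snd c (\<tau> s)"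
  obtain r where r: "r > 0" "cball (?x t) r \<subseteq> chart_image c"
    using chart(2)[OF c(1)] chart(4)[OF c(1) c(2)] by (auto simp: open_contains_cball)
  obtain K where K: "\<And>x y. x \<in> cball (?x t) r \<Longrightarrow> y \<in> cball (?x t) r \<Longrightarrow> norm (?V x - ?V y) \<le> K * norm (x - y)"
    using smooth_on_Lipschitz_cball[OF smooth_E_chart[OF c(1)] r(2)] by blast
  have cont: "isCont \<sigma> t" "isCont \<tau> t" using \<sigma> \<tau> I by (simp_all add: integral_curve_at_def)
  have "isCont ?x t" "isCont ?y t"
    using \<sigma>[OF I(2)] \<tau>[OF I(2)] c eq by (auto simp: integral_curve_at_def intro: has_vector_derivative_continuous)
  then have "eventually (\<lambda>s. ?x s \<in> ball (?x t) r) (nhds t)" "eventually (\<lambda>s. ?y s \<in> ball (?x t) r) (nhds t)"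
    using r(1) eq by (intro isCont_eventually; simp)+
  moreover have "eventually (\<lambda>s. s \<in> I) (nhds t)" using I by (simp add: eventually_nhds_in_open)
  moreover have "eventually (\<lambda>s. \<sigma> s \<in> fst c) (nhds t)" "eventually (\<lambda>s. \<tau> s \<in> fst c) (nhds t)"
    using isCont_eventually[OF cont(1) chart(1)[OF c(1)] c(2)] isCont_eventually[OF cont(2) chart(1)[OF c(1)]] c(2) eq
    by simp_all
  ultimately have "eventually (\<lambda>s. s \<in> I \<and> \<sigma> s \<in> fst c \<and> \<tau> s \<in> fst c \<and> ?x s \<in> ball (?x t) r \<and> ?y s \<in> ball (?x t) r) (nhds t)"
    by eventually_elim simp
  then obtain \<delta> where \<delta>: "\<delta> > 0" "\<And>s. dist s t < \<delta> \<Longrightarrow>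
      s \<in> I \<and> \<sigma> s \<in> fst c \<and> \<tau> s \<in> fst c \<and> ?x s \<in> ball (?x t) r \<and> ?y s \<in> ball (?x t) r"
    unfolding eventually_nhds_metric by blast
  have near: "dist s t < \<delta>" if "t - \<delta> < s" "s < t + \<delta>" for s
    using that by (simp add: dist_real_def abs_less_iff)
  have "?x s - ?y s = 0" if s: "t - \<delta> < s" "s < t + \<delta>" for s
  proof (rule gronwall_zero[where w' = "\<lambda>s. ?V (?x s) - ?V (?y s)" and K = K and t = t, OF _ _ _ _ _ s])
    fix s assume "t - \<delta> < s" "s < t + \<delta>"
    note n = \<delta>(2)[OF near[OF this]]
    show "((\<lambda>s. ?x s - ?y s) has_vector_derivative ?V (?x s) - ?V (?y s)) (at s)"
      using \<sigma>[of s] \<tau>[of s] n c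
      by (intro has_vector_derivative_diff) (simp_all add: integral_curve_at_def chart(5)[OF c(1)])
    show "norm (?V (?x s) - ?V (?y s)) \<le> K * norm (?x s - ?y s)"
      using n by (intro K) auto
  qed (use \<delta>(1) eq in auto)
  note eq' = this
  have "\<sigma> s = \<tau> s" if "dist s t < \<delta>" for s
  proof -
    have "t - \<delta> < s" "s < t + \<delta>" using that by (auto simp: dist_real_def abs_less_iff)
    from eq'[OF this] have "?x s = ?y s" by simp
    then have "chart_inv c (?x s) = chart_inv c (?y s)" by simp
    then show ?thesis using \<delta>(2)[OF that] by (simp add: chart(5)[OF c(1)])
  qed
  then show ?thesis
    unfolding eventually_nhds_metric using \<delta>(1) by blast
qed

text \<open>Within the connected set \<open>I\<close> agreement is open by local uniqueness and
  disagreement is open by the Hausdorff property.\<close>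

lemma integral_curve_unique:
  assumes I: "open I" "connected I" and \<sigma>: "\<And>s. s \<in> I \<Longrightarrow> integral_curve_at u \<sigma> s"
    and \<tau>: "\<And>s. s \<in> I \<Longrightarrow> integral_curve_at u \<tau> s" and t: "t \<in> I" "\<sigma> t = \<tau> t" and s: "s \<in> I"
  shows "\<sigma> s = \<tau> s"
proof -
  define S where "S = {s \<in> I. \<sigma> s = \<tau> s}"
  define N where "N = {s \<in> I. \<sigma> s \<noteq> \<tau> s}"
  have "open S"
    unfolding open_subopen[of S]
  proof
    fix r assume "r \<in> S"
    then have r: "r \<in> I" "\<sigma> r = \<tau> r" by (simp_all add: S_def)
    obtain T where "open T" "r \<in> T" "\<forall>s\<in>T. \<sigma> s = \<tau> s"
      using integral_curve_unique_near[OF I(1) r(1) \<sigma> \<tau> r(2)] unfolding eventually_nhds by blast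
    then show "\<exists>T. open T \<and> r \<in> T \<and> T \<subseteq> S"
      using I(1) r(1) by (intro exI[of _ "T \<inter> I"]) (auto simp: S_def)
  qed
  moreover have "open N"
    unfolding open_subopen[of N]
  proof
    fix r assume "r \<in> N"
    then have r: "r \<in> I" "\<sigma> r \<noteq> \<tau> r" by (simp_all add: N_def)
    obtain P Q where PQ: "open P" "open Q" "\<sigma> r \<in> P" "\<tau> r \<in> Q" "P \<inter> Q = {}"
      using hausdorff[OF r(2)] by blast
    have "eventually (\<lambda>s. \<sigma> s \<in> P) (nhds r)" "eventually (\<lambda>s. \<tau> s \<in> Q) (nhds r)"
      using \<sigma>[OF r(1)] \<tau>[OF r(1)] PQ by (auto simp: integral_curve_at_def intro: isCont_eventually)
    then have "eventually (\<lambda>s. \<sigma> s \<noteq> \<tau> s) (nhds r)"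
      by eventually_elim (use PQ(5) in auto)
    then obtain T where "open T" "r \<in> T" "\<forall>s\<in>T. \<sigma> s \<noteq> \<tau> s"
      unfolding eventually_nhds by blast
    then show "\<exists>T. open T \<and> r \<in> T \<and> T \<subseteq> N"
      using I(1) r(1) by (intro exI[of _ "T \<inter> I"]) (auto simp: N_def)
  qed
  moreover have "I \<subseteq> S \<union> N" "S \<inter> N \<inter> I = {}" by (auto simp: S_def N_def)
  ultimately have "S \<inter> I = {} \<or> N \<inter> I = {}" using connectedD[OF I(2)] by blast
  then show ?thesis using t s by (auto simp: S_def N_def)
qed

lemma int_powers: "\<exists>P::int \<Rightarrow> 'a. P 0 = e \<and> (\<forall>k. P (k + 1) = mul (P k) h)"
proof -
  define P where "P k = (if k \<ge> 0 then ((\<lambda>x. mul x h) ^^ nat k) e else ((\<lambda>x. mul x (ginv h)) ^^ nat (- k)) e)" for k :: int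
  have "P (k + 1) = mul (P k) h" for k
  proof (cases "k \<ge> 0")
    case True
    then show ?thesis by (simp add: P_def nat_add_distrib)
  next
    case False
    then have "nat (- k) = Suc (nat (- (k + 1)))" by simp
    then have "P k = mul (((\<lambda>x. mul x (ginv h)) ^^ nat (- (k + 1))) e) (ginv h)"
      using False by (simp add: P_def)
    moreover have "P (k + 1) = ((\<lambda>x. mul x (ginv h)) ^^ nat (- (k + 1))) e"
      using False by (auto simp: P_def)
    ultimately show ?thesis by (simp add: assoc)
  qed
  then show ?thesis by (intro exI[of _ P]) (simp add: P_def)
qed

text \<open>A local integral curve \<open>\<gamma>\<close> through the unit element, given on \<open>]-2\<delta>, 2\<delta>[\<close>, extends to all of \<open>\<real>\<close>
  by left translations with the powers of \<open>\<gamma>(\<delta>)\<close>.\<close>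

lemma integral_curve_extend_unit:
  assumes \<delta>: "\<delta> > 0" and \<gamma>: "\<And>s. - 2 * \<delta> < s \<Longrightarrow> s < 2 * \<delta> \<Longrightarrow> integral_curve_at u \<gamma> s" and e: "\<gamma> 0 = e"
  shows "\<exists>\<tau>. \<tau> 0 = e \<and> (\<forall>t. integral_curve_at u \<tau> t)"
proof -
  obtain P :: "int \<Rightarrow> 'a" where P: "P 0 = e" "\<And>k. P (k + 1) = mul (P k) (\<gamma> \<delta>)"
    using int_powers[of "\<gamma> \<delta>"] by blast
  define piece where "piece k t = mul (P k) (\<gamma> (t + - (of_int k * \<delta>)))" for k :: int and t :: real
  define \<tau> where "\<tau> t = piece \<lfloor>t / \<delta>\<rfloor> t" for t
  \<comment> \<open>Pieces live on intervals of length \<open>4 * \<delta>\<close> while their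
    centres are \<open>\<delta>\<close> apart, so that neighbouring pieces overlap amply.\<close>
  have piece: "integral_curve_at u (piece k) t" if "(k - 2) * \<delta> < t" "t < (k + 2) * \<delta>" for k :: int and t
    unfolding piece_def using that
    by (intro integral_curve_at_mul integral_curve_at_shift \<gamma>) (simp_all add: algebra_simps)
  have overlap: "piece (k - 1) t = piece k t" if "(k - 1) * \<delta> < t" "t < (k + 1) * \<delta>" for k :: int and t
  proof (rule integral_curve_unique[of "{(k - 1) * \<delta> <..< (k + 1) * \<delta>}" u _ _ "k * \<delta>"])
    \<comment> \<open>The choice of the group element: \<open>P (k - 1)\<close> times
      \<open>\<gamma> \<delta>\<close> is \<open>P k\<close>, while \<open>\<gamma> 0\<close> is the
      unit.\<close>
    show "piece (k - 1) (k * \<delta>) = piece k (k * \<delta>)"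
      using P(2)[of "k - 1"] by (simp add: piece_def e algebra_simps)
    show "integral_curve_at u (piece (k - 1)) s" "integral_curve_at u (piece k) s"
      if "s \<in> {(k - 1) * \<delta> <..< (k + 1) * \<delta>}" for s
      using that \<delta> by (auto intro!: piece simp: algebra_simps)
  qed (use that \<delta> in \<open>auto simp: algebra_simps\<close>)
  have "integral_curve_at u \<tau> t" for t
  proof -
    define k where "k = \<lfloor>t / \<delta>\<rfloor>"
    have "of_int k \<le> t / \<delta>" "t / \<delta> < of_int k + 1" unfolding k_def by linarith+
    then have k: "k * \<delta> \<le> t" "t < (k + 1) * \<delta>" using \<delta> by (simp_all add: field_simps)
    show ?thesis
    \<comment> \<open>At the left end \<open>t = k * \<delta>\<close> the floor jumps, so a
      two-sided neighbourhood also meets the previous piece; \<open>overlap\<close> identifies it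
      with \<open>piece k\<close> there.\<close>
    proof (rule integral_curve_at_cong[of u "piece k" t "{(k - 1) * \<delta> <..< (k + 1) * \<delta>}"])
      show "integral_curve_at u (piece k) t" using k \<delta> by (intro piece) (simp_all add: algebra_simps)
      show "t \<in> {(k - 1) * \<delta> <..< (k + 1) * \<delta>}" using k \<delta> by (simp add: algebra_simps)
      fix s assume s: "s \<in> {(k - 1) * \<delta> <..< (k + 1) * \<delta>}"
      show "piece k s = \<tau> s"
      proof (cases "k * \<delta> \<le> s")
        case True
        then have "\<lfloor>s / \<delta>\<rfloor> = k" using s \<delta> by (intro floor_unique) (simp_all add: field_simps)
        then show ?thesis by (simp add: \<tau>_def)
      next
        case False
        then have "\<lfloor>s / \<delta>\<rfloor> = k - 1" using s \<delta> by (intro floor_unique) (simp_all add: field_simps)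
        then show ?thesis using overlap[of k s] s by (simp add: \<tau>_def)
      qed
    qed simp
  qed
  moreover have "\<tau> 0 = e" by (simp add: \<tau>_def piece_def P(1) e)
  ultimately show ?thesis by blast
qed

lemma integral_curve_extend:
  assumes I: "open I" "is_interval I" "I \<noteq> {}" and \<sigma>: "\<And>t. t \<in> I \<Longrightarrow> integral_curve_at u \<sigma> t"
  shows "\<exists>\<tau>. (\<forall>t. integral_curve_at u \<tau> t) \<and> (\<forall>t\<in>I. \<tau> t = \<sigma> t)"
proof -
  obtain t0 where t0: "t0 \<in> I" using I(3) by blast
  obtain r where r: "r > 0" "ball t0 r \<subseteq> I" using I(1) t0 openE by blast
  \<comment> \<open>Left translation and a time shift move the curve to the unit at time 0;
    \<open>\<tau>'\<close> below undoes both, and uniqueness on \<open>I\<close> identifies it with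
    \<open>\<sigma>\<close>.\<close>
  define \<gamma> where "\<gamma> s = mul (ginv (\<sigma> t0)) (\<sigma> (s + t0))" for s
  have "integral_curve_at u \<gamma> s" if "- 2 * (r / 2) < s" "s < 2 * (r / 2)" for s
    unfolding \<gamma>_def[abs_def]
  proof (intro integral_curve_at_mul integral_curve_at_shift \<sigma>)
    have "s + t0 \<in> ball t0 r" using that by (auto simp: dist_real_def)
    then show "s + t0 \<in> I" using r(2) by blast
  qed
  moreover have "\<gamma> 0 = e" by (simp add: \<gamma>_def)
  ultimately obtain \<tau> where \<tau>: "\<tau> 0 = e" "\<And>t. integral_curve_at u \<tau> t"
    using integral_curve_extend_unit[of "r / 2" u \<gamma>] r(1) by auto
  define \<tau>' where "\<tau>' t = mul (\<sigma> t0) (\<tau> (t + - t0))" for t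
  have \<tau>': "integral_curve_at u \<tau>' t" for t
    unfolding \<tau>'_def[abs_def] by (intro integral_curve_at_mul integral_curve_at_shift \<tau>(2))
  have "\<tau>' t = \<sigma> t" if "t \<in> I" for t
  proof (rule integral_curve_unique[OF I(1) _ \<tau>' \<sigma> t0 _ that])
    show "connected I" using I(2) by (rule is_interval_connected)
    show "\<tau>' t0 = \<sigma> t0" using right_neutral[of "\<sigma> t0"] by (simp add: \<tau>'_def \<tau>(1))
  qed
  with \<tau>' show ?thesis by blast
qed

section \<open>Geodesics as integral curves of left invariant fields\<close>

lemma geodesic_integral_curve:
  assumes I: "open I" "is_interval I" and \<sigma>: "geodesic_on A F I \<sigma>"
  shows "\<exists>u. \<forall>t\<in>I. integral_curve_at u \<sigma> t"
proof -
  have cont: "isCont \<sigma> t" if "t \<in> I" for t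
    using \<sigma> that continuous_on_eq_continuous_at[OF I(1)] unfolding geodesic_on_def by blast
  have geo: "(\<lambda>s. snd c (\<sigma> s)) differentiable (at t)"
    "(\<lambda>s. vector_derivative (\<lambda>s. snd c (\<sigma> s)) (at s)) differentiable (at t)"
    "vector_derivative (\<lambda>s. vector_derivative (\<lambda>s. snd c (\<sigma> s)) (at s)) (at t) $ i +
       (\<Sum>j\<in>UNIV. \<Sum>k\<in>UNIV. chern (local_rep A F c) (snd c (\<sigma> t)) (vector_derivative (\<lambda>s. snd c (\<sigma> s)) (at t)) i j k
          * vector_derivative (\<lambda>s. snd c (\<sigma> s)) (at t) $ j * vector_derivative (\<lambda>s. snd c (\<sigma> s)) (at t) $ k) = 0"
    if "t \<in> I" "c \<in> A" "\<sigma> t \<in> fst c" for t c i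
    using \<sigma> that unfolding geodesic_on_def Let_def by blast+
  \<comment> \<open>The frame coefficients of the velocity, defined without reference to a chart so
    that the local computations concern one function on \<open>I\<close>; \<open>\<omega>_eq\<close>
    gives its value in every chart.\<close>
  define \<omega> where "\<omega> t = (SOME u. integral_curve_at u \<sigma> t)" for t
  have \<omega>_eq: "integral_curve_at (co c (snd c (\<sigma> t)) (vector_derivative (\<lambda>s. snd c (\<sigma> s)) (at t))) \<sigma> t"
    "\<omega> t = co c (snd c (\<sigma> t)) (vector_derivative (\<lambda>s. snd c (\<sigma> s)) (at t))"
    if t: "t \<in> I" and c: "c \<in> A" "\<sigma> t \<in> fst c" for t c
  proof -
    let ?v = "co c (snd c (\<sigma> t)) (vector_derivative (\<lambda>s. snd c (\<sigma> s)) (at t))"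
    have x: "((\<lambda>s. snd c (\<sigma> s)) has_vector_derivative vector_derivative (\<lambda>s. snd c (\<sigma> s)) (at t)) (at t)"
      using geo(1)[OF t c] by (simp add: vector_derivative_works)
    have "E ?v (\<sigma> t) c = vector_derivative (\<lambda>s. snd c (\<sigma> s)) (at t)"
      using E_co[OF c(1) chart(4)[OF c]] by (simp add: chart(5)[OF c])
    with x show v: "integral_curve_at ?v \<sigma> t"
      by (intro integral_curve_atI[OF cont[OF t] c]) simp
    have "u = ?v" if "integral_curve_at u \<sigma> t" for u
    proof -
      have "((\<lambda>s. snd c (\<sigma> s)) has_vector_derivative E u (\<sigma> t) c) (at t)"
        using that c by (simp add: integral_curve_at_def)
      from vector_derivative_unique_at[OF this x] show ?thesis
        using co_E[OF c(1) chart(4)[OF c], of u] by (simp add: chart(5)[OF c])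
    qed
    with someI[of "\<lambda>u. integral_curve_at u \<sigma> t", OF v] show "\<omega> t = ?v"
      unfolding \<omega>_def by blast
  qed
  have "(\<omega> has_vector_derivative 0) (at t)" if t: "t \<in> I" for t
  proof -
    obtain c where c: "c \<in> A" "\<sigma> t \<in> fst c" by (rule obtain_chart)
    interpret frame_chart br \<kappa> "chart_image c" "\<lambda>x u. E u (chart_inv c x) c" "co c" "local_rep A F c"
      by (rule frame_chart[OF c(1)])
    define x where "x s = snd c (\<sigma> s)" for s
    define x' where "x' s = vector_derivative x (at s)" for s
    define x'' where "x'' = vector_derivative x' (at t)"
    have xU: "x t \<in> chart_image c" using chart(4)[OF c] by (simp add: x_def)
    have d: "(x has_vector_derivative x' t) (at t)" "(x' has_vector_derivative x'') (at t)"
      using geo(1,2)[OF t c] unfolding x''_def x'_def x_def vector_derivative_works by blast+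
    have eq: "x'' $ i + (\<Sum>j\<in>UNIV. \<Sum>k\<in>UNIV. chern (local_rep A F c) (x t) (x' t) i j k * x' t $ j * x' t $ k) = 0" for i
      using geo(3)[OF t c] unfolding x''_def x'_def x_def by blast
    have "x'' = DE (x t) (co c (x t) (x' t)) (x' t)"
    \<comment> \<open>At a zero velocity the Chern coefficients are unknown, but they are multiplied
      by 0 and both sides vanish.\<close>
    proof (cases "x' t = 0")
      case True
      then have "x'' $ i = 0" for i using eq[of i] by simp
      then have "x'' = 0" by (simp add: vec_eq_iff)
      with True show ?thesis by (simp add: linear_0[OF linear_DE[OF xU]])
    next
      case False
      then have "x'' + \<Gamma> (x t) (x' t) (x' t) = 0"
        using eq by (simp add: sum_chern[OF xU] vec_eq_iff)
      moreover have "\<Gamma> (x t) (x' t) (x' t) = - DE (x t) (co c (x t) (x' t)) (x' t)"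
        by (simp add: \<Gamma>_def scaleR_2[symmetric])
      ultimately show ?thesis by simp
    qed
    with has_vector_derivative_co[OF xU d]
    have "((\<lambda>s. co c (x s) (x' s)) has_vector_derivative 0) (at t)" by (simp add: lin_simps)
    moreover have ev: "eventually (\<lambda>s. s \<in> UNIV \<longrightarrow> co c (x s) (x' s) = \<omega> s) (nhds t)"
      using isCont_eventually[OF cont[OF t] chart(1)[OF c(1)] c(2)] eventually_nhds_in_open[OF I(1) t]
      by eventually_elim (simp add: \<omega>_eq(2)[OF _ c(1)] x_def[abs_def] x'_def[abs_def])
    ultimately show ?thesis
      using has_vector_derivative_cong_ev[OF ev] \<omega>_eq(2)[OF t c]
      by (simp add: x_def[abs_def] x'_def[abs_def])
  qed
  \<comment> \<open>A zero derivative on an interval makes the coefficients constant.\<close>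
  then have "\<exists>u. \<forall>t\<in>I. \<omega> t = u"
    using has_derivative_zero_constant[of I \<omega>] is_interval_convex[OF I(2)]
    by (auto simp: has_vector_derivative_def intro: has_derivative_at_withinI)
  then obtain u where u: "\<And>t. t \<in> I \<Longrightarrow> \<omega> t = u" by blast
  have "integral_curve_at u \<sigma> t" if t: "t \<in> I" for t
  proof -
    obtain c where c: "c \<in> A" "\<sigma> t \<in> fst c" by (rule obtain_chart)
    show ?thesis using \<omega>_eq[OF t c] u[OF t] by simp
  qed
  then show ?thesis by blast
qed

text \<open>With constant coefficients \<open>u\<close> the acceleration is the derivative
  \<open>DE\<close> of the frame field along the velocity, which is minus the
  \<open>\<Gamma>\<close>-term because the bracket of \<open>u\<close> with itself vanishes.\<close>

lemma integral_curve_geodesic: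
  assumes \<tau>: "\<And>t. integral_curve_at u \<tau> t"
  shows "geodesic_on A F UNIV \<tau>"
  unfolding geodesic_on_def Let_def
proof (intro conjI ballI impI allI)
  have cont: "isCont \<tau> t" for t using \<tau> by (simp add: integral_curve_at_def)
  then show "continuous_on UNIV \<tau>" by (simp add: continuous_at_imp_continuous_on)
  fix t c assume c: "c \<in> A" "\<tau> t \<in> fst c"
  interpret frame_chart br \<kappa> "chart_image c" "\<lambda>x u. E u (chart_inv c x) c" "co c" "local_rep A F c"
    by (rule frame_chart[OF c(1)])
  define x where "x s = snd c (\<tau> s)" for s
  define x' where "x' s = vector_derivative x (at s)" for s
  have xU: "x t \<in> chart_image c" using chart(4)[OF c] by (simp add: x_def)
  have dx: "(x has_vector_derivative E u (chart_inv c (x s)) c) (at s)" if "\<tau> s \<in> fst c" for s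
    using \<tau>[of s] that c(1) by (simp add: integral_curve_at_def x_def[abs_def] chart(5))
  have x'_eq: "x' s = E u (chart_inv c (x s)) c" if "\<tau> s \<in> fst c" for s
    unfolding x'_def by (rule vector_derivative_at[OF dx[OF that]])
  have "((\<lambda>s. E u (chart_inv c (x s)) c) has_vector_derivative DE (x t) u (x' t)) (at t)"
    using has_vector_derivative_compose_derivative[OF dx[OF c(2)] DE[OF xU]] by (simp add: x'_eq[OF c(2)])
  moreover have ev: "eventually (\<lambda>s. s \<in> UNIV \<longrightarrow> E u (chart_inv c (x s)) c = x' s) (nhds t)"
    using isCont_eventually[OF cont[of t] chart(1)[OF c(1)] c(2)]
    by eventually_elim (simp add: x'_eq)
  ultimately have dx': "(x' has_vector_derivative DE (x t) u (x' t)) (at t)"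
    using has_vector_derivative_cong_ev[OF ev] x'_eq[OF c(2)] by simp
  have cx: "co c (x t) (x' t) = u" using co_E[OF xU] by (simp add: x'_eq[OF c(2)])
  have "x differentiable (at t)" using dx[OF c(2)] by (rule differentiableI_vector)
  then show "(\<lambda>s. snd c (\<tau> s)) differentiable (at t)" by (simp add: x_def[abs_def])
  have "x' differentiable (at t)" using dx' by (rule differentiableI_vector)
  then show "(\<lambda>s. vector_derivative (\<lambda>s. snd c (\<tau> s)) (at s)) differentiable (at t)"
    by (simp add: x'_def[abs_def] x_def[abs_def])
  fix i
  have "vector_derivative x' (at t) $ i +
       (\<Sum>j\<in>UNIV. \<Sum>k\<in>UNIV. chern (local_rep A F c) (x t) (x' t) i j k * x' t $ j * x' t $ k) = 0"
  proof (cases "x' t = 0")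
    case True
    then show ?thesis using linear_0[OF linear_DE[OF xU]] by (simp add: vector_derivative_at[OF dx'])
  next
    case False
    have "\<Gamma> (x t) (x' t) (x' t) = - DE (x t) u (x' t)"
      by (simp add: \<Gamma>_def cx scaleR_2[symmetric])
    then show ?thesis by (simp add: vector_derivative_at[OF dx'] sum_chern[OF xU False])
  qed
  then show "vector_derivative (\<lambda>s. vector_derivative (\<lambda>s. snd c (\<tau> s)) (at s)) (at t) $ i +
       (\<Sum>j\<in>UNIV. \<Sum>k\<in>UNIV. chern (local_rep A F c) (snd c (\<tau> t)) (vector_derivative (\<lambda>s. snd c (\<tau> s)) (at t)) i j k
          * vector_derivative (\<lambda>s. snd c (\<tau> s)) (at t) $ j * vector_derivative (\<lambda>s. snd c (\<tau> s)) (at t) $ k) = 0"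
    by (simp add: x'_def[abs_def] x_def[abs_def])
qed

theorem F_geodesically_complete: "geodesically_complete A F"
  unfolding geodesically_complete_def
proof (intro allI impI, elim conjE)
  fix I \<sigma> assume I: "open I" "is_interval I" "I \<noteq> {}" and \<sigma>: "geodesic_on A F I \<sigma>"
  obtain u where "\<And>t. t \<in> I \<Longrightarrow> integral_curve_at u \<sigma> t"
    using geodesic_integral_curve[OF I(1,2) \<sigma>] by blast
  from integral_curve_extend[OF I this]
  show "\<exists>\<tau>. geodesic_on A F UNIV \<tau> \<and> (\<forall>t\<in>I. \<tau> t = \<sigma> t)"
    using integral_curve_geodesic by blast
qed

end

section \<open>The Lie bracket of vector fields is bilinear\<close>

lemma smooth_vfield_differentiable:
  assumes "smooth_manifold A" "smooth_vfield A V" "c \<in> A" "p \<in> fst c"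
  shows "(\<lambda>u. V (chart_inv c u) c) differentiable (at (snd c p))"
  using assms is_chartD(4)[OF smooth_manifold_chart[OF assms(1,3)] assms(4)]
  by (auto simp: smooth_vfield_def intro: smooth_on_differentiable)

lemma lie_bracket_antisym: "lie_bracket A V W = - lie_bracket A W V"
  by (simp add: lie_bracket_def fun_eq_iff)

text \<open>Smoothness enters because \<open>frechet_derivative\<close> is additive only for
  differentiable fields.\<close>

lemma lie_bracket_add:
  assumes A: "smooth_manifold A" and V: "smooth_vfield A V" and V': "smooth_vfield A V'" and W: "smooth_vfield A W"
  shows "lie_bracket A (V + V') W = lie_bracket A V W + lie_bracket A V' W"
proof (intro ext)
  fix p c
  show "lie_bracket A (V + V') W p c = (lie_bracket A V W + lie_bracket A V' W) p c"
  proof (cases "c \<in> A \<and> p \<in> fst c")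
    case True
    then have d: "((\<lambda>u. V (chart_inv c u) c) has_derivative frechet_derivative (\<lambda>u. V (chart_inv c u) c) (at (snd c p))) (at (snd c p))"
      "((\<lambda>u. V' (chart_inv c u) c) has_derivative frechet_derivative (\<lambda>u. V' (chart_inv c u) c) (at (snd c p))) (at (snd c p))"
      "linear (frechet_derivative (\<lambda>u. W (chart_inv c u) c) (at (snd c p)))"
      using smooth_vfield_differentiable[OF A] V V' W
      by (simp_all add: frechet_derivative_works[symmetric] linear_frechet_derivative)
    show ?thesis
      using True frechet_derivative_at[OF has_derivative_add[OF d(1,2)], symmetric]
      by (simp add: lie_bracket_def linear_add[OF d(3)])
  qed (auto simp: lie_bracket_def)
qed

lemma lie_bracket_scaleR:
  assumes A: "smooth_manifold A" and V: "smooth_vfield A V" and W: "smooth_vfield A W"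
  shows "lie_bracket A (r *\<^sub>R V) W = r *\<^sub>R lie_bracket A V W"
proof (intro ext)
  fix p c
  show "lie_bracket A (r *\<^sub>R V) W p c = (r *\<^sub>R lie_bracket A V W) p c"
  proof (cases "c \<in> A \<and> p \<in> fst c")
    case True
    then have d: "((\<lambda>u. V (chart_inv c u) c) has_derivative frechet_derivative (\<lambda>u. V (chart_inv c u) c) (at (snd c p))) (at (snd c p))"
      "linear (frechet_derivative (\<lambda>u. W (chart_inv c u) c) (at (snd c p)))"
      using smooth_vfield_differentiable[OF A] V W
      by (simp_all add: frechet_derivative_works[symmetric] linear_frechet_derivative)
    show ?thesis
      using True frechet_derivative_at[OF has_derivative_scaleR_right[OF d(1)], symmetric]
      by (simp add: lie_bracket_def linear_scale[OF d(2)] scaleR_diff_right)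
  qed (auto simp: lie_bracket_def)
qed

section \<open>The Lie algebra \<open>\<real> \<oplus> su(2)\<close>\<close>

lemma vector_4 [simp]:
  "(vector [a, b, c, d] :: 'a::zero^4) $ 1 = a" "(vector [a, b, c, d] :: 'a^4) $ 2 = b"
  "(vector [a, b, c, d] :: 'a^4) $ 3 = c" "(vector [a, b, c, d] :: 'a^4) $ 4 = d"
  by (simp_all add: vector_def)

text \<open>The cross product in the last three coordinates, which belong to \<open>Y\<close>,
  \<open>Z\<close>, \<open>W\<close>; the first coordinate belongs to the central field
  \<open>X\<close>.\<close>

definition su2_bracket :: "real^4 \<Rightarrow> real^4 \<Rightarrow> real^4" where
  "su2_bracket u v = vector [0, u$3 * v$4 - u$4 * v$3, u$4 * v$2 - u$2 * v$4, u$2 * v$3 - u$3 * v$2]"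

lemma su2_bracket_nth [simp]:
  "su2_bracket u v $ 1 = 0" "su2_bracket u v $ 2 = u$3 * v$4 - u$4 * v$3"
  "su2_bracket u v $ 3 = u$4 * v$2 - u$2 * v$4" "su2_bracket u v $ 4 = u$2 * v$3 - u$3 * v$2"
  by (simp_all add: su2_bracket_def)

lemma inner_4: "(u::real^4) \<bullet> v = u$1 * v$1 + u$2 * v$2 + u$3 * v$3 + u$4 * v$4"
  by (simp add: inner_vec_def sum_4)

text \<open>Ad-invariance is the alternating property of the scalar triple product.\<close>

lemma ad_invariant_su2_bracket:
  assumes "\<bar>q\<bar> < 1"
  shows "ad_invariant su2_bracket (vector [q, 0, 0, 0])"
proof (rule ad_invariant.intro)
  have "bilinear su2_bracket"
    unfolding bilinear_def by (intro conjI allI linearI; simp add: vec_eq_iff forall_4 algebra_simps)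
  then show "bounded_bilinear su2_bracket" by (simp add: bilinear_conv_bounded_bilinear)
  show "norm (vector [q, 0, 0, 0] :: real^4) < 1"
    using assms by (simp add: norm_eq_sqrt_inner inner_4)
qed (simp_all add: vec_eq_iff forall_4 inner_4 algebra_simps)

theorem mainTheorem1:
  fixes A :: "('a::{t2_space,second_countable_topology}, 4) chart set"
    and mul :: "'a \<Rightarrow> 'a \<Rightarrow> 'a" and e :: 'a and ginv :: "'a \<Rightarrow> 'a"
    and X Y Z W Q :: "('a, 4) vfield"
    and g :: "'a \<Rightarrow> ('a, 4) tvec \<Rightarrow> ('a, 4) tvec \<Rightarrow> real"
    and F :: "'a \<Rightarrow> ('a, 4) tvec \<Rightarrow> real"
    and q :: real
  assumes G: "lie_group A mul e ginv" and sc: "simply_connected (UNIV :: 'a set)"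
    and basis: "distinct [X, Y, Z, W]" "independent {X, Y, Z, W}"
               "span {X, Y, Z, W} = lie_algebra A mul"
    and brackets: "lie_bracket A Y Z = W" "lie_bracket A Z W = Y" "lie_bracket A W Y = Z"
    and central: "\<forall>V\<in>lie_algebra A mul. lie_bracket A X V = 0"
    and g: "riemannian_metric A g" "left_invariant_metric A mul e ginv g"
    and onb: "orthonormal_at g e [X, Y, Z, W]"
    and q: "0 < \<bar>q\<bar>" "\<bar>q\<bar> < 1"
    and Q: "Q = q *\<^sub>R X"
    and F: "F = randers g Q"
  shows "berwald_type A F \<and> geodesically_complete A F \<and>
    (\<forall>a b c d a' b' c' d' U V.
       U = a *\<^sub>R X + b *\<^sub>R Y + c *\<^sub>R Z + d *\<^sub>R W \<and>
       V = a' *\<^sub>R X + b' *\<^sub>R Y + c' *\<^sub>R Z + d' *\<^sub>R W \<and>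
       orthonormal_at g e [U, V] \<longrightarrow>
       (\<forall>p. flag_curvature A F p (span {U p, V p}) (U p) =
              ((b * c' - c * b')\<^sup>2 + (b * d' - d * b')\<^sup>2 + (c * d' - d * c')\<^sup>2)
              / (4 * (1 + a * q)\<^sup>2) \<and>
            flag_curvature A F p (span {U p, V p}) (U p) \<ge> 0)) \<and>
    nonneg_flag_curvature A F"
proof -
  have A: "smooth_manifold A" using G by (simp add: lie_group_def)
  define E where "E u = u$1 *\<^sub>R X + u$2 *\<^sub>R Y + u$3 *\<^sub>R Z + u$4 *\<^sub>R W" for u :: "real^4"
  have sub: "subspace (lie_algebra A mul)"
    unfolding basis(3)[symmetric] by (rule subspace_span)
  have mem: "X \<in> lie_algebra A mul" "Y \<in> lie_algebra A mul" "Z \<in> lie_algebra A mul" "W \<in> lie_algebra A mul"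
    unfolding basis(3)[symmetric] by (simp_all add: span_base)
  have E_mem: "E u \<in> lie_algebra A mul" for u
    unfolding E_def by (intro subspace_add[OF sub] subspace_scale[OF sub] mem)
  note closed = subspace_add[OF sub] subspace_scale[OF sub]
  have smooth: "smooth_vfield A V" if "V \<in> lie_algebra A mul" for V
    using that by (simp add: lie_algebra_def)
  have tangent: "V p \<in> tangent_space A p" if "V \<in> lie_algebra A mul" for V p
    using smooth[OF that] by (simp add: smooth_vfield_def)
  have lb: "lie_bracket A (V + V') V'' = lie_bracket A V V'' + lie_bracket A V' V''"
    "lie_bracket A (r *\<^sub>R V) V'' = r *\<^sub>R lie_bracket A V V''"
    if "V \<in> lie_algebra A mul" "V' \<in> lie_algebra A mul" "V'' \<in> lie_algebra A mul" for V V' V'' r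
    using that by (simp_all add: smooth lie_bracket_add[OF A] lie_bracket_scaleR[OF A])
  have lbE: "lie_bracket A (E u) V = u$1 *\<^sub>R lie_bracket A X V + u$2 *\<^sub>R lie_bracket A Y V
      + u$3 *\<^sub>R lie_bracket A Z V + u$4 *\<^sub>R lie_bracket A W V" if "V \<in> lie_algebra A mul" for u V
    unfolding E_def using that mem by (simp add: lb closed)
  have lbE': "lie_bracket A V (E u) = u$1 *\<^sub>R lie_bracket A V X + u$2 *\<^sub>R lie_bracket A V Y
      + u$3 *\<^sub>R lie_bracket A V Z + u$4 *\<^sub>R lie_bracket A V W" if "V \<in> lie_algebra A mul" for u V
    \<comment> \<open>Linearity in the second argument is inherited from the first by
      antisymmetry.\<close>
    using lbE[OF that, of u] lie_bracket_antisym[of A V "E u"] lie_bracket_antisym[of A V X]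
      lie_bracket_antisym[of A V Y] lie_bracket_antisym[of A V Z] lie_bracket_antisym[of A V W]
    by (simp add: algebra_simps)
  have self: "lie_bracket A V V = 0" for V
    by (simp add: lie_bracket_def fun_eq_iff)
  have table: "lie_bracket A X V = 0" "lie_bracket A V X = 0" if "V \<in> lie_algebra A mul" for V
    using central that lie_bracket_antisym[of A V X] by simp_all
  have table': "lie_bracket A Z Y = - W" "lie_bracket A W Z = - Y" "lie_bracket A Y W = - Z"
    using brackets lie_bracket_antisym[of A Z Y] lie_bracket_antisym[of A W Z] lie_bracket_antisym[of A Y W]
    by simp_all
  have bracket: "lie_bracket A (E u) (E v) = E (su2_bracket u v)" for u v
    unfolding lbE[OF E_mem] lbE'[OF mem(1)] lbE'[OF mem(2)] lbE'[OF mem(3)] lbE'[OF mem(4)]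
    by (simp add: table mem brackets table' self) (simp add: E_def algebra_simps)
  have gs: "g e v w = g e w v" "g e (v + v') w = g e v w + g e v' w" "g e (r *\<^sub>R v) w = r * g e v w"
    if "v \<in> tangent_space A e" "v' \<in> tangent_space A e" "w \<in> tangent_space A e" for v v' w r
    using g(1) that unfolding riemannian_metric_def by blast+
  have gE: "g e (E u e) (V e) = u$1 * g e (X e) (V e) + u$2 * g e (Y e) (V e)
      + u$3 * g e (Z e) (V e) + u$4 * g e (W e) (V e)" if V: "V \<in> lie_algebra A mul" for u V
  proof -
    have 1: "g e ((V1 + V2) e) (V e) = g e (V1 e) (V e) + g e (V2 e) (V e)" "g e ((r *\<^sub>R V1) e) (V e) = r * g e (V1 e) (V e)"
      if "V1 \<in> lie_algebra A mul" "V2 \<in> lie_algebra A mul" for V1 V2 r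
      using gs(2,3)[OF tangent[OF that(1)] tangent[OF that(2)] tangent[OF V]] by simp_all
    show ?thesis unfolding E_def using mem by (simp only: 1 closed)
  qed
  have o: "g e (X e) (X e) = 1" "g e (X e) (Y e) = 0" "g e (X e) (Z e) = 0" "g e (X e) (W e) = 0"
    "g e (Y e) (X e) = 0" "g e (Y e) (Y e) = 1" "g e (Y e) (Z e) = 0" "g e (Y e) (W e) = 0"
    "g e (Z e) (X e) = 0" "g e (Z e) (Y e) = 0" "g e (Z e) (Z e) = 1" "g e (Z e) (W e) = 0"
    "g e (W e) (X e) = 0" "g e (W e) (Y e) = 0" "g e (W e) (Z e) = 0" "g e (W e) (W e) = 1"
    using onb unfolding orthonormal_at_def by (simp_all add: All_less_Suc)
  have gE': "g e (E u e) (E v e) = u \<bullet> v" for u v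
  proof -
    have "g e (V e) (E v e) = g e (E v e) (V e)" if "V \<in> lie_algebra A mul" for V
      by (rule gs(1)[OF tangent[OF that] tangent[OF that] tangent[OF E_mem]])
    then show ?thesis
      unfolding gE[OF E_mem] using mem by (simp add: gE o inner_4)
  qed
  interpret lie_group_frame su2_bracket "vector [q, 0, 0, 0]" A mul e ginv E g
  proof (intro lie_group_frame.intro lie_group_frame_axioms.intro ad_invariant_su2_bracket q(2) G E_mem bracket gE' g)
    show "linear E" by (rule linearI) (simp_all add: E_def algebra_simps)
  qed
  have "E (vector [q, 0, 0, 0]) = Q" by (simp add: E_def Q)
  \<comment> \<open>Identifies the Randers metric built inside the locale from the coefficients of
    \<open>Q\<close> with the given one, so that the locale theorems transfer.\<close>
  then have F': "lie_group_frame.F (vector [q, 0, 0, 0]) E g = F"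
    by (simp add: F_def F)
  have "flag_curvature A F p (span {U p, V p}) (U p) =
          ((b * c' - c * b')\<^sup>2 + (b * d' - d * b')\<^sup>2 + (c * d' - d * c')\<^sup>2) / (4 * (1 + a * q)\<^sup>2)"
    if U: "U = a *\<^sub>R X + b *\<^sub>R Y + c *\<^sub>R Z + d *\<^sub>R W" and V: "V = a' *\<^sub>R X + b' *\<^sub>R Y + c' *\<^sub>R Z + d' *\<^sub>R W"
      and UV: "orthonormal_at g e [U, V]" for a b c d a' b' c' d' U V p
  proof -
    define u v :: "real^4" where "u = vector [a, b, c, d]" and "v = vector [a', b', c', d']"
    have E: "U = E u" "V = E v" by (simp_all add: U V E_def u_def v_def)
    have uv: "u \<bullet> u = 1" "u \<bullet> v = 0" "v \<bullet> v = 1"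
      using UV unfolding orthonormal_at_def E by (simp_all add: All_less_Suc gE')
    have "u \<noteq> 0" "v \<noteq> r *\<^sub>R u" for r
      using uv by (auto simp: inner_commute)
    then have "flag_curvature A F p (span {U p, V p}) (U p) = flagK u v"
      unfolding E F'[symmetric] by (rule flag_curvature_E)
    also have "\<dots> = ((b * c' - c * b')\<^sup>2 + (b * d' - d * b')\<^sup>2 + (c * d' - d * c')\<^sup>2) / (4 * (1 + a * q)\<^sup>2)"
    proof -
      \<comment> \<open>For an orthonormal pair the Gram determinant is 1 and the Randers norm of
        \<open>u\<close> is \<open>1 + a * q\<close>, so \<open>flagK\<close> reduces to this
        squared bracket over \<open>4 * (1 + a * q)^2\<close>.\<close>
      have "su2_bracket u v \<bullet> su2_bracket u v = (b * c' - c * b')\<^sup>2 + (b * d' - d * b')\<^sup>2 + (c * d' - d * c')\<^sup>2"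
        unfolding inner_4 by (simp add: u_def v_def power2_eq_square algebra_simps)
      moreover have "vector [q, 0, 0, 0] \<bullet> u = a * q"
        unfolding inner_4 by (simp add: u_def mult.commute)
      moreover have "norm u = 1" using uv(1) by (simp add: norm_eq_sqrt_inner)
      ultimately show ?thesis
        by (simp add: flagK_def power2_norm_eq_inner uv)
    qed
    finally show ?thesis .
  qed
  then show ?thesis
    using F_berwald F_geodesically_complete F_nonneg_flag_curvature unfolding F' by auto
qed

end
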